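(* Let $N\ge1$. (i) Let $-1\le\gamma<0$. There exists a $C^\infty$ function $u\in\dot W^{1,1}(\mathbb R^N)$ that is rapidly decreasing (i.e. $\sup_x|x|^k|u(x)|<\infty$ for every $k\ge0$) such that $\lim_{\lambda\to0^+}\lambda\,\nu_\gamma(E_{\lambda,\gamma}[u])=\infty$. (ii) Let $-1\le\gamma<0$. There exists a compactly supported $u\in W^{1,1}(\mathbb R^N)$ with $\lim_{\lambda\to0^+}\lambda\,\nu_\gamma(E_{\lambda,\gamma}[u])=\infty$. Moreover the set $\{u\in W^{1,1}(\mathbb R^N):\limsup_{\lambda\to0^+}\lambda\,\nu_\gamma(E_{\lambda,\gamma}[u])<\infty\}$ is meager (of first Baire category) in $W^{1,1}(\mathbb R^N)$. (iii) Suppose either $-1\le\gamma<0$ and $N\ge2$, or $-1<\gamma<0$ and $N=1$. There exists a compactly supported $u\in W^{1,1}(\mathbb R^N)$ such that $\nu_\gamma(E_{\lambda,\gamma}[u])=\infty$ for all $\lambda>0$. Moreover the set $\{u\in W^{1,1}(\mathbb R^N):\nu_\gamma(E_{\lambda,\gamma}[u])<\infty\text{ for some }\lambda\in(0,\infty)\}$ is meager in $W^{1,1}(\mathbb R^N)$.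
   Context: For $N\ge1$ and $\gamma\in\mathbb R$, $\nu_\gamma(E)=\iint_{(x,y)\in E,\,x\ne y}|x-y|^{\gamma-N}\,dx\,dy$ for measurable $E\subset\mathbb R^N\times\mathbb R^N$. For measurable $u$, $E_{\lambda,\gamma}[u]=\{(x,y):x\ne y,\ \frac{|u(x)-u(y)|}{|x-y|^{1+\gamma}}>\lambda\}$. $\dot W^{1,1}(\mathbb R^N)$: locally integrable functions with distributional gradient in $L^1$; $W^{1,1}(\mathbb R^N)=\dot W^{1,1}\cap L^1$ with norm $\|u\|_{L^1}+\|\nabla u\|_{L^1}$ (a Banach space). *)

theory Defs
  imports "HOL-Analysis.Analysis"
begin

text \<open>C-infinity: all iterated partial derivatives exist everywhere and are continuous.\<close>
coinductive smooth_fun :: "(real^'n \<Rightarrow> real) \<Rightarrow> bool" where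
  "continuous_on UNIV f \<Longrightarrow>
   (\<forall>i. \<exists>g. (\<forall>x. ((\<lambda>t. f (x + t *\<^sub>R axis i 1)) has_real_derivative g x) (at 0)) \<and> smooth_fun g)
   \<Longrightarrow> smooth_fun f"

definition test_fun :: "(real^'n \<Rightarrow> real) \<Rightarrow> bool" where
  "test_fun \<phi> \<longleftrightarrow> smooth_fun \<phi> \<and> compact (closure {x. \<phi> x \<noteq> 0})"

definition weak_gradient :: "(real^'n \<Rightarrow> real) \<Rightarrow> (real^'n \<Rightarrow> real^'n) \<Rightarrow> bool" where
  "weak_gradient u g \<longleftrightarrow>
     (\<forall>\<phi> i \<psi>. test_fun \<phi> \<longrightarrow>
        (\<forall>x. ((\<lambda>t. \<phi> (x + t *\<^sub>R axis i 1)) has_real_derivative \<psi> x) (at 0)) \<longrightarrow>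
        (\<integral>x. u x * \<psi> x \<partial>lebesgue) = - (\<integral>x. g x $ i * \<phi> x \<partial>lebesgue))"

definition locally_integrable :: "(real^'n \<Rightarrow> real) \<Rightarrow> bool" where
  "locally_integrable u \<longleftrightarrow> (\<forall>K. compact K \<longrightarrow> set_integrable lebesgue K u)"

definition dotW11 :: "(real^'n \<Rightarrow> real) set" where
  "dotW11 = {u. locally_integrable u \<and>
                (\<exists>g. integrable lebesgue g \<and> weak_gradient u g)}"

definition W11 :: "(real^'n \<Rightarrow> real) set" where
  "W11 = {u. u \<in> dotW11 \<and> integrable lebesgue u}"

definition wgrad :: "(real^'n \<Rightarrow> real) \<Rightarrow> real^'n \<Rightarrow> real^'n" where
  "wgrad u = (SOME g. integrable lebesgue g \<and> weak_gradient u g)"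

definition W11_dist :: "(real^'n \<Rightarrow> real) \<Rightarrow> (real^'n \<Rightarrow> real) \<Rightarrow> real" where
  "W11_dist u v = (\<integral>x. \<bar>u x - v x\<bar> \<partial>lebesgue) + (\<integral>x. norm (wgrad u x - wgrad v x) \<partial>lebesgue)"

text \<open>Norm topology of W^{1,1} (on representatives; a.e.-equal functions are topologically
  indistinguishable).\<close>
definition W11_topology :: "(real^'n \<Rightarrow> real) topology" where
  "W11_topology = topology (\<lambda>U. U \<subseteq> W11 \<and>
      (\<forall>u\<in>U. \<exists>e>0. \<forall>v\<in>W11. W11_dist u v < e \<longrightarrow> v \<in> U))"

lemma istopology_W11:
  "istopology (\<lambda>U::(real^'n \<Rightarrow> real) set. U \<subseteq> W11 \<and>
      (\<forall>u\<in>U. \<exists>e>0. \<forall>v\<in>W11. W11_dist u v < e \<longrightarrow> v \<in> U))"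
proof -
  have 1: "\<exists>e>0. \<forall>v\<in>W11. W11_dist u v < e \<longrightarrow> v \<in> S \<inter> T"
    if h: "\<exists>e>0. \<forall>v\<in>W11. W11_dist u v < e \<longrightarrow> v \<in> S"
       "\<exists>e>0. \<forall>v\<in>W11. W11_dist u v < e \<longrightarrow> v \<in> T"
    for u :: "real^'n \<Rightarrow> real" and S T
  proof -
    obtain e1 e2 where "e1 > 0" "\<forall>v\<in>W11. W11_dist u v < e1 \<longrightarrow> v \<in> S"
      "e2 > 0" "\<forall>v\<in>W11. W11_dist u v < e2 \<longrightarrow> v \<in> T" using h by blast
    then show ?thesis by (intro exI[of _ "min e1 e2"]) auto
  qed
  show ?thesis unfolding istopology_def
  proof (rule conjI; intro allI impI)
    fix S T :: "(real^'n \<Rightarrow> real) set"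
    assume hS: "S \<subseteq> W11 \<and> (\<forall>u\<in>S. \<exists>e>0. \<forall>v\<in>W11. W11_dist u v < e \<longrightarrow> v \<in> S)"
      and hT: "T \<subseteq> W11 \<and> (\<forall>u\<in>T. \<exists>e>0. \<forall>v\<in>W11. W11_dist u v < e \<longrightarrow> v \<in> T)"
    have "\<forall>u\<in>S \<inter> T. \<exists>e>0. \<forall>v\<in>W11. W11_dist u v < e \<longrightarrow> v \<in> S \<inter> T"
    proof
      fix u assume "u \<in> S \<inter> T"
      then show "\<exists>e>0. \<forall>v\<in>W11. W11_dist u v < e \<longrightarrow> v \<in> S \<inter> T"
        using hS hT by (intro 1) auto
    qed
    then show "S \<inter> T \<subseteq> W11 \<and> (\<forall>u\<in>S \<inter> T. \<exists>e>0. \<forall>v\<in>W11. W11_dist u v < e \<longrightarrow> v \<in> S \<inter> T)"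
      using hS by blast
  next
    fix K :: "(real^'n \<Rightarrow> real) set set"
    assume hK: "\<forall>S\<in>K. S \<subseteq> W11 \<and> (\<forall>u\<in>S. \<exists>e>0. \<forall>v\<in>W11. W11_dist u v < e \<longrightarrow> v \<in> S)"
    have "\<forall>u\<in>\<Union>K. \<exists>e>0. \<forall>v\<in>W11. W11_dist u v < e \<longrightarrow> v \<in> \<Union>K"
    proof
      fix u assume "u \<in> \<Union>K"
      then obtain S where "S \<in> K" "u \<in> S" by blast
      then obtain e where "e > 0" "\<forall>v\<in>W11. W11_dist u v < e \<longrightarrow> v \<in> S" using hK by blast
      then show "\<exists>e>0. \<forall>v\<in>W11. W11_dist u v < e \<longrightarrow> v \<in> \<Union>K" using \<open>S \<in> K\<close> by blast
    qed
    then show "\<Union>K \<subseteq> W11 \<and> (\<forall>u\<in>\<Union>K. \<exists>e>0. \<forall>v\<in>W11. W11_dist u v < e \<longrightarrow> v \<in> \<Union>K)"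
      using hK by blast
  qed
qed

definition nowhere_dense_in :: "'a topology \<Rightarrow> 'a set \<Rightarrow> bool" where
  "nowhere_dense_in X A \<longleftrightarrow> A \<subseteq> topspace X \<and> X interior_of (X closure_of A) = {}"

definition meager_in :: "'a topology \<Rightarrow> 'a set \<Rightarrow> bool" where
  "meager_in X S \<longleftrightarrow> S \<subseteq> topspace X \<and>
     (\<exists>F::nat \<Rightarrow> 'a set. (\<forall>n. nowhere_dense_in X (F n)) \<and> S \<subseteq> (\<Union>n. F n))"

definition nu :: "real \<Rightarrow> ((real^'n) \<times> (real^'n)) set \<Rightarrow> ennreal" where
  "nu \<gamma> E = (\<integral>\<^sup>+ z. indicator {p \<in> E. fst p \<noteq> snd p} z
        * ennreal (dist (fst z) (snd z) powr (\<gamma> - real CARD('n))) \<partial>(lebesgue \<Otimes>\<^sub>M lebesgue))"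

definition Eset :: "real \<Rightarrow> real \<Rightarrow> (real^'n \<Rightarrow> real) \<Rightarrow> ((real^'n) \<times> (real^'n)) set" where
  "Eset lam \<gamma> u = {(x, y). x \<noteq> y \<and> \<bar>u x - u y\<bar> / dist x y powr (1 + \<gamma>) > lam}"

definition rapidly_decreasing :: "(real^'n \<Rightarrow> real) \<Rightarrow> bool" where
  "rapidly_decreasing u \<longleftrightarrow> (\<forall>k::real. k \<ge> 0 \<longrightarrow> (\<exists>C. \<forall>x. norm x powr k * \<bar>u x\<bar> \<le> C))"

definition compact_support :: "(real^'n \<Rightarrow> real) \<Rightarrow> bool" where
  "compact_support u \<longleftrightarrow> compact (closure {x. u x \<noteq> 0})"

end

theory Submission
  imports Defs
begin

text \<open>Let \<open>\<beta> = 1 + \<gamma> \<in> [0, 1)\<close>. A Cantor function of dimension \<open>\<beta>\<close> has increments of order \<open>s powr \<beta>\<close>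
  at distance \<open>s\<close>, for every scale \<open>s\<close>, near about \<open>s powr - \<beta>\<close> intervals of length \<open>s\<close>. Pairs of points at
  distance about \<open>s\<close> therefore contribute to \<open>nu\<close> an amount independent of \<open>s\<close>, whereas the total
  variation is \<open>1\<close>. Smoothing the Cantor function at depth \<open>K\<close> gives a block with \<open>nu \<gamma> (Eset lam \<gamma> u)\<close> of
  order \<open>K\<close> for a fixed level \<open>lam\<close> and with gradient bounded in \<open>L1\<close> independently of \<open>K\<close>. (For \<open>\<gamma> = -1\<close>
  the Cantor set degenerates to a point, and the block is a steep jump.)
  The functions asked for are sums of scaled blocks with disjoint supports.

  Meagerness follows from existence without completeness of \<open>W11\<close>: the sets of functions with a uniform
  bound on \<open>nu\<close> are closed by Fatou's lemma, and if \<open>w\<close> has infinite \<open>nu\<close>, then \<open>u\<close> and \<open>u + c * w\<close>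
  cannot both satisfy such a bound, by the triangle inequality.\<close>

section \<open>Smooth functions\<close>

text \<open>Write \<open>N\<close> for \<open>CARD('n)\<close>. A block of height \<open>c\<close>
  and scale \<open>r\<close> costs at most a constant times \<open>c * r ^ (N - 1)\<close> in total
  variation and is seen, up to the factor \<open>N + 1\<close>, by every level \<open>lam\<close>
  below \<open>c / r powr (1 + \<gamma>)\<close>. Its contribution to \<open>nu\<close> is made as
  large as desired through the depth, which affects neither quantity. Each existence claim thus
  reduces to a choice of heights and scales with summable costs. For a smooth rapidly decreasing
  function the supports are locally finite: unit scale, with centres going to infinity. For compact
  support the cubes shrink and accumulate at a point. Infinite \<open>nu\<close> at every level
  requires the detected levels to tend to infinity while the costs stay summable, and with scales at
  most 1 this is possible exactly if \<open>N + \<gamma> > 0\<close>. The excluded case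
  \<open>N = 1\<close>, \<open>\<gamma> = -1\<close> is a genuine obstruction: there elements of
  \<open>W11\<close> are essentially bounded and \<open>Eset\<close> asks for
  \<open>\<bar>u x - u y\<bar> > lam\<close>, which large levels satisfy only on a null set.\<close>

definition flat :: "nat \<Rightarrow> real \<Rightarrow> real" where
  "flat k t = (if t \<le> 0 then 0 else exp (- 1 / t) / t ^ k)"

lemma flat_nonneg: "0 \<le> flat k t"
  by (simp add: flat_def)

lemma flat_tendsto_0: "(flat k \<longlongrightarrow> 0) (at 0)"
proof -
  have "((\<lambda>t::real. inverse t ^ k / exp (inverse t)) \<longlongrightarrow> 0) (at_right 0)"
    using filterlim_compose[OF tendsto_power_div_exp_0 filterlim_inverse_at_top_right] .
  then have R: "(flat k \<longlongrightarrow> 0) (at_right 0)"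
    by (rule Lim_transform_eventually)
       (auto simp: eventually_at_filter flat_def exp_minus field_simps power_inverse)
  have L: "(flat k \<longlongrightarrow> 0) (at_left 0)"
    by (rule Lim_transform_eventually[OF tendsto_const])
       (auto simp: eventually_at_filter flat_def)
  show ?thesis using L R by (simp add: filterlim_split_at)
qed

text \<open>The power \<open>k\<close> is carried along so that the family is closed under
  differentiation up to linear combinations. At \<open>0\<close> the difference quotient of
  \<open>flat k\<close> is \<open>flat (Suc k)\<close>, so the derivative there is again an instance
  of \<open>flat_tendsto_0\<close>.\<close>

lemma flat_deriv:
  "(flat k has_real_derivative (flat (k + 2) t - real k * flat (k + 1) t)) (at t)"
proof -
  consider "t < 0" | "t = 0" | "t > 0" by linarith
  then show ?thesis
  proof cases
    case 1
    have "((\<lambda>_. 0) has_real_derivative 0) (at t)" by simp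
    then have "(flat k has_real_derivative 0) (at t)"
      by (rule has_field_derivative_transform_within_open[where S = "{..<0}"])
         (use 1 in \<open>auto simp: flat_def\<close>)
    then show ?thesis using 1 by (simp add: flat_def)
  next
    case 2
    have "((\<lambda>h. (flat k (0 + h) - flat k 0) / h) \<longlongrightarrow> 0) (at 0)"
      by (rule Lim_transform_eventually[OF flat_tendsto_0[of "Suc k"]])
         (auto simp: eventually_at_filter flat_def)
    then show ?thesis using 2 by (simp add: DERIV_def flat_def)
  next
    case 3
    have "((\<lambda>t. exp (- inverse t) * inverse t ^ k) has_real_derivative
        exp (- inverse t) * (inverse t * inverse t) * inverse t ^ k
        + exp (- inverse t) * (real k * inverse t ^ (k - 1) * - (inverse t * inverse t))) (at t)"
      using 3 by (auto intro!: derivative_eq_intros)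
    moreover have "exp (- inverse t) * (inverse t * inverse t) * inverse t ^ k
        + exp (- inverse t) * (real k * inverse t ^ (k - 1) * - (inverse t * inverse t))
        = flat (k + 2) t - real k * flat (k + 1) t"
      using 3 by (cases k) (simp_all add: flat_def divide_inverse power_inverse algebra_simps)
    ultimately have "((\<lambda>t. exp (- inverse t) * inverse t ^ k) has_real_derivative
        (flat (k + 2) t - real k * flat (k + 1) t)) (at t)" by simp
    then show ?thesis
      by (rule has_field_derivative_transform_within_open[where S = "{0<..}"])
         (use 3 in \<open>auto simp: flat_def divide_inverse power_inverse\<close>)
  qed
qed

text \<open>Coinduction up to algebraic operations: this class contains \<open>smooth_fun\<close> and is closed under partial
  derivatives, hence it equals \<open>smooth_fun\<close>.\<close>
inductive smooth_gen :: "(real^'n \<Rightarrow> real) \<Rightarrow> bool" where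
  base: "smooth_fun f \<Longrightarrow> smooth_gen f"
| const: "smooth_gen (\<lambda>x. c)"
| flat: "smooth_gen (\<lambda>x. flat k (x $ i))"
| affine: "smooth_gen f \<Longrightarrow> smooth_gen (\<lambda>x. f (s *\<^sub>R x + q))"
| add: "smooth_gen f \<Longrightarrow> smooth_gen g \<Longrightarrow> smooth_gen (\<lambda>x. f x + g x)"
| mult: "smooth_gen f \<Longrightarrow> smooth_gen g \<Longrightarrow> smooth_gen (\<lambda>x. f x * g x)"
| inverse: "smooth_gen f \<Longrightarrow> (\<forall>x. f x \<noteq> 0) \<Longrightarrow> smooth_gen (\<lambda>x. inverse (f x))"

definition partial_deriv :: "'n \<Rightarrow> (real^'n \<Rightarrow> real) \<Rightarrow> (real^'n \<Rightarrow> real) \<Rightarrow> bool" where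
  "partial_deriv i f g \<longleftrightarrow> (\<forall>x. ((\<lambda>t. f (x + t *\<^sub>R axis i 1)) has_real_derivative g x) (at 0))"

lemma partial_deriv_unique: "partial_deriv i f g \<Longrightarrow> partial_deriv i f h \<Longrightarrow> g = h"
  unfolding partial_deriv_def using DERIV_unique by blast

lemma partial_deriv_add:
  "partial_deriv i f f' \<Longrightarrow> partial_deriv i g g' \<Longrightarrow> partial_deriv i (\<lambda>x. f x + g x) (\<lambda>x. f' x + g' x)"
  unfolding partial_deriv_def by (auto intro!: derivative_eq_intros)

lemma partial_deriv_mult:
  "partial_deriv i f f' \<Longrightarrow> partial_deriv i g g' \<Longrightarrow>
   partial_deriv i (\<lambda>x. f x * g x) (\<lambda>x. f' x * g x + f x * g' x)"
  unfolding partial_deriv_def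
  by (safe, drule_tac x=x in spec, drule_tac x=x in spec, drule (1) DERIV_mult) (simp add: algebra_simps)

lemma partial_deriv_const: "partial_deriv i (\<lambda>x. c) (\<lambda>x. 0)"
  unfolding partial_deriv_def by auto

lemma partial_deriv_affine:
  assumes "partial_deriv i f f'"
  shows "partial_deriv i (\<lambda>x. f (s *\<^sub>R x + q)) (\<lambda>x. s * f' (s *\<^sub>R x + q))"
  unfolding partial_deriv_def
proof
  fix x
  have 1: "((\<lambda>t. f ((s *\<^sub>R x + q) + t *\<^sub>R axis i 1)) has_real_derivative f' (s *\<^sub>R x + q)) (at (s * 0))"
    using assms unfolding partial_deriv_def by simp
  have "((\<lambda>t. f ((s *\<^sub>R x + q) + (s * t) *\<^sub>R axis i 1)) has_real_derivative f' (s *\<^sub>R x + q) * s) (at 0)"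
    by (rule DERIV_chain2[where f="\<lambda>t. f ((s *\<^sub>R x + q) + t *\<^sub>R axis i 1)" and g="(*) s", OF 1])
       (auto intro!: derivative_eq_intros)
  then show "((\<lambda>t. f (s *\<^sub>R (x + t *\<^sub>R axis i 1) + q)) has_real_derivative s * f' (s *\<^sub>R x + q)) (at 0)"
    by (simp add: algebra_simps)
qed

lemma partial_deriv_inverse:
  assumes "partial_deriv i f f'" "\<forall>x. f x \<noteq> 0"
  shows "partial_deriv i (\<lambda>x. inverse (f x)) (\<lambda>x. - 1 * (f' x * (inverse (f x) * inverse (f x))))"
  using assms unfolding partial_deriv_def
  by (safe, drule_tac x=x in spec, drule_tac DERIV_inverse')
     (auto simp: algebra_simps)

lemma partial_deriv_coord:
  assumes "\<And>t. (f has_real_derivative f' t) (at t)"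
  shows "partial_deriv i (\<lambda>x. f (x $ j)) (\<lambda>x. if i = j then f' (x $ j) else 0)"
  unfolding partial_deriv_def
proof
  fix x :: "real^'a"
  have "((\<lambda>t. f (t + x $ j)) has_real_derivative f' (x $ j)) (at 0)"
    using assms DERIV_shift[of f "f' (x $ j)" 0 "x $ j"] by simp
  then show "((\<lambda>t. f ((x + t *\<^sub>R axis i 1) $ j)) has_real_derivative (if i = j then f' (x $ j) else 0)) (at 0)"
    by (auto simp: axis_def add.commute)
qed

lemma smooth_fun_continuous: "smooth_fun f \<Longrightarrow> continuous_on UNIV f"
  by (auto elim: smooth_fun.cases)

lemma smooth_fun_partial: "smooth_fun f \<Longrightarrow> \<exists>g. partial_deriv i f g \<and> smooth_fun g"
  unfolding partial_deriv_def by (auto elim: smooth_fun.cases)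

lemma smooth_gen_step:
  fixes f :: "real^'n \<Rightarrow> real"
  shows "smooth_gen f \<Longrightarrow> continuous_on UNIV f \<and> (\<forall>i. \<exists>g. partial_deriv i f g \<and> smooth_gen g)"
proof (induction rule: smooth_gen.induct)
  case (base f)
  then show ?case using smooth_fun_continuous smooth_fun_partial smooth_gen.base by blast
next
  case (const c)
  then show ?case by (intro conjI allI exI[of _ "\<lambda>x. 0"] continuous_on_const partial_deriv_const smooth_gen.const)
next
  case (flat k j)
  have "continuous_on UNIV (flat k)"
    using flat_deriv DERIV_isCont continuous_at_imp_continuous_on by blast
  then have "continuous_on UNIV (\<lambda>x::real^'n. flat k (x $ j))"
    by (rule continuous_on_compose2) (auto intro!: continuous_intros)
  moreover have "\<exists>g. partial_deriv i (\<lambda>x::real^'n. flat k (x $ j)) g \<and> smooth_gen g" for i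
  proof (cases "i = j")
    case True
    have "smooth_gen (\<lambda>x::real^'n. flat (k + 2) (x $ j) + (- real k) * flat (k + 1) (x $ j))"
      by (rule smooth_gen.add[OF smooth_gen.flat smooth_gen.mult[OF smooth_gen.const smooth_gen.flat]])
    with True partial_deriv_coord[OF flat_deriv, of i k j] show ?thesis
      by (intro exI conjI) simp_all
  next
    case False
    with partial_deriv_coord[OF flat_deriv, of i k j]
    have "partial_deriv i (\<lambda>x::real^'n. flat k (x $ j)) (\<lambda>x. 0)" by simp
    then show ?thesis using smooth_gen.const[of 0] by (intro exI conjI)
  qed
  ultimately show ?case by simp
next
  case (affine f s q)
  have "continuous_on UNIV (\<lambda>x. f (s *\<^sub>R x + q))"
    by (rule continuous_on_compose2[of UNIV f]) (use affine in \<open>auto intro!: continuous_intros\<close>)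
  moreover have "\<exists>g. partial_deriv i (\<lambda>x. f (s *\<^sub>R x + q)) g \<and> smooth_gen g" for i
  proof -
    obtain f' where h: "partial_deriv i f f'" "smooth_gen f'"
      using affine.IH by blast
    have "smooth_gen (\<lambda>x. s * f' (s *\<^sub>R x + q))"
      by (rule smooth_gen.mult[OF smooth_gen.const smooth_gen.affine[OF h(2)]])
    then show ?thesis using partial_deriv_affine[OF h(1)] by blast
  qed
  ultimately show ?case by simp
next
  case (add f g)
  have "\<exists>h. partial_deriv i (\<lambda>x. f x + g x) h \<and> smooth_gen h" for i
  proof -
    obtain f' g' where "partial_deriv i f f'" "smooth_gen f'" "partial_deriv i g g'" "smooth_gen g'"
      using add.IH by blast
    then show ?thesis using partial_deriv_add smooth_gen.add by blast
  qed
  then show ?case using add.IH by (simp add: continuous_on_add)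
next
  case (mult f g)
  have "\<exists>h. partial_deriv i (\<lambda>x. f x * g x) h \<and> smooth_gen h" for i
  proof -
    obtain f' g' where h: "partial_deriv i f f'" "smooth_gen f'" "partial_deriv i g g'" "smooth_gen g'"
      using mult.IH by blast
    have "smooth_gen (\<lambda>x. f' x * g x + f x * g' x)"
      by (rule smooth_gen.add[OF smooth_gen.mult[OF h(2) mult.hyps(2)] smooth_gen.mult[OF mult.hyps(1) h(4)]])
    then show ?thesis using partial_deriv_mult[OF h(1,3)] by blast
  qed
  then show ?case using mult.IH by (simp add: continuous_on_mult)
next
  case (inverse f)
  have "\<exists>h. partial_deriv i (\<lambda>x. inverse (f x)) h \<and> smooth_gen h" for i
  proof -
    obtain f' where h: "partial_deriv i f f'" "smooth_gen f'"
      using inverse.IH by blast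
    have r: "smooth_gen (\<lambda>x. inverse (f x))"
      by (rule smooth_gen.inverse[OF inverse.hyps])
    have "smooth_gen (\<lambda>x. - 1 * (f' x * (inverse (f x) * inverse (f x))))"
      by (rule smooth_gen.mult[OF smooth_gen.const smooth_gen.mult[OF h(2) smooth_gen.mult[OF r r]]])
    then show ?thesis using partial_deriv_inverse[OF h(1) inverse.hyps(2)] by blast
  qed
  then show ?case using inverse by (simp add: continuous_on_inverse)
qed

lemma smooth_gen_smooth: "smooth_gen f \<Longrightarrow> smooth_fun f"
proof (coinduction arbitrary: f rule: smooth_fun.coinduct)
  case (smooth_fun f)
  from smooth_gen_step[OF this] have "continuous_on UNIV f"
    "\<forall>i. \<exists>g. (\<forall>x. ((\<lambda>t. f (x + t *\<^sub>R axis i 1)) has_real_derivative g x) (at 0)) \<and> smooth_gen g"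
    unfolding partial_deriv_def by simp_all
  then show ?case by (intro exI[of _ f] conjI refl) (assumption, meson)
qed

lemma smooth_fun_const: "smooth_fun (\<lambda>x. c)"
  by (rule smooth_gen_smooth[OF smooth_gen.const])

lemma smooth_fun_flat: "smooth_fun (\<lambda>x. flat k (x $ i))"
  by (rule smooth_gen_smooth[OF smooth_gen.flat])

lemma smooth_fun_affine: "smooth_fun f \<Longrightarrow> smooth_fun (\<lambda>x. f (s *\<^sub>R x + q))"
  by (rule smooth_gen_smooth[OF smooth_gen.affine[OF smooth_gen.base]])

lemma smooth_fun_add: "smooth_fun f \<Longrightarrow> smooth_fun g \<Longrightarrow> smooth_fun (\<lambda>x. f x + g x)"
  by (rule smooth_gen_smooth[OF smooth_gen.add[OF smooth_gen.base smooth_gen.base]])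

lemma smooth_fun_mult: "smooth_fun f \<Longrightarrow> smooth_fun g \<Longrightarrow> smooth_fun (\<lambda>x. f x * g x)"
  by (rule smooth_gen_smooth[OF smooth_gen.mult[OF smooth_gen.base smooth_gen.base]])

lemma smooth_fun_divide:
  "smooth_fun f \<Longrightarrow> smooth_fun g \<Longrightarrow> (\<forall>x. g x \<noteq> 0) \<Longrightarrow> smooth_fun (\<lambda>x. f x / g x)"
  unfolding divide_inverse
  by (rule smooth_gen_smooth[OF smooth_gen.mult[OF smooth_gen.base smooth_gen.inverse[OF smooth_gen.base]]])

lemma smooth_fun_sum: "(\<And>j. j \<in> I \<Longrightarrow> smooth_fun (f j)) \<Longrightarrow> smooth_fun (\<lambda>x. \<Sum>j\<in>I. f j x)"
  by (induction I rule: infinite_finite_induct) (auto intro: smooth_fun_const smooth_fun_add)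

lemma smooth_fun_prod: "(\<And>j. j \<in> I \<Longrightarrow> smooth_fun (f j)) \<Longrightarrow> smooth_fun (\<lambda>x. \<Prod>j\<in>I. f j x)"
  by (induction I rule: infinite_finite_induct) (auto intro: smooth_fun_const smooth_fun_mult)

text \<open>Used for an infinite sum of blocks, which near each point is a single block. The local
  property itself is the coinduction invariant: partial derivatives of the local representatives
  agree on the balls with those of \<open>f\<close>, so they glue to one function that again has the
  property.\<close>

lemma smooth_fun_local:
  fixes f :: "real^'n \<Rightarrow> real"
  assumes "\<forall>x. \<exists>e>0. \<exists>h. smooth_fun h \<and> (\<forall>y\<in>ball x e. f y = h y)"
  shows "smooth_fun f"
  using assms
proof (coinduction arbitrary: f rule: smooth_fun.coinduct)
  case (smooth_fun f)
  have eq: "(\<forall>y\<in>ball x e. f y = h y) \<Longrightarrow> 0 < e \<Longrightarrow> partial_deriv i h g \<Longrightarrow> z \<in> ball x e \<Longrightarrow>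
    ((\<lambda>t. f (z + t *\<^sub>R axis i 1)) has_real_derivative g z) (at 0)" for x e h i g z
  proof -
    assume a: "\<forall>y\<in>ball x e. f y = h y" "0 < e" "partial_deriv i h g" "z \<in> ball x e"
    have "((\<lambda>t. h (z + t *\<^sub>R axis i 1)) has_real_derivative g z) (at 0)"
      using a(3) unfolding partial_deriv_def by blast
    moreover have "open ((\<lambda>t::real. z + t *\<^sub>R axis i 1) -` ball x e)"
      by (rule open_vimage) (auto intro!: continuous_intros)
    ultimately show ?thesis
      by (rule has_field_derivative_transform_within_open[where S="(\<lambda>t. z + t *\<^sub>R axis i 1) -` ball x e"])
         (use a in auto)
  qed
  have "continuous (at x) f" for x
  proof -
    obtain e h where eh: "e > 0" "smooth_fun h" "\<forall>y\<in>ball x e. f y = h y" using smooth_fun by blast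
    have "isCont h x" using smooth_fun_continuous[OF eh(2)] continuous_on_eq_continuous_at open_UNIV by blast
    then show ?thesis
      using continuous_transform_within_openin[of x UNIV h "ball x e" f] eh by auto
  qed
  then have 1: "continuous_on UNIV f" by (simp add: continuous_at_imp_continuous_on)
  have "\<exists>g. partial_deriv i f g \<and> (\<forall>x. \<exists>e>0. \<exists>h. smooth_fun h \<and> (\<forall>y\<in>ball x e. g y = h y))" for i
  proof -
    have "\<exists>D. ((\<lambda>t. f (x + t *\<^sub>R axis i 1)) has_real_derivative D) (at 0)" for x
    proof -
      obtain e h where eh: "e > 0" "smooth_fun h" "\<forall>y\<in>ball x e. f y = h y" using smooth_fun by blast
      obtain g where "partial_deriv i h g" using smooth_fun_partial[OF eh(2)] by blast
      from eq[OF eh(3,1) this, of x] eh(1) show ?thesis by auto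
    qed
    then obtain g where g: "\<And>x. ((\<lambda>t. f (x + t *\<^sub>R axis i 1)) has_real_derivative g x) (at 0)" by metis
    have "\<exists>e>0. \<exists>h. smooth_fun h \<and> (\<forall>y\<in>ball x e. g y = h y)" for x
    proof -
      obtain e h where eh: "e > 0" "smooth_fun h" "\<forall>y\<in>ball x e. f y = h y" using smooth_fun by blast
      obtain h' where h': "partial_deriv i h h'" "smooth_fun h'" using smooth_fun_partial[OF eh(2)] by blast
      have "\<forall>y\<in>ball x e. g y = h' y"
        using eq[OF eh(3,1) h'(1)] g DERIV_unique by blast
      then show ?thesis using eh(1) h'(2) by blast
    qed
    then show ?thesis using g unfolding partial_deriv_def by (intro exI[of _ g] conjI allI)
  qed
  with 1 show ?case unfolding partial_deriv_def
    by (intro exI[of _ f] conjI refl) (assumption, meson)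
qed

section \<open>Integration by parts\<close>

lemma partial_deriv_at:
  assumes "partial_deriv i f g"
  shows "((\<lambda>t. f (x + t *\<^sub>R axis i 1)) has_real_derivative g (x + s *\<^sub>R axis i 1)) (at s)"
proof -
  have "((\<lambda>t. f (x + s *\<^sub>R axis i 1 + t *\<^sub>R axis i 1)) has_real_derivative g (x + s *\<^sub>R axis i 1)) (at 0)"
    using assms unfolding partial_deriv_def by blast
  then have "((\<lambda>t. f (x + (t + s) *\<^sub>R axis i 1)) has_real_derivative g (x + s *\<^sub>R axis i 1)) (at 0)"
    by (simp add: algebra_simps)
  then show ?thesis
    using DERIV_shift[of "\<lambda>t. f (x + t *\<^sub>R axis i 1)" _ 0 s] by simp
qed

lemma partial_deriv_zero_outside:
  assumes "partial_deriv i f g" "closed S" "\<And>x. x \<notin> S \<Longrightarrow> f x = 0" "x \<notin> S"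
  shows "g x = 0"
proof -
  have "open ((\<lambda>t::real. x + t *\<^sub>R axis i 1) -` (- S))"
    by (rule open_vimage) (use assms(2) in \<open>auto intro!: continuous_intros\<close>)
  then have "((\<lambda>t. f (x + t *\<^sub>R axis i 1)) has_real_derivative 0) (at 0)"
    by (rule has_field_derivative_transform_within_open[OF DERIV_const[of 0]]) (use assms(3,4) in auto)
  moreover have "((\<lambda>t. f (x + t *\<^sub>R axis i 1)) has_real_derivative g x) (at 0)"
    using assms(1) unfolding partial_deriv_def by (rule spec)
  ultimately show ?thesis by (metis DERIV_unique)
qed

lemma continuous_bounded_support:
  fixes f :: "'a::euclidean_space \<Rightarrow> real"
  assumes "continuous_on UNIV f" "\<And>x. x \<notin> S \<Longrightarrow> f x = 0" "compact S"
  obtains B where "B \<ge> 0" "\<And>x. \<bar>f x\<bar> \<le> B"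
proof -
  have "compact (f ` S)"
    using assms by (meson compact_continuous_image continuous_on_subset subset_UNIV)
  then obtain B where B: "\<And>x. x \<in> S \<Longrightarrow> norm (f x) \<le> B"
    using compact_imp_bounded bounded_iff by (metis imageI)
  show ?thesis
  proof (rule that[of "max 0 B"])
    show "\<bar>f x\<bar> \<le> max 0 B" for x
      using B[of x] assms(2)[of x] by (cases "x \<in> S") auto
  qed simp
qed

lemma integrable_bounded_support:
  fixes f :: "'a::euclidean_space \<Rightarrow> 'b::{banach, second_countable_topology}"
  assumes "f \<in> borel_measurable lborel" "\<And>x. norm (f x) \<le> B" "\<And>x. x \<notin> S \<Longrightarrow> f x = 0" "compact S"
  shows "integrable lborel f"
proof (rule Bochner_Integration.integrable_bound)
  show "integrable lborel (\<lambda>x. B * indicator S x)"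
    using assms(4) emeasure_bounded_finite[OF compact_imp_bounded[OF assms(4)]]
    by (intro integrable_mult_right integrable_real_indicator) (auto simp: compact_imp_closed)
  show "AE x in lborel. norm (f x) \<le> norm (B * indicator S x)"
  proof (rule AE_I2)
    show "norm (f x) \<le> norm (B * indicator S x)" for x
      using assms(2)[of x] assms(3)[of x] by (cases "x \<in> S") auto
  qed
qed (use assms in auto)

text \<open>Translation invariance takes the place of an iterated integral: every difference
  quotient of \<open>f\<close> integrates to zero. The quotients converge to \<open>g\<close>, and
  the mean value theorem bounds them by the supremum of \<open>g\<close>; steps of length at most 1
  keep their supports in the ball of radius \<open>R + 1\<close>, so dominated convergence
  applies.\<close>

lemma integral_partial_deriv_eq_0:
  fixes f :: "real^'n \<Rightarrow> real"
  assumes "partial_deriv i f g" "continuous_on UNIV f" "continuous_on UNIV g"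
    and supp: "\<And>x. norm x > R \<Longrightarrow> f x = 0"
  shows "integral\<^sup>L lborel g = 0"
proof -
  let ?e = "axis i 1 :: real^'n"
  define s :: "nat \<Rightarrow> real" where "s n = inverse (real (Suc n))" for n
  have s: "0 < s n" "s n \<le> 1" for n by (auto simp: s_def field_simps)
  have s0: "s \<longlonglongrightarrow> 0" unfolding s_def by (rule LIMSEQ_inverse_real_of_nat)
  define q where "q n x = (f (x + s n *\<^sub>R ?e) - f x) / s n" for n x
  have g0: "g x = 0" if "x \<notin> cball 0 R" for x
    by (rule partial_deriv_zero_outside[OF assms(1) _ _ that]) (use supp in auto)
  obtain B where B: "B \<ge> 0" "\<And>x. \<bar>g x\<bar> \<le> B"
    using continuous_bounded_support[OF assms(3) g0 compact_cball] by blast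
  have [measurable]: "f \<in> borel_measurable borel" "g \<in> borel_measurable borel"
    using assms by (auto intro: borel_measurable_continuous_onI)
  have fint: "integrable lborel f"
  proof -
    have f0: "f x = 0" if "x \<notin> cball 0 R" for x using supp that by simp
    obtain C where "\<And>x. \<bar>f x\<bar> \<le> C"
      using continuous_bounded_support[OF assms(2) f0 compact_cball] by blast
    then show ?thesis by (intro integrable_bounded_support[of f C "cball 0 R"]) (use supp in auto)
  qed
  have tr: "integrable lborel (\<lambda>x. f (x + a))" "(\<integral>x. f (x + a) \<partial>lborel) = integral\<^sup>L lborel f" for a
  proof -
    have d: "distr lborel borel (\<lambda>x::real^'n. x + a) = lborel"
      using lborel_distr_plus[of a] by (simp add: add.commute[of _ a])
    show "integrable lborel (\<lambda>x. f (x + a))"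
      using fint integrable_distr_eq[of "\<lambda>x. x + a" lborel borel f] by (simp add: d)
    show "(\<integral>x. f (x + a) \<partial>lborel) = integral\<^sup>L lborel f"
      using integral_distr[of "\<lambda>x. x + a" lborel borel f] by (simp add: d)
  qed
  have q0: "integral\<^sup>L lborel (q n) = 0" for n
    unfolding q_def using fint tr[of "s n *\<^sub>R ?e"] by simp
  have lim: "(\<lambda>n. integral\<^sup>L lborel (q n)) \<longlonglongrightarrow> integral\<^sup>L lborel g"
  proof (rule integral_dominated_convergence[where w="\<lambda>x. B * indicator (cball 0 (R + 1)) x"])
    show "integrable lborel (\<lambda>x::real^'n. B * indicator (cball 0 (R + 1)) x)"
      using emeasure_bounded_finite[OF bounded_cball, of "0::real^'n" "R + 1"]
      by (intro integrable_mult_right integrable_real_indicator) auto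
    show "AE x in lborel. (\<lambda>n. q n x) \<longlonglongrightarrow> g x"
    proof (rule AE_I2)
      fix x
      have "((\<lambda>h. (f (x + h *\<^sub>R ?e) - f x) / h) \<longlongrightarrow> g x) (at 0)"
        using assms(1) unfolding partial_deriv_def DERIV_def by simp
      moreover have "filterlim s (at 0) sequentially"
        using s0 s(1) by (simp add: filterlim_at less_imp_neq[symmetric])
      ultimately show "(\<lambda>n. q n x) \<longlonglongrightarrow> g x"
        unfolding q_def by (rule filterlim_compose)
    qed
    show "AE x in lborel. norm (q n x) \<le> B * indicator (cball 0 (R + 1)) x" for n
    proof (rule AE_I2)
      fix x
      show "norm (q n x) \<le> B * indicator (cball 0 (R + 1)) x"
      proof (cases "norm x \<le> R + 1")
        case True
        obtain z where "f (x + s n *\<^sub>R ?e) - f (x + 0 *\<^sub>R ?e) = (s n - 0) * g (x + z *\<^sub>R ?e)"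
          using MVT2[of 0 "s n" "\<lambda>t. f (x + t *\<^sub>R ?e)" "\<lambda>t. g (x + t *\<^sub>R ?e)"] partial_deriv_at[OF assms(1)] s(1) by blast
        then have "q n x = g (x + z *\<^sub>R ?e)" using s(1)[of n] by (simp add: q_def)
        then show ?thesis using B True by simp
      next
        case False
        have "norm x \<le> norm (x + s n *\<^sub>R ?e) + norm (s n *\<^sub>R ?e)"
          by (metis add_diff_cancel_right' norm_triangle_ineq4)
        also have "norm (s n *\<^sub>R ?e) \<le> 1" using s[of n] by simp
        finally have "norm (x + s n *\<^sub>R ?e) > R" using False by simp
        then show ?thesis using False supp by (simp add: q_def)
      qed
    qed
  qed (simp_all add: q_def[abs_def])
  show ?thesis using LIMSEQ_unique[OF lim] by (simp add: q0)
qed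

section \<open>Test functions, and classical gradients as weak gradients\<close>

lemma test_funD:
  fixes \<phi> :: "real^'n \<Rightarrow> real"
  assumes "test_fun \<phi>" "partial_deriv i \<phi> \<psi>"
  shows "smooth_fun \<phi>" "smooth_fun \<psi>"
    and "\<phi> \<in> borel_measurable borel" "\<psi> \<in> borel_measurable borel"
    and "\<exists>R B. (\<forall>x. R < norm x \<longrightarrow> \<phi> x = 0 \<and> \<psi> x = 0) \<and> (\<forall>x. \<bar>\<phi> x\<bar> \<le> B \<and> \<bar>\<psi> x\<bar> \<le> B)"
proof -
  show s: "smooth_fun \<phi>" "smooth_fun \<psi>"
    using assms(1) smooth_fun_partial[of \<phi> i] partial_deriv_unique[OF assms(2)]
    unfolding test_fun_def by auto
  then show "\<phi> \<in> borel_measurable borel" "\<psi> \<in> borel_measurable borel"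
    by (simp_all add: borel_measurable_continuous_onI smooth_fun_continuous)
  let ?K = "closure {x. \<phi> x \<noteq> 0}"
  have K: "compact ?K" using assms(1) by (simp add: test_fun_def)
  have \<phi>0: "\<phi> x = 0" if "x \<notin> ?K" for x using that closure_subset[of "{x. \<phi> x \<noteq> 0}"] by auto
  have \<psi>0: "\<psi> x = 0" if "x \<notin> ?K" for x
    using partial_deriv_zero_outside[OF assms(2) compact_imp_closed[OF K] \<phi>0 that] .
  obtain B1 where B1: "\<And>x. \<bar>\<phi> x\<bar> \<le> B1"
    using continuous_bounded_support[OF smooth_fun_continuous[OF s(1)] \<phi>0 K] by blast
  obtain B2 where B2: "\<And>x. \<bar>\<psi> x\<bar> \<le> B2"
    using continuous_bounded_support[OF smooth_fun_continuous[OF s(2)] \<psi>0 K] by blast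
  obtain R where "\<And>x. x \<in> ?K \<Longrightarrow> norm x \<le> R" using K compact_imp_bounded bounded_iff by metis
  then have "\<forall>x. R < norm x \<longrightarrow> \<phi> x = 0 \<and> \<psi> x = 0" using \<phi>0 \<psi>0 by (meson not_le)
  then show "\<exists>R B. (\<forall>x. R < norm x \<longrightarrow> \<phi> x = 0 \<and> \<psi> x = 0) \<and> (\<forall>x. \<bar>\<phi> x\<bar> \<le> B \<and> \<bar>\<psi> x\<bar> \<le> B)"
    using B1 B2 by (intro exI[of _ R] exI[of _ "max B1 B2"]) (simp add: le_max_iff_disj)
qed

lemma weak_gradient_iff:
  "weak_gradient u g \<longleftrightarrow> (\<forall>\<phi> i \<psi>. test_fun \<phi> \<longrightarrow> partial_deriv i \<phi> \<psi> \<longrightarrow>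
     (\<integral>x. u x * \<psi> x \<partial>lebesgue) = - (\<integral>x. g x $ i * \<phi> x \<partial>lebesgue))"
  unfolding weak_gradient_def partial_deriv_def by (rule refl)

text \<open>The product of \<open>v\<close> with a test function has compact support, so the
  integral of its partial derivative vanishes; the product rule splits that integral. All integrands
  are continuous, so the computation takes place in \<open>lborel\<close> and is moved to
  \<open>lebesgue\<close> by completion.\<close>

lemma weak_gradient_smooth:
  fixes v :: "real^'n \<Rightarrow> real"
  assumes "smooth_fun v" and g: "\<And>i. partial_deriv i v (\<lambda>x. g x $ i)"
  shows "weak_gradient v g"
  unfolding weak_gradient_iff
proof (intro allI impI)
  fix \<phi> :: "real^'n \<Rightarrow> real" and i \<psi> assume \<phi>: "test_fun \<phi>" and \<psi>: "partial_deriv i \<phi> \<psi>"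
  note t = test_funD[OF \<phi> \<psi>]
  have sg: "smooth_fun (\<lambda>x. g x $ i)"
    using smooth_fun_partial[OF assms(1), of i] partial_deriv_unique[OF g[of i]] by auto
  obtain R where R: "\<forall>x. R < norm x \<longrightarrow> \<phi> x = 0 \<and> \<psi> x = 0" using t(5) by blast
  note c = smooth_fun_continuous[OF assms(1)] smooth_fun_continuous[OF sg]
    smooth_fun_continuous[OF t(1)] smooth_fun_continuous[OF t(2)]
  have I: "integrable lborel h"
    if h: "continuous_on UNIV h" and hR: "\<And>x. R < norm x \<Longrightarrow> h x = 0" for h :: "real^'n \<Rightarrow> real"
  proof -
    have h0: "h x = 0" if "x \<notin> cball 0 R" for x using hR that by simp
    obtain C where "\<And>x. \<bar>h x\<bar> \<le> C"
      using continuous_bounded_support[OF h h0 compact_cball] by blast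
    then show ?thesis
      using h h0 by (intro integrable_bounded_support[of h C "cball 0 R"])
        (simp_all add: borel_measurable_continuous_onI)
  qed
  have m: "(\<lambda>x. v x * \<psi> x) \<in> borel_measurable lborel" "(\<lambda>x. g x $ i * \<phi> x) \<in> borel_measurable lborel"
    using c by (auto intro!: borel_measurable_continuous_onI continuous_on_mult)
  have "integral\<^sup>L lborel (\<lambda>x. g x $ i * \<phi> x + v x * \<psi> x) = 0"
    by (rule integral_partial_deriv_eq_0[where R=R, OF partial_deriv_mult[OF g \<psi>]])
       (use c R in \<open>auto intro!: continuous_on_mult continuous_on_add\<close>)
  also have "integral\<^sup>L lborel (\<lambda>x. g x $ i * \<phi> x + v x * \<psi> x) =
     integral\<^sup>L lborel (\<lambda>x. g x $ i * \<phi> x) + integral\<^sup>L lborel (\<lambda>x. v x * \<psi> x)"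
    by (intro Bochner_Integration.integral_add I) (use c R in \<open>auto intro!: continuous_on_mult\<close>)
  finally show "(\<integral>x. v x * \<psi> x \<partial>lebesgue) = - (\<integral>x. g x $ i * \<phi> x \<partial>lebesgue)"
    unfolding integral_completion[OF m(1)] integral_completion[OF m(2)] by linarith
qed

section \<open>Smooth cutoffs and uniqueness of weak gradients\<close>

text \<open>The standard smooth transition. Its values are exactly 0 up to 0 and exactly 1 from 1
  on, so that rescaled copies serve both as cutoffs with a plateau and as the individual rises of
  the Cantor functions.\<close>

definition step :: "real \<Rightarrow> real" where
  "step t = flat 0 t / (flat 0 t + flat 0 (1 - t))"

lemma flat0_pos: "t > 0 \<Longrightarrow> flat 0 t > 0"
  by (simp add: flat_def)

lemma flat0_mono: "s \<le> t \<Longrightarrow> flat 0 s \<le> flat 0 t"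
  by (auto simp: flat_def field_simps)

lemma step_denom_pos: "flat 0 t + flat 0 (1 - t) > 0"
  using flat_nonneg[of 0 t] flat_nonneg[of 0 "1 - t"] flat0_pos[of t] flat0_pos[of "1 - t"]
  by (cases "t > 0") auto

lemma step_nonpos: "t \<le> 0 \<Longrightarrow> step t = 0"
  by (simp add: step_def flat_def)

lemma step_ge_1: "t \<ge> 1 \<Longrightarrow> step t = 1"
  using step_denom_pos[of t] by (simp add: step_def flat_def)

lemma step_bounds: "0 \<le> step t" "step t \<le> 1"
  using step_denom_pos[of t] flat_nonneg[of 0 t] flat_nonneg[of 0 "1 - t"]
  by (simp_all add: step_def)

lemma step_mono: "s \<le> t \<Longrightarrow> step s \<le> step t"
proof -
  assume st: "s \<le> t"
  have "flat 0 s * flat 0 (1 - t) \<le> flat 0 t * flat 0 (1 - s)"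
    using st by (intro mult_mono flat0_mono flat_nonneg) auto
  then show ?thesis
    using step_denom_pos[of s] step_denom_pos[of t]
    by (simp add: step_def field_simps)
qed

lemma smooth_fun_step: "smooth_fun (\<lambda>x::real^'n. step (a * x $ i + b))"
proof -
  have "smooth_fun (\<lambda>x::real^'n. flat 0 (((-1) *\<^sub>R x + axis i 1) $ i))"
    by (rule smooth_fun_affine[OF smooth_fun_flat])
  then have 1: "smooth_fun (\<lambda>x::real^'n. flat 0 (1 - x $ i))" by simp
  have "smooth_fun (\<lambda>x::real^'n. step (x $ i))"
    unfolding step_def using step_denom_pos
    by (intro smooth_fun_divide smooth_fun_add smooth_fun_flat 1) (metis less_irrefl)
  from smooth_fun_affine[OF this, of a "axis i b"] show ?thesis by simp
qed

text \<open>As \<open>c\<close> grows, these functions tend pointwise to the indicator of the open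
  box, because \<open>step\<close> vanishes at 0. The arguments are written in the affine form of
  \<open>smooth_fun_step\<close>.\<close>

lemma test_fun_box:
  "test_fun (\<lambda>x::real^'n. \<Prod>i\<in>UNIV. step (c * x $ i + - c * a $ i) * step (- c * x $ i + c * b $ i))"
  (is "test_fun ?f") if "c > 0"
proof -
  have "?f x = 0" if nx: "x \<notin> cbox a b" for x
  proof -
    obtain i where "x $ i < a $ i \<or> b $ i < x $ i" using nx unfolding mem_box_cart not_all de_Morgan_conj not_le by blast
    then have "step (c * x $ i + - c * a $ i) * step (- c * x $ i + c * b $ i) = 0"
      using \<open>c > 0\<close> by (auto simp: step_nonpos)
    then show ?thesis by (intro prod_zero) auto
  qed
  then have "closure {x. ?f x \<noteq> 0} \<subseteq> cbox a b"
    by (intro closure_minimal) (auto simp: closed_cbox)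
  then have "compact (closure {x. ?f x \<noteq> 0})"
    by (meson bounded_subset bounded_cbox closed_closure compact_eq_bounded_closed)
  moreover have "smooth_fun ?f"
    by (intro smooth_fun_prod smooth_fun_mult smooth_fun_step)
  ultimately show ?thesis by (simp add: test_fun_def)
qed

lemma step_scaled_tendsto: "(\<lambda>n. step (real (Suc n) * t)) \<longlonglongrightarrow> (if t > 0 then 1 else 0)"
proof (cases "t > 0")
  case True
  obtain N where N: "1 < real N * t" using reals_Archimedean3[OF True] by blast
  have "eventually (\<lambda>n. step (real (Suc n) * t) = 1) sequentially"
  proof (rule eventually_sequentiallyI[of N])
    fix n assume "N \<le> n"
    then have "real N * t \<le> real (Suc n) * t" using True by (intro mult_right_mono) auto
    then show "step (real (Suc n) * t) = 1" using N by (intro step_ge_1) simp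
  qed
  then show ?thesis using True by (simp add: tendsto_eventually)
next
  case False
  then have "step (real (Suc n) * t) = 0" for n
    by (intro step_nonpos) (simp add: mult_nonneg_nonpos)
  then show ?thesis using False by simp
qed

lemma integral_box_eq_0:
  fixes g :: "real^'n \<Rightarrow> real"
  assumes g: "integrable lebesgue g" and 0: "\<And>\<phi>. test_fun \<phi> \<Longrightarrow> (\<integral>x. g x * \<phi> x \<partial>lebesgue) = 0"
  shows "(\<integral>x. g x * indicator (box a b) x \<partial>lebesgue) = 0"
proof -
  define \<phi> where "\<phi> n x = (\<Prod>i\<in>UNIV. step (real (Suc n) * x $ i + - real (Suc n) * a $ i) *
     step (- real (Suc n) * x $ i + real (Suc n) * b $ i))" for n and x :: "real^'n"
  have t: "test_fun (\<phi> n)" for n unfolding \<phi>_def[abs_def] by (rule test_fun_box) simp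
  have lim: "(\<lambda>n. \<phi> n x) \<longlonglongrightarrow> indicator (box a b) x" for x
  proof -
    have "(\<lambda>n. \<phi> n x) \<longlonglongrightarrow> (\<Prod>i\<in>UNIV. (if x $ i - a $ i > 0 then 1 else 0) * (if b $ i - x $ i > 0 then 1 else 0))"
      unfolding \<phi>_def
      using step_scaled_tendsto[of "x $ _ - a $ _"] step_scaled_tendsto[of "b $ _ - x $ _"]
      by (intro tendsto_prod tendsto_mult) (simp_all add: algebra_simps)
    also have "(\<Prod>i\<in>UNIV. (if x $ i - a $ i > 0 then 1 else 0) * (if b $ i - x $ i > 0 then 1 else 0)) = (indicator (box a b) x :: real)"
    proof (cases "x \<in> box a b")
      case True
      then show ?thesis by (simp add: mem_box_cart)
    next
      case False
      then obtain i where "\<not> (a $ i < x $ i \<and> x $ i < b $ i)" by (auto simp: mem_box_cart)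
      then have "(if x $ i - a $ i > 0 then 1 else 0) * (if b $ i - x $ i > 0 then 1 else 0) = (0::real)" by auto
      then show ?thesis using False by (metis (no_types, lifting) UNIV_I finite prod_zero indicator_simps(2))
    qed
    finally show ?thesis .
  qed
  have b: "0 \<le> \<phi> n x" "\<phi> n x \<le> 1" for n x
    unfolding \<phi>_def using step_bounds
    by (auto intro!: prod_nonneg prod_le_1 mult_nonneg_nonneg mult_le_one)
  have m[measurable]: "\<phi> n \<in> borel_measurable lebesgue" for n
  proof -
    have "smooth_fun (\<phi> n)" using t[of n] by (simp add: test_fun_def)
    from borel_measurable_continuous_onI[OF smooth_fun_continuous[OF this]]
    show ?thesis by (intro measurable_completion) simp
  qed
  have [measurable]: "g \<in> borel_measurable lebesgue" "box a b \<in> sets lebesgue" using g by auto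
  have "(\<lambda>n. \<integral>x. g x * \<phi> n x \<partial>lebesgue) \<longlonglongrightarrow> (\<integral>x. g x * indicator (box a b) x \<partial>lebesgue)"
  proof (rule integral_dominated_convergence[where w="\<lambda>x. \<bar>g x\<bar>"])
    show "AE x in lebesgue. (\<lambda>n. g x * \<phi> n x) \<longlonglongrightarrow> g x * indicator (box a b) x"
      using lim by (intro AE_I2 tendsto_mult tendsto_const)
    show "AE x in lebesgue. norm (g x * \<phi> n x) \<le> \<bar>g x\<bar>" for n
      using b by (intro AE_I2) (simp add: abs_mult mult_left_le)
  qed (use g in auto)
  then show ?thesis by (simp add: 0[OF t] LIMSEQ_const_iff)
qed

text \<open>The fundamental lemma of the calculus of variations, without mollifiers. Test functions
  approximate indicators of open boxes, so the positive and negative parts of a Borel version of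
  \<open>g\<close> have the same integral over each box. Boxes are stable under intersection and
  generate the Borel sets, so the two parts are densities of the same measure.\<close>

lemma AE_eq_0_of_test_fun:
  fixes g :: "real^'n \<Rightarrow> real"
  assumes g: "integrable lebesgue g" and 0: "\<And>\<phi>. test_fun \<phi> \<Longrightarrow> (\<integral>x. g x * \<phi> x \<partial>lebesgue) = 0"
  shows "AE x in lebesgue. g x = 0"
proof -
  have gm: "g \<in> borel_measurable lebesgue" using g by auto
  obtain h where h[measurable]: "h \<in> borel_measurable lborel" and gh: "AE x in lborel. g x = h x"
    using completion_ex_borel_measurable_real[OF gm] by blast
  have gh': "AE x in lebesgue. g x = h x" using gh by (rule AE_completion)
  have hl: "h \<in> borel_measurable lebesgue" using h by (rule measurable_completion)
  have hint: "integrable lborel h"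
    using g integrable_cong_AE[OF gm hl gh'] integrable_completion[OF h] by simp
  have hbox: "(\<integral>x. h x * indicator (box a b) x \<partial>lborel) = 0" for a b
  proof -
    have "(\<integral>x. h x * indicator (box a b) x \<partial>lborel) = (\<integral>x. h x * indicator (box a b) x \<partial>lebesgue)"
      by (rule integral_completion[symmetric]) measurable
    also have "\<dots> = (\<integral>x. g x * indicator (box a b) x \<partial>lebesgue)"
    proof (rule integral_cong_AE)
      have [measurable]: "box a b \<in> sets lebesgue" by simp
      show "(\<lambda>x. h x * indicator (box a b) x) \<in> borel_measurable lebesgue"
        "(\<lambda>x. g x * indicator (box a b) x) \<in> borel_measurable lebesgue"
        using gm hl by simp_all
      show "AE x in lebesgue. h x * indicator (box a b) x = g x * indicator (box a b) x"
        using gh' by eventually_elim simp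
    qed
    finally show ?thesis using integral_box_eq_0[OF g 0] by simp
  qed
  \<comment> \<open>Since \<open>ennreal\<close> truncates negative numbers to 0, these are the
    measures given by the positive and the negative part of \<open>h\<close>.\<close>
  define M1 where "M1 = density lborel (\<lambda>x. ennreal (h x))"
  define M2 where "M2 = density lborel (\<lambda>x. ennreal (- h x))"
  have fin1: "(\<integral>\<^sup>+x. ennreal (h x) \<partial>lborel) < \<infinity>" and fin2: "(\<integral>\<^sup>+x. ennreal (- h x) \<partial>lborel) < \<infinity>"
    using integrableD(2,3)[OF hint] by (auto simp: less_top)
  have e: "emeasure M1 (box a b) = emeasure M2 (box a b)" for a b
  proof -
    let ?k = "\<lambda>x. h x * indicator (box a b) x"
    have ki: "integrable lborel ?k"
      using integrable_mult_indicator[OF _ hint, of "box a b"] by (simp add: mult.commute)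
    have n: "(\<integral>\<^sup>+x. ennreal (?k x) \<partial>lborel) \<noteq> \<infinity>" "(\<integral>\<^sup>+x. ennreal (- ?k x) \<partial>lborel) \<noteq> \<infinity>"
      using integrableD(2,3)[OF ki] by auto
    have "enn2real (\<integral>\<^sup>+x. ennreal (?k x) \<partial>lborel) = enn2real (\<integral>\<^sup>+x. ennreal (- ?k x) \<partial>lborel)"
      using real_lebesgue_integral_def[OF ki] hbox[of a b] by simp
    then have "ennreal (enn2real (\<integral>\<^sup>+x. ennreal (?k x) \<partial>lborel)) =
        ennreal (enn2real (\<integral>\<^sup>+x. ennreal (- ?k x) \<partial>lborel))" by (rule arg_cong)
    then have "(\<integral>\<^sup>+x. ennreal (?k x) \<partial>lborel) = (\<integral>\<^sup>+x. ennreal (- ?k x) \<partial>lborel)"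
      using n unfolding ennreal_enn2real_if infinity_ennreal_def by simp
    moreover have "emeasure M1 (box a b) = (\<integral>\<^sup>+x. ennreal (?k x) \<partial>lborel)"
      unfolding M1_def by (subst emeasure_density) (auto intro!: nn_integral_cong simp: indicator_def)
    moreover have "emeasure M2 (box a b) = (\<integral>\<^sup>+x. ennreal (- ?k x) \<partial>lborel)"
      unfolding M2_def by (subst emeasure_density) (auto intro!: nn_integral_cong simp: indicator_def)
    ultimately show ?thesis by simp
  qed
  have M12: "M1 = M2"
  proof (rule measure_eqI_generator_eq)
    let ?E = "range (\<lambda>(a, b). box a b :: (real^'n) set)"
    show "Int_stable ?E"
      by (auto simp: Int_stable_def box_Int_box)
    show "?E \<subseteq> Pow UNIV" "sets M1 = sigma_sets UNIV ?E" "sets M2 = sigma_sets UNIV ?E"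
      by (simp_all add: borel_eq_box M1_def M2_def)
    let ?A = "\<lambda>n::nat. box (- (real n *\<^sub>R One)) (real n *\<^sub>R One) :: (real^'n) set"
    show "range ?A \<subseteq> ?E" "(\<Union>i. ?A i) = UNIV"
      unfolding UN_box_eq_UNIV by auto
    show "emeasure M1 (?A i) \<noteq> \<infinity>" for i
    proof -
      have "emeasure M1 (?A i) \<le> emeasure M1 (space M1)" by (rule emeasure_space)
      also have "\<dots> < \<infinity>" unfolding M1_def using fin1 by (subst emeasure_density) auto
      finally show ?thesis by simp
    qed
    show "emeasure M1 X = emeasure M2 X" if "X \<in> ?E" for X
      using that e by auto
  qed
  have "AE x in lborel. ennreal (h x) = ennreal (- h x)"
    by (rule sigma_finite_measure.density_unique[OF sigma_finite_lborel]) (use M12 in \<open>auto simp: M1_def M2_def\<close>)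
  then have "AE x in lborel. h x = 0"
  proof eventually_elim
    fix x assume "ennreal (h x) = ennreal (- h x)"
    then show "h x = 0" by (cases "h x \<ge> 0") (auto simp: ennreal_neg)
  qed
  then have "AE x in lebesgue. h x = 0" by (rule AE_completion)
  with gh' show ?thesis by eventually_elim simp
qed

lemma integrable_nth:
  fixes g :: "'a \<Rightarrow> real^'n"
  assumes "integrable M g"
  shows "integrable M (\<lambda>x. g x $ i)"
  using integrable_bounded_linear[OF bounded_linear_vec_nth assms] .

lemma integrable_mult_bounded:
  fixes u \<phi> :: "real^'n \<Rightarrow> real"
  assumes "integrable lebesgue u" "\<phi> \<in> borel_measurable borel" "\<And>x. \<bar>\<phi> x\<bar> \<le> B"
  shows "integrable lebesgue (\<lambda>x. u x * \<phi> x)"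
proof (rule Bochner_Integration.integrable_bound)
  show "integrable lebesgue (\<lambda>x. B * u x)" using assms(1) by simp
  have "\<phi> \<in> borel_measurable lebesgue" using assms(2) by (simp add: measurable_completion)
  then show "(\<lambda>x. u x * \<phi> x) \<in> borel_measurable lebesgue" using assms(1) by simp
  show "AE x in lebesgue. norm (u x * \<phi> x) \<le> norm (B * u x)"
  proof (rule AE_I2)
    fix x
    have "\<bar>u x\<bar> * \<bar>\<phi> x\<bar> \<le> \<bar>u x\<bar> * \<bar>B\<bar>" using assms(3)[of x] by (intro mult_left_mono) auto
    then show "norm (u x * \<phi> x) \<le> norm (B * u x)" by (simp add: abs_mult mult.commute)
  qed
qed

text \<open>\<open>wgrad\<close> is an arbitrary choice among weak gradients; this lemma allows an
  explicit gradient to replace it under an integral.\<close>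

lemma weak_gradient_unique:
  fixes u :: "real^'n \<Rightarrow> real"
  assumes "integrable lebesgue g" "weak_gradient u g" "integrable lebesgue h" "weak_gradient u h"
  shows "AE x in lebesgue. g x = h x"
proof -
  have "AE x in lebesgue. g x $ i - h x $ i = 0" for i
  proof (rule AE_eq_0_of_test_fun)
    show "integrable lebesgue (\<lambda>x. g x $ i - h x $ i)"
      using assms by (intro Bochner_Integration.integrable_diff integrable_nth)
    fix \<phi> :: "real^'n \<Rightarrow> real" assume \<phi>: "test_fun \<phi>"
    obtain \<psi> where \<psi>: "partial_deriv i \<phi> \<psi>" using smooth_fun_partial \<phi> unfolding test_fun_def by blast
    note t = test_funD[OF \<phi> \<psi>]
    obtain B where B: "\<And>x. \<bar>\<phi> x\<bar> \<le> B" using t(5) by blast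
    have "(\<integral>x. g x $ i * \<phi> x \<partial>lebesgue) = (\<integral>x. h x $ i * \<phi> x \<partial>lebesgue)"
      using assms(2)[unfolded weak_gradient_iff, rule_format, OF \<phi> \<psi>]
        assms(4)[unfolded weak_gradient_iff, rule_format, OF \<phi> \<psi>] by linarith
    then show "(\<integral>x. (g x $ i - h x $ i) * \<phi> x \<partial>lebesgue) = 0"
      unfolding left_diff_distrib
      by (subst Bochner_Integration.integral_diff)
         (use assms B t(3) in \<open>auto intro!: integrable_mult_bounded integrable_nth\<close>)
  qed
  then have "AE x in lebesgue. \<forall>i. g x $ i - h x $ i = 0" by (simp add: AE_all_countable)
  then show ?thesis by eventually_elim (simp add: vec_eq_iff)
qed

lemma weak_gradient_add_scaled:
  fixes u w :: "real^'n \<Rightarrow> real"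
  assumes "integrable lebesgue u" "integrable lebesgue w" "integrable lebesgue g" "integrable lebesgue h"
    and "weak_gradient u g" "weak_gradient w h"
  shows "weak_gradient (\<lambda>x. u x + c * w x) (\<lambda>x. g x + c *\<^sub>R h x)"
  unfolding weak_gradient_iff
proof (intro allI impI)
  fix \<phi> :: "real^'n \<Rightarrow> real" and i \<psi> assume \<phi>: "test_fun \<phi>" and \<psi>: "partial_deriv i \<phi> \<psi>"
  note t = test_funD[OF \<phi> \<psi>]
  obtain B where B: "\<And>x. \<bar>\<phi> x\<bar> \<le> B" "\<And>x. \<bar>\<psi> x\<bar> \<le> B" using t(5) by blast
  have 1: "(\<integral>x. u x * \<psi> x \<partial>lebesgue) = - (\<integral>x. g x $ i * \<phi> x \<partial>lebesgue)"
    "(\<integral>x. w x * \<psi> x \<partial>lebesgue) = - (\<integral>x. h x $ i * \<phi> x \<partial>lebesgue)"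
    using assms(5,6) \<phi> \<psi> unfolding weak_gradient_iff by simp_all
  have I: "integrable lebesgue (\<lambda>x. u x * \<psi> x)" "integrable lebesgue (\<lambda>x. w x * \<psi> x)"
    "integrable lebesgue (\<lambda>x. g x $ i * \<phi> x)" "integrable lebesgue (\<lambda>x. h x $ i * \<phi> x)"
    using assms(1-4) t(3,4) B by (auto intro!: integrable_mult_bounded integrable_nth)
  have "(\<integral>x. (u x + c * w x) * \<psi> x \<partial>lebesgue) = (\<integral>x. u x * \<psi> x + c * (w x * \<psi> x) \<partial>lebesgue)"
    by (simp add: algebra_simps)
  also have "\<dots> = (\<integral>x. u x * \<psi> x \<partial>lebesgue) + c * (\<integral>x. w x * \<psi> x \<partial>lebesgue)"
    using I by simp
  also have "\<dots> = - ((\<integral>x. g x $ i * \<phi> x \<partial>lebesgue) + c * (\<integral>x. h x $ i * \<phi> x \<partial>lebesgue))"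
    using 1 by simp
  also have "\<dots> = - (\<integral>x. g x $ i * \<phi> x + c * (h x $ i * \<phi> x) \<partial>lebesgue)"
    using I by simp
  also have "\<dots> = - (\<integral>x. (g x + c *\<^sub>R h x) $ i * \<phi> x \<partial>lebesgue)"
    by (simp add: algebra_simps)
  finally show "(\<integral>x. (u x + c * w x) * \<psi> x \<partial>lebesgue) = - (\<integral>x. (g x + c *\<^sub>R h x) $ i * \<phi> x \<partial>lebesgue)" .
qed

section \<open>Elements of \<open>W11\<close> and their perturbations\<close>

lemma W11I:
  fixes u :: "real^'n \<Rightarrow> real"
  assumes "integrable lebesgue u" "integrable lebesgue g" "weak_gradient u g"
  shows "u \<in> W11"
proof -
  have "set_integrable lebesgue K u" if "compact K" for K
    using that assms(1) unfolding set_integrable_def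
    by (intro integrable_mult_indicator) (auto simp: compact_imp_closed lmeasurable_compact fmeasurableD)
  then show ?thesis using assms by (auto simp: W11_def dotW11_def locally_integrable_def)
qed

lemma wgrad_W11:
  assumes "u \<in> W11"
  shows "integrable lebesgue (wgrad u)" "weak_gradient u (wgrad u)"
proof -
  have "\<exists>g. integrable lebesgue g \<and> weak_gradient u g"
    using assms unfolding W11_def dotW11_def by simp
  from someI_ex[OF this] show "integrable lebesgue (wgrad u)" "weak_gradient u (wgrad u)"
    unfolding wgrad_def by simp_all
qed

text \<open>The gradient chosen for the sum agrees only almost everywhere with the combination of
  the chosen gradients, which suffices for the integral. The resulting distance is linear in
  \<open>\<bar>c\<bar>\<close>, so small multiples of \<open>w\<close> stay in any given
  neighbourhood of \<open>u\<close>.\<close>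

lemma W11_add_scaled:
  fixes u w :: "real^'n \<Rightarrow> real"
  assumes "u \<in> W11" "w \<in> W11"
  shows "(\<lambda>x. u x + c * w x) \<in> W11"
    and "W11_dist u (\<lambda>x. u x + c * w x) = \<bar>c\<bar> * ((\<integral>x. \<bar>w x\<bar> \<partial>lebesgue) + (\<integral>x. norm (wgrad w x) \<partial>lebesgue))"
proof -
  note W = wgrad_W11[OF assms(1)] wgrad_W11[OF assms(2)]
  have I: "integrable lebesgue u" "integrable lebesgue w" using assms by (auto simp: W11_def)
  have wg: "weak_gradient (\<lambda>x. u x + c * w x) (\<lambda>x. wgrad u x + c *\<^sub>R wgrad w x)"
    by (rule weak_gradient_add_scaled) (use W I in auto)
  have gi: "integrable lebesgue (\<lambda>x. wgrad u x + c *\<^sub>R wgrad w x)" using W by auto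
  show in_W: "(\<lambda>x. u x + c * w x) \<in> W11"
    by (rule W11I[OF _ gi wg]) (use I in auto)
  note W3 = wgrad_W11[OF in_W]
  have ae: "AE x in lebesgue. wgrad (\<lambda>x. u x + c * w x) x = wgrad u x + c *\<^sub>R wgrad w x"
    by (rule weak_gradient_unique[OF W3 gi wg])
  have "(\<integral>x. norm (wgrad u x - wgrad (\<lambda>x. u x + c * w x) x) \<partial>lebesgue) = (\<integral>x. \<bar>c\<bar> * norm (wgrad w x) \<partial>lebesgue)"
  proof (rule integral_cong_AE)
    show "AE x in lebesgue. norm (wgrad u x - wgrad (\<lambda>x. u x + c * w x) x) = \<bar>c\<bar> * norm (wgrad w x)"
      using ae by eventually_elim simp
  qed (use W W3 in auto)
  then show "W11_dist u (\<lambda>x. u x + c * w x) = \<bar>c\<bar> * ((\<integral>x. \<bar>w x\<bar> \<partial>lebesgue) + (\<integral>x. norm (wgrad w x) \<partial>lebesgue))"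
    by (simp add: W11_dist_def abs_mult distrib_left)
qed

section \<open>Reduction of meagerness to existence\<close>

lemma sigma_finite_lebesgue: "sigma_finite_measure (lebesgue :: 'a::euclidean_space measure)"
proof
  let ?A = "range (\<lambda>n::nat. box (- (real n *\<^sub>R One)) (real n *\<^sub>R One) :: 'a set)"
  show "\<exists>A::'a set set. countable A \<and> A \<subseteq> sets lebesgue \<and> \<Union>A = space lebesgue \<and> (\<forall>a\<in>A. emeasure lebesgue a \<noteq> \<infinity>)"
    by (intro exI[of _ ?A]) (use emeasure_lborel_box_finite in \<open>auto simp: UN_box_eq_UNIV less_top[symmetric]\<close>)
qed

text \<open>The exceptional pairs lie in two strips over null sets. This turns almost everywhere
  convergence of functions into convergence at both entries of almost every pair.\<close>

lemma AE_pair_fst_snd: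
  assumes "sigma_finite_measure N" "AE x in M. P x" "AE y in N. Q y"
  shows "AE z in M \<Otimes>\<^sub>M N. P (fst z) \<and> Q (snd z)"
proof -
  interpret N: sigma_finite_measure N by fact
  obtain A where A: "{x\<in>space M. \<not> P x} \<subseteq> A" "emeasure M A = 0" "A \<in> sets M"
    using assms(2) by (auto elim!: AE_E)
  obtain B where B: "{x\<in>space N. \<not> Q x} \<subseteq> B" "emeasure N B = 0" "B \<in> sets N"
    using assms(3) by (auto elim!: AE_E)
  have 1: "A \<times> space N \<in> null_sets (M \<Otimes>\<^sub>M N)" "space M \<times> B \<in> null_sets (M \<Otimes>\<^sub>M N)"
    using A B by (auto simp: null_sets_def N.emeasure_pair_measure_Times)
  show ?thesis
    by (rule AE_I'[OF null_sets.Un[OF 1]]) (use A B in \<open>auto simp: space_pair_measure\<close>)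
qed

section \<open>The measure \<open>nu\<close> and the level sets \<open>Eset\<close>\<close>

lemma nu_mono: "E \<subseteq> E' \<Longrightarrow> nu \<gamma> E \<le> nu \<gamma> E'"
  unfolding nu_def by (intro nn_integral_mono mult_right_mono) (auto simp: indicator_def)

lemma ident_measurable_lebesgue: "(\<lambda>x. x) \<in> borel_measurable (lebesgue :: 'a::euclidean_space measure)"
  by (intro measurable_completion) simp

lemma measurable_fst_snd_lebesgue[measurable]:
  "fst \<in> borel_measurable ((lebesgue :: 'a::euclidean_space measure) \<Otimes>\<^sub>M N)"
  "snd \<in> borel_measurable (N \<Otimes>\<^sub>M (lebesgue :: 'a::euclidean_space measure))"
  by (rule measurable_compose[OF measurable_fst ident_measurable_lebesgue],
      rule measurable_compose[OF measurable_snd ident_measurable_lebesgue])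

lemma Eset_measurable[measurable]:
  fixes u :: "real^'n \<Rightarrow> real"
  assumes [measurable]: "u \<in> borel_measurable lebesgue"
  shows "Eset lam \<gamma> u \<in> sets (lebesgue \<Otimes>\<^sub>M lebesgue)"
proof -
  have "Eset lam \<gamma> u = {z \<in> space (lebesgue \<Otimes>\<^sub>M lebesgue).
     fst z \<noteq> snd z \<and> \<bar>u (fst z) - u (snd z)\<bar> / dist (fst z) (snd z) powr (1 + \<gamma>) > lam}"
    by (auto simp: Eset_def space_pair_measure)
  also have "\<dots> \<in> sets (lebesgue \<Otimes>\<^sub>M lebesgue)" by measurable
  finally show ?thesis .
qed

lemma Eset_ne: "{p \<in> Eset lam \<gamma> u. fst p \<noteq> snd p} = Eset lam \<gamma> u"
  by (auto simp: Eset_def)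

lemma nu_Eset: "nu \<gamma> (Eset lam \<gamma> u) = (\<integral>\<^sup>+ z. indicator (Eset lam \<gamma> u) z
    * ennreal (dist (fst z) (snd z) powr (\<gamma> - real CARD('n))) \<partial>(lebesgue \<Otimes>\<^sub>M lebesgue))"
  for u :: "real^'n \<Rightarrow> real"
  unfolding nu_def Eset_ne ..

lemma nu_Eset_subadd:
  fixes u v w :: "real^'n \<Rightarrow> real"
  assumes [measurable]: "u \<in> borel_measurable lebesgue" "v \<in> borel_measurable lebesgue"
    and sub: "Eset lam \<gamma> w \<subseteq> Eset lam1 \<gamma> u \<union> Eset lam2 \<gamma> v"
  shows "nu \<gamma> (Eset lam \<gamma> w) \<le> nu \<gamma> (Eset lam1 \<gamma> u) + nu \<gamma> (Eset lam2 \<gamma> v)"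
proof -
  have "nu \<gamma> (Eset lam \<gamma> w) \<le> (\<integral>\<^sup>+ z. indicator (Eset lam1 \<gamma> u) z * ennreal (dist (fst z) (snd z) powr (\<gamma> - real CARD('n)))
      + indicator (Eset lam2 \<gamma> v) z * ennreal (dist (fst z) (snd z) powr (\<gamma> - real CARD('n))) \<partial>(lebesgue \<Otimes>\<^sub>M lebesgue))"
    unfolding nu_Eset using sub by (intro nn_integral_mono) (auto simp: indicator_def)
  also have "\<dots> = nu \<gamma> (Eset lam1 \<gamma> u) + nu \<gamma> (Eset lam2 \<gamma> v)"
    unfolding nu_Eset by (rule nn_integral_add) measurable
  finally show ?thesis .
qed

lemma Eset_scale:
  assumes "c > 0"
  shows "Eset lam \<gamma> (\<lambda>x. c * w x) = Eset (lam / c) \<gamma> w"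
proof -
  have "\<bar>c * a - c * b\<bar> / d > lam \<longleftrightarrow> \<bar>a - b\<bar> / d > lam / c" for a b d :: real
  proof -
    have "\<bar>c * a - c * b\<bar> = c * \<bar>a - b\<bar>"
      using assms by (simp add: right_diff_distrib[symmetric] abs_mult)
    then show ?thesis using assms by (simp add: field_simps)
  qed
  then show ?thesis by (simp add: Eset_def)
qed

lemma Eset_diff_subset:
  "Eset (2 * lam) \<gamma> w \<subseteq> Eset lam \<gamma> (\<lambda>x. u x + w x) \<union> Eset lam \<gamma> u"
proof (rule subsetI, rule ccontr)
  fix z assume z: "z \<in> Eset (2 * lam) \<gamma> w" "z \<notin> Eset lam \<gamma> (\<lambda>x. u x + w x) \<union> Eset lam \<gamma> u"
  obtain x y where xy: "z = (x, y)" by (cases z)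
  define d where "d = dist x y powr (1 + \<gamma>)"
  have d: "d > 0" and ne: "x \<noteq> y" using z xy by (auto simp: d_def Eset_def)
  have a: "\<bar>(u x + w x) - (u y + w y)\<bar> \<le> lam * d" "\<bar>u x - u y\<bar> \<le> lam * d" "\<bar>w x - w y\<bar> > 2 * lam * d"
    using z ne d unfolding xy by (auto simp: Eset_def d_def[symmetric] field_simps not_less)
  then show False by linarith
qed

text \<open>Lower semicontinuity under \<open>L1\<close> convergence alone. Along an almost
  everywhere convergent subsequence, a pair in the limiting level set lies in all later level sets,
  because \<open>Eset\<close> is defined by a strict inequality; hence its indicator is at most the
  lower limit, and Fatou's lemma applies.\<close>

lemma nu_Eset_L1_limit:
  fixes u :: "real^'n \<Rightarrow> real" and v :: "nat \<Rightarrow> real^'n \<Rightarrow> real"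
  assumes u: "integrable lebesgue u" and v: "\<And>k. integrable lebesgue (v k)"
    and lim: "(\<lambda>k. \<integral>x. \<bar>u x - v k x\<bar> \<partial>lebesgue) \<longlonglongrightarrow> 0"
    and le: "\<And>k. nu \<gamma> (Eset lam \<gamma> (v k)) \<le> C"
  shows "nu \<gamma> (Eset lam \<gamma> u) \<le> C"
proof -
  obtain r where r: "strict_mono r" "AE x in lebesgue. (\<lambda>n. u x - v (r n) x) \<longlonglongrightarrow> 0"
    using tendsto_L1_AE_subseq[of lebesgue "\<lambda>k x. u x - v k x"] u v lim by auto
  have [measurable]: "u \<in> borel_measurable lebesgue" "v k \<in> borel_measurable lebesgue" for k
    using u v[of k] by auto
  let ?P = "\<lambda>x. (\<lambda>n. v (r n) x) \<longlonglongrightarrow> u x"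
  have P: "AE x in lebesgue. ?P x"
    using r(2)
  proof eventually_elim
    case (elim x)
    from tendsto_diff[OF tendsto_const[of "u x"] this] show ?case by simp
  qed
  let ?w = "\<lambda>z::(real^'n) \<times> (real^'n). ennreal (dist (fst z) (snd z) powr (\<gamma> - real CARD('n)))"
  let ?L = "lebesgue \<Otimes>\<^sub>M lebesgue :: ((real^'n) \<times> (real^'n)) measure"
  have "nu \<gamma> (Eset lam \<gamma> u) \<le> (\<integral>\<^sup>+ z. liminf (\<lambda>n. indicator (Eset lam \<gamma> (v (r n))) z * ?w z) \<partial>?L)"
    unfolding nu_Eset
  proof (rule nn_integral_mono_AE)
    from AE_pair_fst_snd[OF sigma_finite_lebesgue P P]
    show "AE z in ?L. indicator (Eset lam \<gamma> u) z * ?w z \<le> liminf (\<lambda>n. indicator (Eset lam \<gamma> (v (r n))) z * ?w z)"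
    proof eventually_elim
      case (elim z)
      show ?case
      proof (cases "z \<in> Eset lam \<gamma> u")
        case True
        let ?q = "\<lambda>f. \<bar>f (fst z) - f (snd z)\<bar> / dist (fst z) (snd z) powr (1 + \<gamma>)"
        have ne: "fst z \<noteq> snd z" and gt: "?q u > lam" using True by (auto simp: Eset_def)
        have "(\<lambda>n. ?q (v (r n))) \<longlonglongrightarrow> ?q u"
          using elim ne by (intro tendsto_intros) auto
        then have "eventually (\<lambda>n. ?q (v (r n)) > lam) sequentially"
          using gt by (rule order_tendstoD(1))
        then have ev: "eventually (\<lambda>n. ?w z \<le> indicator (Eset lam \<gamma> (v (r n))) z * ?w z) sequentially"
          by eventually_elim (use ne in \<open>simp add: Eset_def split_beta\<close>)
        show ?thesis using Liminf_bounded[OF ev] True by simp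
      qed simp
    qed
  qed
  also have "\<dots> \<le> liminf (\<lambda>n. nu \<gamma> (Eset lam \<gamma> (v (r n))))"
    unfolding nu_Eset by (rule nn_integral_liminf) measurable
  also have "\<dots> \<le> liminf (\<lambda>n::nat. C)"
    by (intro Liminf_mono always_eventually allI le)
  finally show ?thesis by (simp add: Liminf_const)
qed

section \<open>The topology of \<open>W11\<close> and the category argument\<close>

lemma openin_W11: "openin W11_topology U \<longleftrightarrow> U \<subseteq> W11 \<and>
      (\<forall>u\<in>U. \<exists>e>0. \<forall>v\<in>W11. W11_dist u v < e \<longrightarrow> v \<in> U)"
  unfolding W11_topology_def by (subst topology_inverse'[OF istopology_W11]) (rule refl)

lemma topspace_W11: "topspace W11_topology = (W11 :: (real^'n \<Rightarrow> real) set)"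
proof
  show "topspace W11_topology \<subseteq> (W11 :: (real^'n \<Rightarrow> real) set)"
    using openin_topspace[of "W11_topology :: (real^'n \<Rightarrow> real) topology"] unfolding openin_W11 by simp
  have "openin W11_topology (W11 :: (real^'n \<Rightarrow> real) set)" unfolding openin_W11 by (auto intro: exI[of _ 1])
  then show "(W11 :: (real^'n \<Rightarrow> real) set) \<subseteq> topspace W11_topology" by (rule openin_subset)
qed

text \<open>Each \<open>F n\<close> is closed with empty interior. Closedness is required only for
  \<open>L1\<close> limits, since \<open>W11_dist\<close> dominates the \<open>L1\<close> distance.
  For empty interior one fixed direction \<open>w\<close> is enough: a small multiple of it leaves
  \<open>F n\<close> without leaving the neighbourhood.\<close>

lemma meager_in_W11:
  fixes F :: "nat \<Rightarrow> (real^'n \<Rightarrow> real) set"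
  assumes S: "S \<subseteq> (\<Union>n. F n)" and F: "\<And>n. F n \<subseteq> W11"
    and closed: "\<And>n u v. u \<in> W11 \<Longrightarrow> (\<And>k. v k \<in> F n) \<Longrightarrow>
      (\<lambda>k::nat. \<integral>x. \<bar>u x - v k x\<bar> \<partial>lebesgue) \<longlonglongrightarrow> 0 \<Longrightarrow> u \<in> F n"
    and w: "w \<in> W11" and perturb: "\<And>n u c. u \<in> F n \<Longrightarrow> c > 0 \<Longrightarrow> (\<lambda>x. u x + c * w x) \<notin> F n"
  shows "meager_in W11_topology S"
proof -
  have cl: "closedin W11_topology (F n)" for n
    unfolding closedin_def topspace_W11 openin_W11
  proof (intro conjI F Diff_subset ballI)
    fix u assume u: "u \<in> W11 - F n"
    show "\<exists>e>0. \<forall>v\<in>W11. W11_dist u v < e \<longrightarrow> v \<in> W11 - F n"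
    proof (rule ccontr)
      assume "\<not> ?thesis"
      then have "\<forall>k::nat. \<exists>v. W11_dist u v < inverse (real (Suc k)) \<and> v \<in> F n"
        by (metis DiffI inverse_positive_iff_positive of_nat_0_less_iff zero_less_Suc)
      then obtain v where v: "\<And>k. W11_dist u (v k) < inverse (real (Suc k))" "\<And>k. v k \<in> F n"
        by metis
      have "(\<lambda>k. \<integral>x. \<bar>u x - v k x\<bar> \<partial>lebesgue) \<longlonglongrightarrow> 0"
      proof (rule tendsto_sandwich[OF _ _ tendsto_const LIMSEQ_inverse_real_of_nat])
        have "(\<integral>x. \<bar>u x - v k x\<bar> \<partial>lebesgue) \<le> W11_dist u (v k)" for k
          unfolding W11_dist_def by simp
        then show "\<forall>\<^sub>F k in sequentially. (\<integral>x. \<bar>u x - v k x\<bar> \<partial>lebesgue) \<le> inverse (real (Suc k))"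
          using v(1) by (intro always_eventually allI) (meson less_imp_le order_trans)
      qed simp
      then have "u \<in> F n" using closed u v(2) by blast
      then show False using u by simp
    qed
  qed
  have "W11_topology interior_of (F n) = {}" for n
  proof (rule ccontr)
    assume "\<not> ?thesis"
    then obtain T u where T: "openin W11_topology T" "u \<in> T" "T \<subseteq> F n"
      unfolding interior_of_def by auto
    then obtain e where e: "e > 0" "\<forall>v\<in>W11. W11_dist u v < e \<longrightarrow> v \<in> T"
      unfolding openin_W11 by blast
    define K where "K = (\<integral>x. \<bar>w x\<bar> \<partial>lebesgue) + (\<integral>x. norm (wgrad w x) \<partial>lebesgue)"
    have K: "K \<ge> 0" by (simp add: K_def)
    \<comment> \<open>The perturbation moves \<open>u\<close> by \<open>c * K\<close>, which is
      below \<open>e\<close>; the summand 1 covers the case \<open>K = 0\<close>.\<close>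
    define c where "c = e / (K + 1)"
    have c: "c > 0" "c * K < e" using e K by (auto simp: c_def field_simps)
    have uW: "u \<in> W11" using T F by blast
    have "(\<lambda>x. u x + c * w x) \<in> T"
      using e(2) W11_add_scaled[OF uW w, of c] c by (simp add: K_def)
    then show False using perturb[of u n c] T c by blast
  qed
  then have "nowhere_dense_in W11_topology (F n)" for n
    using F closure_of_closedin[OF cl] by (simp add: nowhere_dense_in_def topspace_W11)
  moreover have "S \<subseteq> W11" using S F by blast
  ultimately show ?thesis using S unfolding meager_in_def topspace_W11 by blast
qed

text \<open>\<open>nu\<close> of the level set decreases as the level rises, so a single integer can
  serve both as level and as bound, which makes the union countable. Taking \<open>Suc n\<close>
  keeps the level positive.\<close>

lemma meager_finite_nu:
  fixes w :: "real^'n \<Rightarrow> real"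
  assumes w: "w \<in> W11" and inf: "\<And>lam. lam > 0 \<Longrightarrow> nu \<gamma> (Eset lam \<gamma> w) = \<infinity>"
  shows "meager_in W11_topology {u :: real^'n \<Rightarrow> real. u \<in> W11 \<and> (\<exists>lam>0. nu \<gamma> (Eset lam \<gamma> u) < \<infinity>)}"
proof (rule meager_in_W11[where F="\<lambda>n. {u \<in> W11. nu \<gamma> (Eset (real (Suc n)) \<gamma> u) \<le> of_nat (Suc n)}", OF _ _ _ w])
  show "{u :: real^'n \<Rightarrow> real. u \<in> W11 \<and> (\<exists>lam>0. nu \<gamma> (Eset lam \<gamma> u) < \<infinity>)}
     \<subseteq> (\<Union>n. {u \<in> W11. nu \<gamma> (Eset (real (Suc n)) \<gamma> u) \<le> of_nat (Suc n)})"
  proof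
    fix u :: "real^'n \<Rightarrow> real" assume "u \<in> {u. u \<in> W11 \<and> (\<exists>lam>0. nu \<gamma> (Eset lam \<gamma> u) < \<infinity>)}"
    then obtain lam where u: "u \<in> W11" and lam: "nu \<gamma> (Eset lam \<gamma> u) < \<infinity>" by blast
    obtain n1 where n1: "nu \<gamma> (Eset lam \<gamma> u) \<le> of_nat n1"
      using lam ennreal_Ex_less_of_nat less_imp_le by (metis infinity_ennreal_def)
    obtain n2 :: nat where n2: "lam \<le> real n2" using real_arch_simple by blast
    define n where "n = max n1 n2"
    have "Eset (real (Suc n)) \<gamma> u \<subseteq> Eset lam \<gamma> u"
      using n2 by (auto simp: Eset_def n_def)
    from nu_mono[OF this, of \<gamma>] n1 have "nu \<gamma> (Eset (real (Suc n)) \<gamma> u) \<le> of_nat n1" by (rule order_trans)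
    also have "(of_nat n1 :: ennreal) \<le> of_nat (Suc n)" by (intro of_nat_mono) (simp add: n_def)
    finally show "u \<in> (\<Union>n. {u \<in> W11. nu \<gamma> (Eset (real (Suc n)) \<gamma> u) \<le> of_nat (Suc n)})" using u by blast
  qed
  show "u \<in> {u \<in> W11. nu \<gamma> (Eset (real (Suc n)) \<gamma> u) \<le> of_nat (Suc n)}"
    if "u \<in> W11" "\<And>k. v k \<in> {u \<in> W11. nu \<gamma> (Eset (real (Suc n)) \<gamma> u) \<le> of_nat (Suc n)}"
      "(\<lambda>k::nat. \<integral>x. \<bar>u x - v k x\<bar> \<partial>lebesgue) \<longlonglongrightarrow> 0" for n u and v :: "nat \<Rightarrow> real^'n \<Rightarrow> real"
    using that nu_Eset_L1_limit[of u v \<gamma> "real (Suc n)" "of_nat (Suc n)"] by (simp add: W11_def)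
  show "(\<lambda>x. u x + c * w x) \<notin> {u \<in> W11. nu \<gamma> (Eset (real (Suc n)) \<gamma> u) \<le> of_nat (Suc n)}"
    if u: "u \<in> {u \<in> W11. nu \<gamma> (Eset (real (Suc n)) \<gamma> u) \<le> of_nat (Suc n)}" and c: "c > 0" for n u c
  proof
    assume uw: "(\<lambda>x. u x + c * w x) \<in> {u \<in> W11. nu \<gamma> (Eset (real (Suc n)) \<gamma> u) \<le> of_nat (Suc n)}"
    let ?l = "real (Suc n)"
    have "nu \<gamma> (Eset (2 * ?l) \<gamma> (\<lambda>x. c * w x)) \<le> nu \<gamma> (Eset ?l \<gamma> (\<lambda>x. u x + c * w x)) + nu \<gamma> (Eset ?l \<gamma> u)"
      by (rule nu_Eset_subadd[OF _ _ Eset_diff_subset]) (use u uw in \<open>auto simp: W11_def\<close>)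
    also have "\<dots> \<le> of_nat (Suc n) + of_nat (Suc n)" using u uw by (intro add_mono) auto
    also have "\<dots> < \<infinity>" by (simp add: of_nat_less_top)
    finally show False using inf[of "2 * ?l / c"] c by (simp add: Eset_scale)
  qed
qed auto

text \<open>A finite upper limit yields a common bound for all levels in some interval between 0 and
  \<open>inverse (real (Suc n))\<close>. The bound at each level is preserved by \<open>L1\<close>
  limits, hence so is their conjunction. The perturbation is excluded at one sufficiently small
  level.\<close>

lemma meager_bounded_limsup:
  fixes w :: "real^'n \<Rightarrow> real"
  assumes w: "w \<in> W11" and inf: "((\<lambda>lam. ennreal lam * nu \<gamma> (Eset lam \<gamma> w)) \<longlongrightarrow> \<infinity>) (at_right 0)"
  shows "meager_in W11_topology {u :: real^'n \<Rightarrow> real. u \<in> W11 \<and>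
             Limsup (at_right 0) (\<lambda>lam. ennreal lam * nu \<gamma> (Eset lam \<gamma> u)) < \<infinity>}"
proof (rule meager_in_W11[where F="\<lambda>n. {u \<in> W11. \<forall>lam. 0 < lam \<longrightarrow> lam < inverse (real (Suc n)) \<longrightarrow>
     ennreal lam * nu \<gamma> (Eset lam \<gamma> u) \<le> of_nat (Suc n)}", OF _ _ _ w])
  let ?F = "\<lambda>n. {u :: real^'n \<Rightarrow> real. u \<in> W11 \<and> (\<forall>lam. 0 < lam \<longrightarrow> lam < inverse (real (Suc n)) \<longrightarrow>
     ennreal lam * nu \<gamma> (Eset lam \<gamma> u) \<le> of_nat (Suc n))}"
  show "{u :: real^'n \<Rightarrow> real. u \<in> W11 \<and> Limsup (at_right 0) (\<lambda>lam. ennreal lam * nu \<gamma> (Eset lam \<gamma> u)) < \<infinity>}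
     \<subseteq> (\<Union>n. ?F n)"
  proof
    fix u :: "real^'n \<Rightarrow> real"
    assume "u \<in> {u. u \<in> W11 \<and> Limsup (at_right 0) (\<lambda>lam. ennreal lam * nu \<gamma> (Eset lam \<gamma> u)) < \<infinity>}"
    then have u: "u \<in> W11" and L: "Limsup (at_right 0) (\<lambda>lam. ennreal lam * nu \<gamma> (Eset lam \<gamma> u)) < \<infinity>" by auto
    obtain n1 where n1: "Limsup (at_right 0) (\<lambda>lam. ennreal lam * nu \<gamma> (Eset lam \<gamma> u)) < of_nat n1"
      using L ennreal_Ex_less_of_nat by (metis infinity_ennreal_def)
    have "eventually (\<lambda>lam. ennreal lam * nu \<gamma> (Eset lam \<gamma> u) < of_nat n1) (at_right 0)"
      using Limsup_lessD[OF n1] .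
    then obtain b where b: "b > 0" "\<And>lam. 0 < lam \<Longrightarrow> lam < b \<Longrightarrow> ennreal lam * nu \<gamma> (Eset lam \<gamma> u) < of_nat n1"
      unfolding eventually_at_right_field by auto
    obtain n2 :: nat where n2: "inverse (real (Suc n2)) < b" using reals_Archimedean[OF b(1)] by blast
    define n where "n = max n1 n2"
    have "ennreal lam * nu \<gamma> (Eset lam \<gamma> u) \<le> of_nat (Suc n)" if "0 < lam" "lam < inverse (real (Suc n))" for lam
    proof -
      have "inverse (real (Suc n)) \<le> inverse (real (Suc n2))"
        by (intro le_imp_inverse_le) (auto simp: n_def)
      then have "lam < b" using that(2) n2 by linarith
      then have "ennreal lam * nu \<gamma> (Eset lam \<gamma> u) \<le> of_nat n1"
        using b(2)[OF that(1)] by (intro less_imp_le)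
      also have "(of_nat n1 :: ennreal) \<le> of_nat (Suc n)" by (intro of_nat_mono) (simp add: n_def)
      finally show ?thesis .
    qed
    then show "u \<in> (\<Union>n. ?F n)" using u by blast
  qed
  show "u \<in> ?F n" if uW: "u \<in> W11" and v: "\<And>k. v k \<in> ?F n"
      and lim: "(\<lambda>k::nat. \<integral>x. \<bar>u x - v k x\<bar> \<partial>lebesgue) \<longlonglongrightarrow> 0" for n u v
  proof (intro CollectI conjI allI impI uW)
    fix lam :: real assume lam: "0 < lam" "lam < inverse (real (Suc n))"
    \<comment> \<open>Semicontinuity concerns \<open>nu\<close> at a fixed level, so the weight
      \<open>lam\<close> is moved to the other side of the bound and back.\<close>
    have inv: "ennreal (inverse lam) * (ennreal lam * X) = X" "ennreal lam * (ennreal (inverse lam) * X) = X" for X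
      using lam(1) by (simp_all add: mult.assoc[symmetric] ennreal_mult[symmetric])
    have "nu \<gamma> (Eset lam \<gamma> u) \<le> ennreal (inverse lam) * of_nat (Suc n)"
    proof (rule nu_Eset_L1_limit[OF _ _ lim])
      show "nu \<gamma> (Eset lam \<gamma> (v k)) \<le> ennreal (inverse lam) * of_nat (Suc n)" for k
      proof -
        have "ennreal lam * nu \<gamma> (Eset lam \<gamma> (v k)) \<le> of_nat (Suc n)" using v[of k] lam by blast
        from mult_left_mono[OF this, of "ennreal (inverse lam)"] show ?thesis by (simp only: inv) simp
      qed
    qed (use uW v in \<open>auto simp: W11_def\<close>)
    from mult_left_mono[OF this, of "ennreal lam"]
    show "ennreal lam * nu \<gamma> (Eset lam \<gamma> u) \<le> of_nat (Suc n)" by (simp only: inv) simp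
  qed
  show "(\<lambda>x. u x + c * w x) \<notin> ?F n" if u: "u \<in> ?F n" and c: "c > 0" for n u c
  proof
    assume uw: "(\<lambda>x. u x + c * w x) \<in> ?F n"
    \<comment> \<open>The level \<open>2 * l\<close> for \<open>c * w\<close> is the level
      \<open>2 * l / c\<close> for \<open>w\<close>. The two bounds \<open>Suc n\<close>, multiplied
      by \<open>2 / c\<close>, give the constant to be exceeded.\<close>
    have "eventually (\<lambda>lam. ennreal (4 * real (Suc n) / c) < ennreal lam * nu \<gamma> (Eset lam \<gamma> w)) (at_right 0)"
      using inf by (rule order_tendstoD(1)) simp
    then obtain b where b: "b > 0"
      "\<And>lam. 0 < lam \<Longrightarrow> lam < b \<Longrightarrow> ennreal (4 * real (Suc n) / c) < ennreal lam * nu \<gamma> (Eset lam \<gamma> w)"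
      unfolding eventually_at_right_field by auto
    define l where "l = min (b * c / 2) (inverse (real (Suc n))) / 2"
    have l: "0 < l" "l < inverse (real (Suc n))" "2 * l / c < b"
      using b(1) c by (auto simp: l_def field_simps min_def)
    have "nu \<gamma> (Eset (2 * l) \<gamma> (\<lambda>x. c * w x)) \<le> nu \<gamma> (Eset l \<gamma> (\<lambda>x. u x + c * w x)) + nu \<gamma> (Eset l \<gamma> u)"
      by (rule nu_Eset_subadd[OF _ _ Eset_diff_subset]) (use u uw in \<open>auto simp: W11_def\<close>)
    then have "ennreal l * nu \<gamma> (Eset (2 * l / c) \<gamma> w)
        \<le> ennreal l * nu \<gamma> (Eset l \<gamma> (\<lambda>x. u x + c * w x)) + ennreal l * nu \<gamma> (Eset l \<gamma> u)"
      using c by (simp add: Eset_scale distrib_left[symmetric] mult_left_mono)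
    also have "\<dots> \<le> of_nat (Suc n) + of_nat (Suc n)" using u uw l by (intro add_mono) auto
    finally have "ennreal (2 / c) * (ennreal l * nu \<gamma> (Eset (2 * l / c) \<gamma> w)) \<le> ennreal (2 / c) * (of_nat (Suc n) + of_nat (Suc n))"
      by (rule mult_left_mono) simp
    also have "ennreal (2 / c) * (ennreal l * nu \<gamma> (Eset (2 * l / c) \<gamma> w)) = ennreal (2 * l / c) * nu \<gamma> (Eset (2 * l / c) \<gamma> w)"
      using c l by (simp add: mult.assoc[symmetric] ennreal_mult[symmetric])
    also have "ennreal (2 / c) * (of_nat (Suc n) + of_nat (Suc n)) = ennreal (4 * real (Suc n) / c)"
    proof -
      have "(of_nat (Suc n) + of_nat (Suc n) :: ennreal) = ennreal (2 * real (Suc n))"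
        by (simp only: ennreal_of_nat_eq_real_of_nat ennreal_plus[symmetric] of_nat_0_le_iff) simp
      moreover have "ennreal (2 / c) * ennreal (2 * real (Suc n)) = ennreal (4 * real (Suc n) / c)"
        using c by (subst ennreal_mult[symmetric]) (auto simp del: of_nat_Suc)
      ultimately show ?thesis by (simp only:)
    qed
    finally show False using b(2)[of "2 * l / c"] l c by (simp add: not_less[symmetric])
  qed
qed auto

section \<open>Smoothed Cantor functions\<close>

lemma continuous_on_flat[continuous_intros]:
  assumes "continuous_on S f"
  shows "continuous_on S (\<lambda>x. flat k (f x))"
proof -
  have "continuous_on UNIV (flat k)"
    using DERIV_isCont[OF flat_deriv] continuous_at_imp_continuous_on by blast
  from continuous_on_compose2[OF this assms] show ?thesis by simp
qed

text \<open>The indicator matters besides the bound: after rescaling it marks the slab in which one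
  rise of the Cantor function can have nonzero slope.\<close>

lemma step_deriv:
  obtains d B where "\<And>t. (step has_real_derivative d t) (at t)"
    and "0 \<le> B" "\<And>t. \<bar>d t\<bar> \<le> B * indicator {0..1} t"
proof -
  define e where "e t = flat 0 t + flat 0 (1 - t)" for t
  define d where "d t = (flat 2 t * e t - flat 0 t * (flat 2 t - flat 2 (1 - t))) / (e t * e t)" for t
  have e: "e t \<noteq> 0" for t using step_denom_pos[of t] by (simp add: e_def)
  have f2: "(flat 0 has_real_derivative flat 2 t) (at t)" for t
    using flat_deriv[of 0 t] by (simp add: numeral_2_eq_2)
  have f3: "((\<lambda>t. flat 0 (1 - t)) has_real_derivative - flat 2 (1 - t)) (at t)" for t
  proof -
    have "((\<lambda>t::real. 1 - t) has_real_derivative -1) (at t)" by (auto intro!: derivative_eq_intros)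
    from DERIV_chain2[OF f2[of "1 - t"] this] show ?thesis by simp
  qed
  have "(e has_real_derivative flat 2 t - flat 2 (1 - t)) (at t)" for t
    unfolding e_def[abs_def] using DERIV_add[OF f2 f3] by simp
  from DERIV_divide[OF f2 this e]
  have d: "(step has_real_derivative d t) (at t)" for t
    by (simp add: d_def step_def[abs_def] e_def[abs_def])
  have "continuous_on {0..1} d"
    unfolding d_def e_def using e[unfolded e_def] by (auto intro!: continuous_intros)
  then have "compact (d ` {0..1})" by (intro compact_continuous_image) auto
  then obtain B where B: "\<And>t. t \<in> {0..1} \<Longrightarrow> \<bar>d t\<bar> \<le> B"
    using compact_imp_bounded bounded_iff by (metis imageI real_norm_def)
  have out: "d t = 0" if "t \<notin> {0..1}" for t
  proof -
    have "(step has_real_derivative 0) (at t)"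
    proof (cases "t < 0")
      case True
      show ?thesis
        by (rule has_field_derivative_transform_within_open[OF DERIV_const[of 0], where S="{..<0}"])
           (use True in \<open>auto simp: step_nonpos\<close>)
    next
      case False
      show ?thesis
        by (rule has_field_derivative_transform_within_open[OF DERIV_const[of 1], where S="{1<..}"])
           (use False that in \<open>auto simp: step_ge_1\<close>)
    qed
    then show ?thesis using DERIV_unique[OF d] by blast
  qed
  have "\<bar>d t\<bar> \<le> B * indicator {0..1} t" for t using B[of t] out[of t] by (cases "t \<in> {0..1}") auto
  moreover have "0 \<le> B" using B[of 0] by simp
  ultimately show ?thesis using d that by blast
qed

text \<open>For \<open>n < M ^ k\<close> this is the left endpoint of the \<open>n\<close>-th interval of generation \<open>k\<close>, which has length \<open>\<rho> ^ k\<close>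
  and lies in the interval \<open>n div M\<close> of the previous generation.\<close>
fun cantor_pt :: "real \<Rightarrow> nat \<Rightarrow> nat \<Rightarrow> nat \<Rightarrow> real" where
  "cantor_pt \<rho> M 0 n = real n"
| "cantor_pt \<rho> M (Suc k) n = cantor_pt \<rho> M k (n div M) + real (n mod M) * \<rho> ^ k / 2"

text \<open>Each interval of generation \<open>K\<close> carries one smooth rise of its own width,
  all of equal height, so the total rise is 1. For \<open>M = 1\<close> a single rise of width
  \<open>\<rho> ^ K\<close> at 0 remains.\<close>

definition cantor_fun :: "real \<Rightarrow> nat \<Rightarrow> nat \<Rightarrow> real \<Rightarrow> real" where
  "cantor_fun \<rho> M K t = (\<Sum>n<M ^ K. step ((t - cantor_pt \<rho> M K n) / \<rho> ^ K) / real M ^ K)"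

context
  fixes \<rho> :: real and M :: nat
  assumes \<rho>: "0 < \<rho>" "\<rho> \<le> 1 / 2" and M: "0 < M" "M \<le> 2"
begin

text \<open>Either \<open>n\<close> is the last child, and the next interval begins in the next
  parent, or its sibling starts half a parent length further on; \<open>\<rho> \<le> 1 / 2\<close>
  leaves room for a child in each half. Generation 0 consists of the unit intervals at all natural
  numbers, so the induction can run over arbitrary \<open>n\<close>.\<close>

lemma cantor_pt_Suc: "cantor_pt \<rho> M k n + \<rho> ^ k \<le> cantor_pt \<rho> M k (Suc n)"
proof (induction k arbitrary: n)
  case (Suc k)
  have h: "\<rho> ^ Suc k \<le> \<rho> ^ k / 2" using \<rho> by (simp add: mult_right_mono)
  show ?case
  proof (cases "Suc (n mod M) = M")
    case True
    have "real (n mod M) * \<rho> ^ k / 2 \<le> \<rho> ^ k / 2"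
      using True M \<rho> by (intro divide_right_mono mult_left_le_one_le) auto
    then show ?thesis using Suc.IH[of "n div M"] h True by (simp add: mod_Suc div_Suc)
  next
    case False
    then show ?thesis using h by (simp add: mod_Suc div_Suc distrib_right add_divide_distrib)
  qed
qed simp

lemma cantor_pt_spacing:
  assumes "m < n"
  shows "cantor_pt \<rho> M k m + \<rho> ^ k \<le> cantor_pt \<rho> M k n"
proof -
  have "Suc m \<le> n" using assms by simp
  then show ?thesis
  proof (induction n rule: dec_induct)
    case base show ?case by (rule cantor_pt_Suc)
  next
    case (step n)
    have "0 < \<rho> ^ k" using \<rho> by simp
    then show ?case using step cantor_pt_Suc[of k n] by linarith
  qed
qed

text \<open>\<open>m div M ^ j\<close> is the ancestor of \<open>m\<close> lying \<open>j\<close>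
  generations above. A child stays inside its parent because its offset and its length are each at
  most half the parent's length.\<close>

lemma cantor_pt_descendant:
  "cantor_pt \<rho> M k (m div M ^ j) \<le> cantor_pt \<rho> M (k + j) m \<and>
   cantor_pt \<rho> M (k + j) m + \<rho> ^ (k + j) \<le> cantor_pt \<rho> M k (m div M ^ j) + \<rho> ^ k"
proof (induction j arbitrary: m)
  case (Suc j)
  have h: "\<rho> ^ Suc (k + j) \<le> \<rho> ^ (k + j) / 2" using \<rho> by (simp add: mult_right_mono)
  have "m mod M \<le> 1" using M mod_less_divisor[of M m] by linarith
  then have "real (m mod M) * \<rho> ^ (k + j) / 2 \<le> \<rho> ^ (k + j) / 2"
    using \<rho> by (intro divide_right_mono mult_left_le_one_le) auto
  moreover have "0 \<le> real (m mod M) * \<rho> ^ (k + j) / 2" using \<rho> by simp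
  moreover have "m div M ^ Suc j = m div M div M ^ j" by (simp add: div_mult2_eq)
  ultimately show ?case using Suc.IH[of "m div M"] h by simp
qed simp

lemma cantor_pt_bounds:
  assumes "n < M ^ k"
  shows "0 \<le> cantor_pt \<rho> M k n" "cantor_pt \<rho> M k n + \<rho> ^ k \<le> 1"
  using cantor_pt_descendant[of 0 n k] assms by simp_all

lemma cantor_fun_bounds: "0 \<le> cantor_fun \<rho> M K t" "cantor_fun \<rho> M K t \<le> 1"
proof -
  show "0 \<le> cantor_fun \<rho> M K t"
    unfolding cantor_fun_def using step_bounds by (intro sum_nonneg divide_nonneg_nonneg) auto
  have "cantor_fun \<rho> M K t \<le> (\<Sum>n<M ^ K. 1 / real M ^ K)"
    unfolding cantor_fun_def using step_bounds by (intro sum_mono divide_right_mono) auto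
  also have "\<dots> = 1" using M by simp
  finally show "cantor_fun \<rho> M K t \<le> 1" .
qed

text \<open>All \<open>M ^ (K - k)\<close> final rises descending from interval \<open>n\<close> are
  climbed completely between \<open>s\<close> and \<open>t\<close>, each giving
  \<open>1 / M ^ K\<close>; by monotonicity no other rise contributes negatively.\<close>

lemma cantor_fun_increment:
  assumes "k \<le> K" "n < M ^ k" "s \<le> cantor_pt \<rho> M k n" "cantor_pt \<rho> M k n + \<rho> ^ k \<le> t"
  shows "1 / real M ^ k \<le> cantor_fun \<rho> M K t - cantor_fun \<rho> M K s"
proof -
  obtain j where K: "K = k + j" using assms(1) le_Suc_ex by blast
  have pk: "0 < \<rho> ^ k" "0 < \<rho> ^ K" using \<rho> by simp_all
  define d where "d m = (step ((t - cantor_pt \<rho> M K m) / \<rho> ^ K) - step ((s - cantor_pt \<rho> M K m) / \<rho> ^ K)) / real M ^ K" for m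
  have d0: "0 \<le> d m" for m
    unfolding d_def using assms(3,4) pk
    by (intro divide_nonneg_nonneg) (auto intro!: step_mono divide_right_mono)
  have d1: "d m = 1 / real M ^ K" if "m \<in> {n * M ^ j ..< Suc n * M ^ j}" for m
  proof -
    have "m div M ^ j = n" using that M by (intro div_nat_eqI) (auto simp: mult.commute)
    then have "cantor_pt \<rho> M k n \<le> cantor_pt \<rho> M K m" "cantor_pt \<rho> M K m + \<rho> ^ K \<le> cantor_pt \<rho> M k n + \<rho> ^ k"
      using cantor_pt_descendant[of k m j] K by auto
    then have "step ((t - cantor_pt \<rho> M K m) / \<rho> ^ K) = 1" "step ((s - cantor_pt \<rho> M K m) / \<rho> ^ K) = 0"
      using assms(3,4) pk by (auto intro!: step_ge_1 step_nonpos simp: divide_nonpos_pos)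
    then show ?thesis by (simp add: d_def)
  qed
  have sub: "{n * M ^ j ..< Suc n * M ^ j} \<subseteq> {..<M ^ K}"
  proof -
    have "Suc n * M ^ j \<le> M ^ k * M ^ j" using assms(2) by (intro mult_right_mono) auto
    then show ?thesis by (auto simp: K power_add)
  qed
  have "1 / real M ^ k = (\<Sum>m\<in>{n * M ^ j ..< Suc n * M ^ j}. 1 / real M ^ K)"
    using M by (simp add: K power_add)
  also have "\<dots> = (\<Sum>m\<in>{n * M ^ j ..< Suc n * M ^ j}. d m)" using d1 by simp
  also have "\<dots> \<le> (\<Sum>m<M ^ K. d m)" using sub d0 by (intro sum_mono2) auto
  also have "\<dots> = cantor_fun \<rho> M K t - cantor_fun \<rho> M K s"
    unfolding cantor_fun_def d_def by (simp add: sum_subtractf diff_divide_distrib)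
  finally show ?thesis .
qed

end

section \<open>Blocks: Cantor functions of one coordinate, cut off in all coordinates\<close>

definition cutoff :: "real^'n \<Rightarrow> real" where
  "cutoff z = (\<Prod>i\<in>UNIV. step (1 * z $ i + 3) * step (- 1 * z $ i + 3))"

definition block :: "real \<Rightarrow> nat \<Rightarrow> nat \<Rightarrow> 'n \<Rightarrow> real^'n \<Rightarrow> real" where
  "block \<rho> M K j z = cantor_fun \<rho> M K (z $ j) * cutoff z"

lemma smooth_fun_cutoff: "smooth_fun cutoff"
  unfolding cutoff_def[abs_def] by (intro smooth_fun_prod smooth_fun_mult smooth_fun_step)

lemma cutoff_eq_0: "z \<notin> cbox (vec (-3)) (vec 3) \<Longrightarrow> cutoff z = 0"
proof -
  assume "z \<notin> cbox (vec (-3)) (vec 3)"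
  then obtain i where "z $ i < -3 \<or> 3 < z $ i"
    unfolding mem_box_cart not_all de_Morgan_conj not_le by auto
  then have "step (1 * z $ i + 3) * step (- 1 * z $ i + 3) = 0" by (auto simp: step_nonpos)
  then show ?thesis unfolding cutoff_def by (intro prod_zero) auto
qed

text \<open>The pairs of points counted in the lower bound lie, in block coordinates, in the cube of
  half-side 2. They therefore see the pure Cantor function.\<close>

lemma cutoff_eq_1: "(\<And>i. \<bar>z $ i\<bar> \<le> 2) \<Longrightarrow> cutoff z = 1"
  unfolding cutoff_def
proof (intro prod.neutral ballI)
  fix i assume "\<And>i. \<bar>z $ i\<bar> \<le> 2"
  from this[of i] show "step (1 * z $ i + 3) * step (- 1 * z $ i + 3) = 1" by (simp add: step_ge_1)
qed

lemma cutoff_bounds: "0 \<le> cutoff z" "cutoff z \<le> 1"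
  unfolding cutoff_def using step_bounds
  by (auto intro!: prod_nonneg prod_le_1 mult_nonneg_nonneg mult_le_one)

lemma measure_cbox_cart:
  fixes a b :: "real^'n"
  assumes "\<And>i. a $ i \<le> b $ i"
  shows "measure lborel (cbox a b) = (\<Prod>i\<in>UNIV. b $ i - a $ i)"
  using content_cbox_cart[of a b] assms by (auto simp: interval_ne_empty_cart)

lemma prod_single:
  fixes A B :: real and j :: "'n::finite"
  shows "(\<Prod>i\<in>UNIV. if i = j then A else B) = A * B ^ (CARD('n) - 1)"
proof -
  have "(\<Prod>i\<in>UNIV. if i = j then A else B) = A * (\<Prod>i\<in>UNIV - {j}. if i = j then A else B)"
    by (subst prod.remove[of _ j]) auto
  also have "(\<Prod>i\<in>UNIV - {j}. if i = j then A else B) = (\<Prod>i\<in>UNIV - {j}. B)"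
    by (intro prod.cong) auto
  finally show ?thesis by (simp add: card_Diff_singleton)
qed

lemma smooth_fun_cantor: "smooth_fun (\<lambda>z. cantor_fun \<rho> M K (z $ j))"
proof -
  have "smooth_fun (\<lambda>z. \<Sum>n<M ^ K. step (1 / \<rho> ^ K * z $ j + - cantor_pt \<rho> M K n / \<rho> ^ K) * (1 / real M ^ K))"
    by (intro smooth_fun_sum smooth_fun_mult smooth_fun_step smooth_fun_const)
  then show ?thesis by (simp add: cantor_fun_def diff_divide_distrib)
qed

lemma smooth_fun_block: "smooth_fun (block \<rho> M K j)"
  unfolding block_def[abs_def] by (intro smooth_fun_mult smooth_fun_cantor smooth_fun_cutoff)

lemma block_eq_0: "z \<notin> cbox (vec (-3)) (vec 3) \<Longrightarrow> block \<rho> M K j z = 0"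
  by (simp add: block_def cutoff_eq_0)

text \<open>The bound is independent of the depth \<open>K\<close>: each of the \<open>M ^ K\<close> smooth steps has height
  \<open>1 / M ^ K\<close> and is supported in a slab of width \<open>\<rho> ^ K\<close>.\<close>
lemma block_gradient_bound:
  obtains C where "0 \<le> C" "\<And>\<rho> M K j. 0 < \<rho> \<Longrightarrow> \<rho> \<le> 1 / 2 \<Longrightarrow> 0 < M \<Longrightarrow> M \<le> 2 \<Longrightarrow>
    \<exists>G. (\<forall>i. partial_deriv i (block \<rho> M K j) (\<lambda>z. G z $ i)) \<and> (\<forall>z. z \<notin> cbox (vec (-3)) (vec 3) \<longrightarrow> G z = 0)
      \<and> integrable lborel G \<and> (\<integral>z. norm (G z :: real^'n) \<partial>lborel) \<le> C"
proof -
  let ?Q = "cbox (vec (-3)) (vec 3) :: (real^'n) set"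
  let ?N = "CARD('n)"
  obtain d B where d: "\<And>t. (step has_real_derivative d t) (at t)"
    and B: "0 \<le> B" "\<And>t. \<bar>d t\<bar> \<le> B * indicator {0..1} t"
    using step_deriv by blast
  have "\<forall>i. \<exists>h. partial_deriv i (cutoff :: real^'n \<Rightarrow> real) h \<and> smooth_fun h"
    using smooth_fun_partial[OF smooth_fun_cutoff] by blast
  then obtain h where h: "\<And>i. partial_deriv i (cutoff :: real^'n \<Rightarrow> real) (h i)" "\<And>i. smooth_fun (h i)" by metis
  have h0: "h i z = 0" if "z \<notin> ?Q" for i z
    using partial_deriv_zero_outside[OF h(1) closed_cbox cutoff_eq_0 that] .
  have "\<exists>B. \<forall>z. \<bar>h i z\<bar> \<le> B" for i
    using continuous_bounded_support[OF smooth_fun_continuous[OF h(2)] h0 compact_cbox] by metis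
  then obtain b where b: "\<And>i z. \<bar>h i z\<bar> \<le> b i" by metis
  define C0 where "C0 = (\<Sum>i\<in>UNIV. b i)"
  have b0: "0 \<le> b i" for i using b[of i 0] by linarith
  have C0: "\<bar>h i z\<bar> \<le> C0 * indicator ?Q z" for i z
  proof (cases "z \<in> ?Q")
    case True
    have "b i \<le> C0" unfolding C0_def using b0 by (intro member_le_sum) auto
    then show ?thesis using b[of i z] True by simp
  qed (simp add: h0)
  have C0n: "0 \<le> C0" unfolding C0_def using b0 by (intro sum_nonneg) auto
  show ?thesis
  \<comment> \<open>Each of the \<open>M ^ K\<close> slabs has volume at most
    \<open>\<rho> ^ K * 6 ^ ?N\<close> and slope bound \<open>B / \<rho> ^ K / M ^ K\<close>, so
    everything but \<open>B * 6 ^ ?N\<close> cancels. The derivatives of the cutoff add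
    \<open>C0 * 6 ^ ?N\<close>, and the leading factor comes from bounding the norm by the sum of
    components.\<close>
  proof (rule that[of "real ?N * ((B + C0) * 6 ^ ?N)"])
    show "0 \<le> real ?N * ((B + C0) * 6 ^ ?N)" using B C0n by simp
    fix \<rho> :: real and M K :: nat and j :: 'n
    assume \<rho>: "0 < \<rho>" "\<rho> \<le> 1 / 2" and M: "0 < M" "M \<le> 2"
    let ?a = "cantor_pt \<rho> M K"
    have pK: "0 < \<rho> ^ K" "\<rho> ^ K \<le> 1" using \<rho> by (auto intro: power_le_one)
    have MK: "0 < real M ^ K" using M by simp
    define f where "f t = (\<Sum>n<M ^ K. d ((t - ?a n) / \<rho> ^ K) / \<rho> ^ K / real M ^ K)" for t
    have f: "(cantor_fun \<rho> M K has_real_derivative f t) (at t)" for t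
      unfolding cantor_fun_def[abs_def] f_def
    proof (rule DERIV_sum)
      fix n
      have "((\<lambda>t. (t - ?a n) / \<rho> ^ K) has_real_derivative 1 / \<rho> ^ K) (at t)"
        using pK by (auto intro!: derivative_eq_intros)
      from DERIV_cdivide[OF DERIV_chain2[OF d this]]
      show "((\<lambda>t. step ((t - ?a n) / \<rho> ^ K) / real M ^ K) has_real_derivative d ((t - ?a n) / \<rho> ^ K) / \<rho> ^ K / real M ^ K) (at t)"
        by simp
    qed
    define G where "G z = (\<chi> i. (if i = j then f (z $ j) else 0) * cutoff z + cantor_fun \<rho> M K (z $ j) * h i z)" for z
    have pd: "partial_deriv i (block \<rho> M K j) (\<lambda>z. G z $ i)" for i
      using partial_deriv_mult[OF partial_deriv_coord[OF f] h(1)] by (simp add: block_def[abs_def] G_def)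
    have G0: "G z = 0" if "z \<notin> ?Q" for z
      using that by (simp add: G_def cutoff_eq_0 h0 vec_eq_iff)
    have Gs: "smooth_fun (\<lambda>z. G z $ i)" for i
      using smooth_fun_partial[OF smooth_fun_block[of \<rho> M K j], of i] partial_deriv_unique[OF pd[of i]] by auto
    have Gc: "continuous_on UNIV G"
      using continuous_on_vec_lambda[of UNIV "\<lambda>i z. G z $ i"] smooth_fun_continuous[OF Gs] by simp
    define S where "S n = (cbox (\<chi> i. if i = j then ?a n else -3) (\<chi> i. if i = j then ?a n + \<rho> ^ K else 3) :: (real^'n) set)" for n
    define w where "w z = C0 * indicator ?Q z + (\<Sum>n<M ^ K. B / \<rho> ^ K / real M ^ K * indicator (S n) z)" for z :: "real^'n"
    have le_w: "\<bar>G z $ i\<bar> \<le> w z" for z i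
    proof (cases "z \<in> ?Q")
      case False
      then show ?thesis using B C0n pK MK by (auto simp: G0 w_def intro!: sum_nonneg add_nonneg_nonneg)
    next
      case True
      have Qz: "-3 \<le> z $ i \<and> z $ i \<le> 3" for i using True by (auto simp: mem_box_cart)
      have "\<bar>f (z $ j)\<bar> \<le> (\<Sum>n<M ^ K. \<bar>d ((z $ j - ?a n) / \<rho> ^ K) / \<rho> ^ K / real M ^ K\<bar>)"
        unfolding f_def by (rule sum_abs)
      also have "\<dots> \<le> (\<Sum>n<M ^ K. B / \<rho> ^ K / real M ^ K * indicator (S n) z)"
      proof (rule sum_mono)
        fix n
        have "indicator {0..1} ((z $ j - ?a n) / \<rho> ^ K) = (indicator (S n) z :: real)"
          using Qz pK by (auto simp: S_def indicator_def mem_box_cart field_simps)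
        then have "\<bar>d ((z $ j - ?a n) / \<rho> ^ K)\<bar> \<le> B * indicator (S n) z" using B(2) by metis
        then have "\<bar>d ((z $ j - ?a n) / \<rho> ^ K)\<bar> / (\<rho> ^ K * real M ^ K) \<le> B * indicator (S n) z / (\<rho> ^ K * real M ^ K)"
          using pK MK by (intro divide_right_mono) auto
        then show "\<bar>d ((z $ j - ?a n) / \<rho> ^ K) / \<rho> ^ K / real M ^ K\<bar> \<le> B / \<rho> ^ K / real M ^ K * indicator (S n) z"
          using pK MK by (simp add: abs_divide field_simps)
      qed
      finally have 1: "\<bar>f (z $ j)\<bar> \<le> (\<Sum>n<M ^ K. B / \<rho> ^ K / real M ^ K * indicator (S n) z)" .
      have "\<bar>(if i = j then f (z $ j) else 0) * cutoff z\<bar> \<le> \<bar>f (z $ j)\<bar> * 1"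
        unfolding abs_mult using cutoff_bounds[of z] by (intro mult_mono) auto
      moreover have "\<bar>cantor_fun \<rho> M K (z $ j) * h i z\<bar> \<le> 1 * (C0 * indicator ?Q z)"
        unfolding abs_mult using cantor_fun_bounds[OF \<rho> M, of K "z $ j"] C0[of i z] by (intro mult_mono) auto
      ultimately show ?thesis using 1 unfolding G_def w_def by simp
    qed
    have fm: "emeasure lborel (cbox p q) < \<infinity>" for p q :: "real^'n" by (rule emeasure_lborel_cbox_finite)
    have wi: "integrable lborel w"
      unfolding w_def S_def
      by (intro Bochner_Integration.integrable_add Bochner_Integration.integrable_sum integrable_mult_right integrable_real_indicator)
         (use fm in auto)
    have mQ: "measure lborel ?Q = 6 ^ ?N" by (subst measure_cbox_cart) simp_all
    have mS: "measure lborel (S n) \<le> \<rho> ^ K * 6 ^ ?N" for n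
    proof -
      have "measure lborel (S n) = (\<Prod>i\<in>UNIV. if i = j then \<rho> ^ K else 6)"
        unfolding S_def using pK by (subst measure_cbox_cart) (auto intro!: prod.cong)
      also have "\<dots> \<le> \<rho> ^ K * 6 ^ ?N"
        unfolding prod_single using pK by (intro mult_left_mono power_increasing) auto
      finally show ?thesis .
    qed
    have "integral\<^sup>L lborel w = C0 * measure lborel ?Q + (\<Sum>n<M ^ K. B / \<rho> ^ K / real M ^ K * measure lborel (S n))"
      unfolding w_def S_def
      using fm by (subst Bochner_Integration.integral_add)
        (auto intro!: Bochner_Integration.integrable_sum integrable_real_indicator simp: Bochner_Integration.integral_sum)
    also have "\<dots> \<le> C0 * 6 ^ ?N + (\<Sum>n<M ^ K. B / \<rho> ^ K / real M ^ K * (\<rho> ^ K * 6 ^ ?N))"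
      unfolding mQ using B pK MK mS by (intro add_left_mono sum_mono mult_left_mono) auto
    also have "\<dots> = (B + C0) * 6 ^ ?N" using \<rho> M by (simp add: field_simps)
    finally have iw: "integral\<^sup>L lborel w \<le> (B + C0) * 6 ^ ?N" .
    have nG: "norm (G z) \<le> real ?N * w z" for z
    proof -
      have "norm (G z) \<le> (\<Sum>i\<in>UNIV. \<bar>G z $ i\<bar>)" by (rule norm_le_l1_cart)
      also have "\<dots> \<le> (\<Sum>i\<in>(UNIV::'n set). w z)" using le_w by (intro sum_mono) auto
      finally show ?thesis by simp
    qed
    have Gi: "integrable lborel G"
    proof (rule Bochner_Integration.integrable_bound)
      show "integrable lborel (\<lambda>z. real ?N * w z)" using wi by simp
      show "G \<in> borel_measurable lborel" using Gc by (simp add: borel_measurable_continuous_onI)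
      show "AE z in lborel. norm (G z) \<le> norm (real ?N * w z)"
        using nG by (intro AE_I2) (metis abs_ge_self order_trans real_norm_def)
    qed
    have "(\<integral>z. norm (G z) \<partial>lborel) \<le> (\<integral>z. real ?N * w z \<partial>lborel)"
      using Gi wi nG by (intro integral_mono) auto
    also have "\<dots> \<le> real ?N * ((B + C0) * 6 ^ ?N)" using iw by (simp add: mult_left_mono)
    finally show "\<exists>G. (\<forall>i. partial_deriv i (block \<rho> M K j) (\<lambda>z. G z $ i)) \<and> (\<forall>z. z \<notin> ?Q \<longrightarrow> G z = 0)
      \<and> integrable lborel G \<and> (\<integral>z. norm (G z :: real^'n) \<partial>lborel) \<le> real ?N * ((B + C0) * 6 ^ ?N)"
      using pd G0 Gi by blast
  qed
qed

section \<open>Lower bound for a single block\<close>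

lemma emeasure_box_cart:
  fixes a b :: "real^'n"
  assumes "\<And>i. a $ i \<le> b $ i"
  shows "emeasure lebesgue (box a b) = ennreal (\<Prod>i\<in>UNIV. b $ i - a $ i)"
proof -
  have "emeasure lebesgue (box a b) = emeasure lborel (cbox a b)"
    by (simp add: emeasure_lborel_box_eq emeasure_lborel_cbox_eq)
  also have "\<dots> = ennreal (measure lborel (cbox a b))"
    by (rule emeasure_eq_ennreal_measure) (use emeasure_lborel_cbox_finite[of a b] in simp)
  finally show ?thesis by (simp add: measure_cbox_cart assms)
qed

lemma vec_nth_measurable[measurable]: "(\<lambda>x::real^'n. x $ i) \<in> borel_measurable borel"
  by (rule borel_measurable_continuous_onI) (intro continuous_intros)

text \<open>Covers the sets of pairs used below, where the box for the second point moves with the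
  first point.\<close>

lemma pair_box_measurable:
  fixes l1 u1 :: "real^'n" and l2 u2 :: "'n \<Rightarrow> real \<Rightarrow> real"
  assumes [measurable]: "\<And>i. l2 i \<in> borel_measurable borel" "\<And>i. u2 i \<in> borel_measurable borel"
  shows "{z. fst z \<in> box l1 u1 \<and> snd z \<in> box (\<chi> i. l2 i (fst z $ i)) (\<chi> i. u2 i (fst z $ i))}
     \<in> sets (lebesgue \<Otimes>\<^sub>M (lebesgue :: (real^'n) measure))" (is "?A \<in> sets ?L")
proof -
  have f[measurable]: "(\<lambda>z. fst z $ i) \<in> borel_measurable ?L" and s[measurable]: "(\<lambda>z. snd z $ i) \<in> borel_measurable ?L" for i
    by (rule measurable_compose[OF measurable_fst_snd_lebesgue(1) vec_nth_measurable],
        rule measurable_compose[OF measurable_fst_snd_lebesgue(2) vec_nth_measurable])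
  have l: "(\<lambda>z. l2 i (fst z $ i)) \<in> borel_measurable ?L" and u: "(\<lambda>z. u2 i (fst z $ i)) \<in> borel_measurable ?L" for i
    by (rule measurable_compose[OF f assms(1)], rule measurable_compose[OF f assms(2)])
  have "?A = (\<Inter>i. {z \<in> space ?L. l1 $ i < fst z $ i} \<inter> {z \<in> space ?L. fst z $ i < u1 $ i} \<inter>
     {z \<in> space ?L. l2 i (fst z $ i) < snd z $ i} \<inter> {z \<in> space ?L. snd z $ i < u2 i (fst z $ i)})"
    by (auto simp: mem_box_cart space_pair_measure)
  also have "\<dots> \<in> sets ?L"
    by (intro sets.countable_INT' sets.Int borel_measurable_less borel_measurable_const f s l u) auto
  finally show ?thesis .
qed

text \<open>A pair of points straddling a \<open>k\<close>-th generation interval of the Cantor construction at distance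
  comparable to \<open>\<rho> ^ k\<close> sees an increment of at least \<open>1 / M ^ k = (\<rho> ^ k) powr (1 + \<gamma>)\<close>. Since there are
  \<open>M ^ k\<close> such intervals, each generation contributes the same amount to \<open>nu\<close>, and the
  contributions of the generations \<open>k < K\<close> are disjoint.\<close>
lemma nu_block_lower_bound:
  fixes u :: "real^'n \<Rightarrow> real" and j :: 'n and p :: "real^'n" and \<rho> \<gamma> c r lam :: real and M K :: nat
  assumes \<rho>: "0 < \<rho>" "\<rho> \<le> 1 / 2" and M: "0 < M" "M \<le> 2"
    and \<gamma>: "-1 \<le> \<gamma>" "\<gamma> < 0" and M\<rho>: "real M * \<rho> powr (1 + \<gamma>) = 1"
    and c: "c > 0" and r: "r > 0" and lam: "lam > 0" "lam * (real CARD('n) + 1) * r powr (1 + \<gamma>) < c"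
    and u: "\<And>x. (\<And>i. \<bar>x $ i - p $ i\<bar> < 3 * r) \<Longrightarrow> u x = c * block \<rho> M K j ((1 / r) *\<^sub>R (x - p))"
  shows "ennreal ((real CARD('n) + 1) powr (\<gamma> - real CARD('n)) * 4 ^ (CARD('n) - 1) / 4
      * real K * r powr (real CARD('n) + \<gamma>)) \<le> nu \<gamma> (Eset lam \<gamma> u)"
proof -
  let ?N = "CARD('n)"
  let ?D = "real ?N + 1"
  let ?L = "lebesgue \<Otimes>\<^sub>M lebesgue :: ((real^'n) \<times> (real^'n)) measure"
  define a where "a = cantor_pt \<rho> M"
  have q: "0 < \<rho> ^ k" "\<rho> ^ k \<le> 1" for k using \<rho> by (auto intro: power_le_one)
  \<comment> \<open>In direction \<open>j\<close> the first point lies to the left of the interval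
    and the second to its right, each within half the interval length. In the other directions the
    first point ranges over the core of the block and the second stays within
    \<open>r * \<rho> ^ k\<close> of it, so the distance remains comparable to the interval
    length.\<close>
  define X where "X k n = box (\<chi> i. if i = j then p $ j + r * (a k n - \<rho> ^ k / 2) else p $ i - r)
    (\<chi> i. if i = j then p $ j + r * a k n else p $ i + r)" for k n
  define Y where "Y k n x = box (\<chi> i. if i = j then p $ j + r * (a k n + \<rho> ^ k) else x $ i - r * \<rho> ^ k)
    (\<chi> i. if i = j then p $ j + r * (a k n + 3 / 2 * \<rho> ^ k) else x $ i + r * \<rho> ^ k)" for k n and x :: "real^'n"
  define A where "A k n = {z. fst z \<in> X k n \<and> snd z \<in> Y k n (fst z)}" for k n
  have Am[measurable]: "A k n \<in> sets ?L" for k n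
    unfolding A_def X_def Y_def
    using pair_box_measurable[of "\<lambda>i t. if i = j then p $ j + r * (a k n + \<rho> ^ k) else t - r * \<rho> ^ k"
        "\<lambda>i t. if i = j then p $ j + r * (a k n + 3 / 2 * \<rho> ^ k) else t + r * \<rho> ^ k"] by simp
  have eX: "emeasure lebesgue (X k n) = ennreal (r * \<rho> ^ k / 2 * (2 * r) ^ (?N - 1))" for k n
  proof -
    have "emeasure lebesgue (X k n) = ennreal (\<Prod>i\<in>UNIV. if i = j then r * \<rho> ^ k / 2 else 2 * r)"
      unfolding X_def using r q[of k]
      by (subst emeasure_box_cart) (auto intro!: arg_cong[where f=ennreal] prod.cong simp: algebra_simps)
    then show ?thesis by (simp only: prod_single)
  qed
  have eY: "emeasure lebesgue (Y k n x) = ennreal (r * \<rho> ^ k / 2 * (2 * r * \<rho> ^ k) ^ (?N - 1))" for k n x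
  proof -
    have "emeasure lebesgue (Y k n x) = ennreal (\<Prod>i\<in>UNIV. if i = j then r * \<rho> ^ k / 2 else 2 * r * \<rho> ^ k)"
      unfolding Y_def using r q[of k]
      by (subst emeasure_box_cart) (auto intro!: arg_cong[where f=ennreal] prod.cong simp: algebra_simps)
    then show ?thesis by (simp only: prod_single)
  qed
  have eA: "emeasure ?L (A k n) = ennreal (4 ^ (?N - 1) / 4 * r ^ (2 * ?N) * (\<rho> ^ k) ^ (?N + 1))" for k n
  proof -
    have [measurable]: "X k n \<in> sets lebesgue" unfolding X_def by simp
    obtain m where m: "?N = Suc m" by (metis not0_implies_Suc zero_less_card_finite less_irrefl)
    have "emeasure ?L (A k n) = (\<integral>\<^sup>+x. emeasure lebesgue (Pair x -` A k n) \<partial>lebesgue)"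
      by (rule sigma_finite_measure.emeasure_pair_measure_alt[OF sigma_finite_lebesgue Am])
    \<comment> \<open>The measure of \<open>Y k n x\<close> does not depend on \<open>x\<close>, so
      the iterated integral becomes a product.\<close>
    also have "\<dots> = (\<integral>\<^sup>+x. ennreal (r * \<rho> ^ k / 2 * (2 * r * \<rho> ^ k) ^ (?N - 1)) * indicator (X k n) x \<partial>lebesgue)"
    proof (rule nn_integral_cong)
      fix x
      have "Pair x -` A k n = (if x \<in> X k n then Y k n x else {})" by (auto simp: A_def)
      then show "emeasure lebesgue (Pair x -` A k n) = ennreal (r * \<rho> ^ k / 2 * (2 * r * \<rho> ^ k) ^ (?N - 1)) * indicator (X k n) x"
        by (simp add: eY)
    qed
    also have "\<dots> = ennreal (r * \<rho> ^ k / 2 * (2 * r * \<rho> ^ k) ^ (?N - 1)) * ennreal (r * \<rho> ^ k / 2 * (2 * r) ^ (?N - 1))"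
      by (subst nn_integral_cmult_indicator) (simp_all add: eX)
    also have "\<dots> = ennreal ((r * \<rho> ^ k / 2 * (2 * r * \<rho> ^ k) ^ (?N - 1)) * (r * \<rho> ^ k / 2 * (2 * r) ^ (?N - 1)))"
      using r q[of k] by (subst ennreal_mult) auto
    also have "(r * \<rho> ^ k / 2 * (2 * r * \<rho> ^ k) ^ (?N - 1)) * (r * \<rho> ^ k / 2 * (2 * r) ^ (?N - 1))
      = 4 ^ (?N - 1) / 4 * r ^ (2 * ?N) * (\<rho> ^ k) ^ (?N + 1)"
    proof -
      have h: "(2 * r * Q) ^ m * (2 * r) ^ m = 4 ^ m * (r * r) ^ m * Q ^ m" for Q
        by (simp only: power_mult_distrib[symmetric]) (simp add: algebra_simps)
      have alg: "(r * Q / 2 * A) * (r * Q / 2 * B) = r * r * Q * Q * (A * B) / 4" for Q A B :: real by simp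
      have "r ^ (2 * Suc m) = r * r * (r * r) ^ m" by (simp add: power_mult power2_eq_square)
      then have "4 ^ m / 4 * r ^ (2 * Suc m) * Q ^ (Suc m + 1) = r * r * Q * Q * (4 ^ m * (r * r) ^ m * Q ^ m) / 4" for Q
        by (simp only: power_Suc add_Suc_right add_0_right One_nat_def) simp
      from this[of "\<rho> ^ k"] show ?thesis unfolding m diff_Suc_1 alg h by (rule sym)
    qed
    finally show ?thesis .
  qed
  \<comment> \<open>Here \<open>\<rho>\<close> and \<open>M\<close> are tied together: the power of
    the distance scale in the denominator of \<open>Eset\<close> equals the increment
    \<open>1 / M ^ k\<close>, so their quotient is the same in every generation.\<close>
  have q\<beta>: "(\<rho> ^ k) powr (1 + \<gamma>) = 1 / real M ^ k" for k
  proof -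
    have "(\<rho> ^ k) powr (1 + \<gamma>) = (\<rho> powr real k) powr (1 + \<gamma>)" using \<rho> by (simp add: powr_realpow)
    also have "\<dots> = (\<rho> powr (1 + \<gamma>)) powr real k" by (simp add: powr_powr mult.commute)
    also have "\<dots> = (\<rho> powr (1 + \<gamma>)) ^ k" using \<rho> by (simp add: powr_realpow)
    also have "\<rho> powr (1 + \<gamma>) = 1 / real M" using M\<rho> M by (simp add: field_simps)
    finally show ?thesis by (simp add: power_one_over)
  qed
  have inE: "z \<in> Eset lam \<gamma> u \<and> fst z \<noteq> snd z \<and> (?D * r * \<rho> ^ k) powr (\<gamma> - real ?N) \<le> dist (fst z) (snd z) powr (\<gamma> - real ?N)"
    if z: "z \<in> A k n" and k: "k < K" and n: "n < M ^ k" for z k n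
  proof -
    obtain x y where xy: "z = (x, y)" by (cases z)
    note ab = cantor_pt_bounds[OF \<rho> M n, folded a_def]
    have h1: "(if i = j then p $ j + r * (a k n - \<rho> ^ k / 2) else p $ i - r) < x $ i"
        "x $ i < (if i = j then p $ j + r * a k n else p $ i + r)"
      and h2: "(if i = j then p $ j + r * (a k n + \<rho> ^ k) else x $ i - r * \<rho> ^ k) < y $ i"
        "y $ i < (if i = j then p $ j + r * (a k n + 3 / 2 * \<rho> ^ k) else x $ i + r * \<rho> ^ k)" for i
      using z unfolding xy A_def X_def Y_def mem_box_cart mem_Collect_eq fst_conv snd_conv vec_lambda_beta by blast+
    have xj: "p $ j + r * (a k n - \<rho> ^ k / 2) < x $ j" "x $ j < p $ j + r * a k n"
      and yj: "p $ j + r * (a k n + \<rho> ^ k) < y $ j" "y $ j < p $ j + r * (a k n + 3 / 2 * \<rho> ^ k)"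
      using h1[of j] h2[of j] by simp_all
    have xi: "p $ i - r < x $ i \<and> x $ i < p $ i + r"
      and yi: "x $ i - r * \<rho> ^ k < y $ i \<and> y $ i < x $ i + r * \<rho> ^ k" if "i \<noteq> j" for i
      using h1[of i] h2[of i] that by simp_all
    define X' where "X' = (1 / r) *\<^sub>R (x - p)"
    define Y' where "Y' = (1 / r) *\<^sub>R (y - p)"
    have xX: "x $ i = p $ i + r * X' $ i" and yY: "y $ i = p $ i + r * Y' $ i" for i
      using r by (simp_all add: X'_def Y'_def)
    have Xj: "a k n - \<rho> ^ k / 2 < X' $ j" "X' $ j < a k n"
      and Yj: "a k n + \<rho> ^ k < Y' $ j" "Y' $ j < a k n + 3 / 2 * \<rho> ^ k"
      using xj yj r unfolding xX yY by simp_all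
    have Xi: "-1 < X' $ i" "X' $ i < 1" if "i \<noteq> j" for i
    proof -
      have "r * (-1) < r * X' $ i" "r * X' $ i < r * 1" using xi[OF that] unfolding xX by simp_all
      then show "-1 < X' $ i" "X' $ i < 1" using r by (simp_all only: mult_less_cancel_left_pos)
    qed
    have Yi: "X' $ i - \<rho> ^ k < Y' $ i" "Y' $ i < X' $ i + \<rho> ^ k" if "i \<noteq> j" for i
    proof -
      have "r * (X' $ i - \<rho> ^ k) < r * Y' $ i" "r * Y' $ i < r * (X' $ i + \<rho> ^ k)"
        using yi[OF that] unfolding xX yY by (simp_all add: algebra_simps)
      then show "X' $ i - \<rho> ^ k < Y' $ i" "Y' $ i < X' $ i + \<rho> ^ k" using r by (simp_all only: mult_less_cancel_left_pos)
    qed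
    have bX: "\<bar>X' $ i\<bar> \<le> 2" and bY: "\<bar>Y' $ i\<bar> \<le> 2" for i
      using Xi[of i] Yi[of i] Xj Yj ab q[of k] by (cases "i = j"; force simp: abs_le_iff)+
    have ux: "u x = c * cantor_fun \<rho> M K (X' $ j)"
    proof -
      have "u x = c * block \<rho> M K j X'"
        unfolding X'_def
      proof (rule u)
        fix i
        have "\<bar>r * X' $ i\<bar> \<le> r * 2" unfolding abs_mult using bX[of i] r by simp
        then show "\<bar>x $ i - p $ i\<bar> < 3 * r" using r unfolding xX by simp
      qed
      then show ?thesis by (simp add: block_def cutoff_eq_1 bX)
    qed
    have uy: "u y = c * cantor_fun \<rho> M K (Y' $ j)"
    proof -
      have "u y = c * block \<rho> M K j Y'"
        unfolding Y'_def
      proof (rule u)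
        fix i
        have "\<bar>r * Y' $ i\<bar> \<le> r * 2" unfolding abs_mult using bY[of i] r by simp
        then show "\<bar>y $ i - p $ i\<bar> < 3 * r" using r unfolding yY by simp
      qed
      then show ?thesis by (simp add: block_def cutoff_eq_1 bY)
    qed
    have inc: "1 / real M ^ k \<le> cantor_fun \<rho> M K (Y' $ j) - cantor_fun \<rho> M K (X' $ j)"
      using cantor_fun_increment[OF \<rho> M _ n, of K "X' $ j" "Y' $ j"] k Xj Yj by (simp add: a_def)
    have ne: "x \<noteq> y" using Xj Yj q[of k] by (auto simp: X'_def Y'_def)
    have "dist x y \<le> (\<Sum>i\<in>UNIV. \<bar>(x - y) $ i\<bar>)" unfolding dist_norm by (rule norm_le_l1_cart)
    \<comment> \<open>Coordinate \<open>j\<close> differs by at most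
      \<open>2 * r * \<rho> ^ k\<close> and every other one by at most half of that; the sum
      explains \<open>?D\<close>.\<close>
    also have "\<dots> \<le> (\<Sum>i\<in>UNIV. r * \<rho> ^ k + (if i = j then r * \<rho> ^ k else 0))"
    proof (rule sum_mono)
      fix i
      have "\<bar>X' $ i - Y' $ i\<bar> \<le> \<rho> ^ k + (if i = j then \<rho> ^ k else 0)"
        using Yi[of i] Xj Yj q[of k] by (cases "i = j"; force simp: abs_le_iff)
      then have "r * \<bar>X' $ i - Y' $ i\<bar> \<le> r * (\<rho> ^ k + (if i = j then \<rho> ^ k else 0))"
        using r by (intro mult_left_mono) auto
      moreover have "\<bar>(x - y) $ i\<bar> = r * \<bar>X' $ i - Y' $ i\<bar>"
        using r unfolding vector_minus_component xX yY by (simp add: right_diff_distrib[symmetric] abs_mult)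
      ultimately show "\<bar>(x - y) $ i\<bar> \<le> r * \<rho> ^ k + (if i = j then r * \<rho> ^ k else 0)"
        by (simp add: distrib_left split: if_splits)
    qed
    also have "\<dots> = ?D * r * \<rho> ^ k" by (simp add: sum.distrib algebra_simps)
    finally have dist: "dist x y \<le> ?D * r * \<rho> ^ k" .
    have "lam * dist x y powr (1 + \<gamma>) \<le> lam * (?D * r * \<rho> ^ k) powr (1 + \<gamma>)"
      using dist lam \<gamma> by (intro mult_left_mono powr_mono2) auto
    also have "\<dots> = lam * (?D powr (1 + \<gamma>) * r powr (1 + \<gamma>) / real M ^ k)"
      using r q[of k] by (simp add: powr_mult q\<beta>)
    also have "\<dots> \<le> lam * (?D * r powr (1 + \<gamma>) / real M ^ k)"
    proof -
      \<comment> \<open>As \<open>?D \<ge> 1\<close> and \<open>1 + \<gamma> < 1\<close>, the power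
        may be replaced by \<open>?D\<close> itself; hence the plain factor in the assumption on
        \<open>lam\<close>.\<close>
      have "?D powr (1 + \<gamma>) \<le> ?D powr 1" using \<gamma> by (intro powr_mono) auto
      then show ?thesis using lam by (intro mult_left_mono divide_right_mono mult_right_mono) auto
    qed
    also have "\<dots> < c * (1 / real M ^ k)"
      using lam M by (simp add: divide_strict_right_mono mult.assoc)
    also have "\<dots> \<le> c * (cantor_fun \<rho> M K (Y' $ j) - cantor_fun \<rho> M K (X' $ j))"
      using inc c by (intro mult_left_mono) auto
    also have "\<dots> \<le> \<bar>u x - u y\<bar>" unfolding ux uy by (simp add: right_diff_distrib)
    finally have "lam < \<bar>u x - u y\<bar> / dist x y powr (1 + \<gamma>)"
      using ne by (simp add: field_simps)
    then have "z \<in> Eset lam \<gamma> u" using ne by (simp add: Eset_def xy)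
    moreover have "(?D * r * \<rho> ^ k) powr (\<gamma> - real ?N) \<le> dist x y powr (\<gamma> - real ?N)"
      using dist ne \<gamma> by (intro powr_mono2') auto
    ultimately show ?thesis using ne by (simp add: xy)
  qed
  \<comment> \<open>In block coordinates the separation \<open>t - s\<close> in direction
    \<open>j\<close> lies strictly between \<open>\<rho> ^ k\<close> and
    \<open>2 * \<rho> ^ k\<close>. For different \<open>k\<close> these ranges are disjoint since
    \<open>\<rho> \<le> 1 / 2\<close>, so the pair determines \<open>k\<close>. The spacing of the
    intervals then determines \<open>n\<close>.\<close>
  have disj: "(k, n) = (k', n')" if z: "z \<in> A k n" "z \<in> A k' n'" for z k n k' n'
  proof -
    obtain x y where xy: "z = (x, y)" by (cases z)
    have xj: "r * (a k n - \<rho> ^ k / 2) < x $ j - p $ j" "x $ j - p $ j < r * a k n"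
      and yj: "r * (a k n + \<rho> ^ k) < y $ j - p $ j" "y $ j - p $ j < r * (a k n + 3 / 2 * \<rho> ^ k)"
      if "z \<in> A k n" for k n
      using that unfolding xy A_def X_def Y_def mem_box_cart by (auto dest!: spec[of _ j])
    define s t where "s = (x $ j - p $ j) / r" and "t = (y $ j - p $ j) / r"
    have st: "a k n - \<rho> ^ k / 2 < s" "s < a k n" "a k n + \<rho> ^ k < t" "t < a k n + 3 / 2 * \<rho> ^ k"
      if "z \<in> A k n" for k n
      using xj[OF that] yj[OF that] r by (simp_all add: s_def t_def field_simps)
    note h = st[OF z(1)] st[OF z(2)]
    have kk: "\<not> m < l" if "\<rho> ^ m < t - s" "t - s < 2 * \<rho> ^ l" for m l
    proof
      assume "m < l"
      then have "\<rho> ^ l \<le> \<rho> ^ Suc m" using \<rho> by (intro power_decreasing) auto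
      also have "\<rho> ^ Suc m \<le> \<rho> ^ m / 2" using \<rho> by (simp add: mult_right_mono)
      finally show False using that by linarith
    qed
    have "k = k'" using kk[of k k'] kk[of k' k] h by linarith
    moreover have "\<not> m < l" if "a k l - \<rho> ^ k / 2 < s" "s < a k m" for m l
      using cantor_pt_spacing[OF \<rho> M, of m l k, folded a_def] that q(1)[of k] by linarith
    ultimately have "n = n'" using h by (metis linorder_neqE_nat)
    then show ?thesis using \<open>k = k'\<close> by simp
  qed
  define I where "I = Sigma {..<K} (\<lambda>k. {..<M ^ k})"
  have fI: "finite I" by (simp add: I_def)
  let ?w = "\<lambda>k. ennreal ((?D * r * \<rho> ^ k) powr (\<gamma> - real ?N))"
  \<comment> \<open>By disjointness at most one term is nonzero at a given \<open>z\<close>, so the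
    sum never exceeds the weight of a single pair.\<close>
  have pw: "(\<Sum>(k, n)\<in>I. ?w k * indicator (A k n) z)
      \<le> indicator (Eset lam \<gamma> u) z * ennreal (dist (fst z) (snd z) powr (\<gamma> - real ?N))" for z
  proof (cases "\<exists>(k, n)\<in>I. z \<in> A k n")
    case True
    then obtain k n where kn: "(k, n) \<in> I" "z \<in> A k n" by blast
    have "(\<Sum>(k, n)\<in>I. ?w k * indicator (A k n) z) = (\<Sum>(k, n)\<in>{(k, n)}. ?w k * indicator (A k n) z)"
    proof (rule sum.mono_neutral_right[OF fI], goal_cases)
      case 2
      show ?case
      proof (rule ballI)
        fix i assume i: "i \<in> I - {(k, n)}"
        obtain k' n' where i': "i = (k', n')" by (cases i)
        have "z \<notin> A k' n'" using disj[OF kn(2), of k' n'] i i' by auto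
        then show "(case i of (k, n) \<Rightarrow> ?w k * indicator (A k n) z) = 0" by (simp add: i')
      qed
    qed (use kn in simp)
    also have "\<dots> = ?w k" using kn by simp
    also have "\<dots> \<le> indicator (Eset lam \<gamma> u) z * ennreal (dist (fst z) (snd z) powr (\<gamma> - real ?N))"
      using inE[OF kn(2)] kn(1) by (simp add: I_def ennreal_leI)
    finally show ?thesis .
  next
    case False
    then have "(\<Sum>(k, n)\<in>I. ?w k * indicator (A k n) z) = 0"
      by (intro sum.neutral) (auto simp: indicator_def)
    then show ?thesis by simp
  qed
  have "(\<Sum>(k, n)\<in>I. ?w k * emeasure ?L (A k n)) = (\<integral>\<^sup>+z. (\<Sum>(k, n)\<in>I. ?w k * indicator (A k n) z) \<partial>?L)"
    unfolding split_beta by (subst nn_integral_sum) (simp_all add: nn_integral_cmult_indicator)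
  also have "\<dots> \<le> nu \<gamma> (Eset lam \<gamma> u)"
    unfolding nu_Eset by (rule nn_integral_mono) (rule pw)
  finally have le: "(\<Sum>(k, n)\<in>I. ?w k * emeasure ?L (A k n)) \<le> nu \<gamma> (Eset lam \<gamma> u)" .
  define \<kappa> where "\<kappa> = ?D powr (\<gamma> - real ?N) * 4 ^ (?N - 1) / 4"
  \<comment> \<open>The exponents add up to \<open>?N + \<gamma>\<close> for \<open>r\<close> and to
    \<open>1 + \<gamma>\<close> for \<open>\<rho> ^ k\<close>, and the latter power is
    \<open>1 / M ^ k\<close>. Summing over the \<open>M ^ k\<close> intervals makes every generation
    contribute the same amount, which yields the factor \<open>K\<close>.\<close>
  have wt: "?w k * emeasure ?L (A k n) = ennreal (\<kappa> * r powr (real ?N + \<gamma>) / real M ^ k)" for k n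
  proof -
    have "(?D * r * \<rho> ^ k) powr (\<gamma> - real ?N) * (4 ^ (?N - 1) / 4 * r ^ (2 * ?N) * (\<rho> ^ k) ^ (?N + 1))
      = \<kappa> * (r powr (\<gamma> - real ?N) * r powr (real (2 * ?N))) * ((\<rho> ^ k) powr (\<gamma> - real ?N) * (\<rho> ^ k) powr (real (?N + 1)))"
      unfolding powr_realpow[OF r] powr_realpow[OF q(1)] using r q[of k] by (simp add: powr_mult \<kappa>_def)
    also have "\<dots> = \<kappa> * r powr (real ?N + \<gamma>) * (\<rho> ^ k) powr (1 + \<gamma>)"
      by (simp add: powr_add[symmetric] algebra_simps)
    finally show ?thesis
      unfolding eA using r q[of k] by (subst ennreal_mult[symmetric]) (simp_all add: q\<beta>)
  qed
  have \<kappa>0: "0 \<le> \<kappa>" by (simp add: \<kappa>_def)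
  have "(\<Sum>(k, n)\<in>I. ?w k * emeasure ?L (A k n)) = (\<Sum>(k, n)\<in>I. ennreal (\<kappa> * r powr (real ?N + \<gamma>) / real M ^ k))"
    by (simp only: wt)
  also have "\<dots> = ennreal (\<Sum>(k, n)\<in>I. \<kappa> * r powr (real ?N + \<gamma>) / real M ^ k)"
    unfolding split_beta using \<kappa>0 by (intro sum_ennreal) auto
  also have "(\<Sum>(k, n)\<in>I. \<kappa> * r powr (real ?N + \<gamma>) / real M ^ k) = \<kappa> * real K * r powr (real ?N + \<gamma>)"
    unfolding I_def using M by (subst sum.Sigma[symmetric]) auto
  finally show ?thesis using le unfolding \<kappa>_def by simp
qed

section \<open>Series of disjoint blocks\<close>

lemma integral_affine_lborel:
  fixes f :: "'a::euclidean_space \<Rightarrow> real"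
  assumes [measurable]: "f \<in> borel_measurable borel" and r: "r > 0"
  shows "(\<integral>x. f x \<partial>lborel) = r ^ DIM('a) * (\<integral>z. f (p + r *\<^sub>R z) \<partial>lborel)"
proof -
  have "(\<integral>x. f x \<partial>lborel) = (\<integral>x. f x \<partial>density (distr lborel borel (\<lambda>x. p + r *\<^sub>R x)) (\<lambda>_. r ^ DIM('a)))"
    using r by (subst lborel_affine[of r p]) (simp_all add: power_abs)
  also have "\<dots> = (\<integral>x. r ^ DIM('a) * f x \<partial>distr lborel borel (\<lambda>x. p + r *\<^sub>R x))"
    using r by (subst integral_density) auto
  also have "\<dots> = r ^ DIM('a) * (\<integral>z. f (p + r *\<^sub>R z) \<partial>lborel)"
    by (subst integral_distr) auto
  finally show ?thesis .
qed

lemma integrable_affine_lborel: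
  fixes f :: "'a::euclidean_space \<Rightarrow> 'b::{banach, second_countable_topology}"
  assumes f: "integrable lborel f" and r: "r > 0"
  shows "integrable lborel (\<lambda>x. f (p + r *\<^sub>R x))"
proof -
  have [measurable]: "f \<in> borel_measurable borel" using f by auto
  have "lborel = density (distr lborel borel (\<lambda>x::'a. p + r *\<^sub>R x)) (\<lambda>_. r ^ DIM('a))"
    using r by (subst lborel_affine[of r p]) (simp_all add: power_abs)
  then have "integrable (density (distr lborel borel (\<lambda>x. p + r *\<^sub>R x)) (\<lambda>_. r ^ DIM('a))) f"
    using f by metis
  then have "integrable (distr lborel borel (\<lambda>x. p + r *\<^sub>R x)) (\<lambda>x. r ^ DIM('a) *\<^sub>R f x)"
    using r by (subst (asm) integrable_density) auto
  then have "integrable lborel (\<lambda>x. r ^ DIM('a) *\<^sub>R f (p + r *\<^sub>R x))"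
    by (subst (asm) integrable_distr_eq) auto
  from integrable_scaleR_right[OF this, of "inverse (r ^ DIM('a))"] show ?thesis using r by simp
qed

text \<open>The image of the cube of half-side 3 that supports a block, under scaling by
  \<open>r\<close> and translation by \<open>p\<close>.\<close>

definition cube :: "real^'n \<Rightarrow> real \<Rightarrow> (real^'n) set" where
  "cube p r = {x. \<forall>i. \<bar>x $ i - p $ i\<bar> \<le> 3 * r}"

lemma cube_eq_cbox: "cube p r = cbox (\<chi> i. p $ i - 3 * r) (\<chi> i. p $ i + 3 * r)"
proof -
  have "\<bar>x - y\<bar> \<le> 3 * r \<longleftrightarrow> y - 3 * r \<le> x \<and> x \<le> y + 3 * r" for x y :: real by linarith
  then show ?thesis by (simp add: cube_def set_eq_iff mem_box_cart)
qed

text \<open>Gradients scale by \<open>c / r\<close> and volumes by \<open>r ^ CARD('n)\<close>. The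
  product gives the factor \<open>c * r ^ (CARD('n) - 1)\<close>, the quantity that must be summable
  for a series of blocks to lie in \<open>W11\<close>.\<close>

lemma scaled_block:
  fixes p :: "real^'n" and c r :: real
  defines "T \<equiv> \<lambda>x. (1 / r) *\<^sub>R (x - p)"
  assumes c: "c > 0" and r: "r > 0"
    and V: "smooth_fun V" "\<And>i. partial_deriv i V (\<lambda>z. G z $ i)" "\<And>z. \<bar>V z\<bar> \<le> 1"
      "\<And>z. z \<notin> cbox (vec (-3)) (vec 3) \<Longrightarrow> V z = 0"
    and G: "integrable lborel G" "(\<integral>z. norm (G z) \<partial>lborel) \<le> C"
      "\<And>z. z \<notin> cbox (vec (-3)) (vec 3) \<Longrightarrow> G z = 0"
  shows "smooth_fun (\<lambda>x. c * V (T x))"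
    and "\<And>x. x \<notin> cube p r \<Longrightarrow> c * V (T x) = 0" "\<And>x. x \<notin> cube p r \<Longrightarrow> (c / r) *\<^sub>R G (T x) = 0"
    and "weak_gradient (\<lambda>x. c * V (T x)) (\<lambda>x. (c / r) *\<^sub>R G (T x))"
    and "integrable lebesgue (\<lambda>x. c * V (T x))" "integrable lebesgue (\<lambda>x. (c / r) *\<^sub>R G (T x))"
    and "(\<integral>x. \<bar>c * V (T x)\<bar> \<partial>lebesgue) \<le> c * (6 * r) ^ CARD('n)"
    and "(\<integral>x. norm ((c / r) *\<^sub>R G (T x)) \<partial>lebesgue) \<le> C * (c * r ^ (CARD('n) - 1))"
proof -
  let ?N = "CARD('n)"
  have T: "T x = (1 / r) *\<^sub>R x + - ((1 / r) *\<^sub>R p)" for x by (simp add: T_def scaleR_diff_right)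
  show s: "smooth_fun (\<lambda>x. c * V (T x))"
    unfolding T by (intro smooth_fun_mult smooth_fun_const smooth_fun_affine V)
  have pd: "partial_deriv i (\<lambda>x. c * V (T x)) (\<lambda>x. ((c / r) *\<^sub>R G (T x)) $ i)" for i
    unfolding T using partial_deriv_mult[OF partial_deriv_const[of i c]
      partial_deriv_affine[where s="1 / r" and q="- ((1 / r) *\<^sub>R p)", OF V(2)[of i]]]
    by simp
  show wg: "weak_gradient (\<lambda>x. c * V (T x)) (\<lambda>x. (c / r) *\<^sub>R G (T x))"
    by (rule weak_gradient_smooth[OF s pd])
  have out: "T x \<notin> cbox (vec (-3)) (vec 3)" if xc: "x \<notin> cube p r" for x
  proof -
    obtain i where i: "\<not> \<bar>x $ i - p $ i\<bar> \<le> 3 * r" using xc unfolding cube_def by auto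
    have "x $ i - p $ i = r * T x $ i" using r by (simp add: T_def)
    then have "r * 3 < r * \<bar>T x $ i\<bar>" using i r by (simp add: abs_mult)
    then have "3 < \<bar>T x $ i\<bar>" using r by simp
    then have "\<not> (- 3 \<le> T x $ i \<and> T x $ i \<le> 3)" by linarith
    then show ?thesis unfolding mem_box_cart vec_component by blast
  qed
  show v0: "c * V (T x) = 0" and g0: "(c / r) *\<^sub>R G (T x) = 0" if "x \<notin> cube p r" for x
    using V(4) G(3) out[OF that] by simp_all
  have vm: "(\<lambda>x. c * V (T x)) \<in> borel_measurable borel"
    by (rule borel_measurable_continuous_onI[OF smooth_fun_continuous[OF s]])
  have Tm[measurable]: "T \<in> borel_measurable borel" unfolding T_def by measurable
  have Gm[measurable]: "G \<in> borel_measurable borel" using G(1) by auto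
  have gm: "(\<lambda>x. (c / r) *\<^sub>R G (T x)) \<in> borel_measurable borel" by measurable
  have ci: "integrable lborel (\<lambda>x. c * indicator (cube p r) x)"
    unfolding cube_eq_cbox using emeasure_lborel_cbox_finite
    by (intro integrable_mult_right integrable_real_indicator) auto
  have bd: "\<bar>c * V (T x)\<bar> \<le> c * indicator (cube p r) x" for x
    using V(3)[of "T x"] v0[of x] c by (cases "x \<in> cube p r") (auto simp: abs_mult)
  have vi: "integrable lborel (\<lambda>x. c * V (T x))"
    by (rule Bochner_Integration.integrable_bound[OF ci])
       (use vm in \<open>auto intro!: AE_I2 order_trans[OF bd]\<close>)
  then show "integrable lebesgue (\<lambda>x. c * V (T x))"
    using integrable_completion[of "\<lambda>x. c * V (T x)" lborel] vm by simp
  have "(\<integral>x. \<bar>c * V (T x)\<bar> \<partial>lebesgue) = (\<integral>x. \<bar>c * V (T x)\<bar> \<partial>lborel)"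
    using vm by (intro integral_completion) simp
  also have "\<dots> \<le> (\<integral>x. c * indicator (cube p r) x \<partial>lborel)"
    using vi ci bd by (intro integral_mono) auto
  also have "\<dots> = c * measure lborel (cube p r)" by simp
  also have "measure lborel (cube p r) = (6 * r) ^ ?N"
    unfolding cube_eq_cbox using r by (subst measure_cbox_cart) auto
  finally show "(\<integral>x. \<bar>c * V (T x)\<bar> \<partial>lebesgue) \<le> c * (6 * r) ^ ?N" .
  have "integrable lborel (\<lambda>x. (c / r) *\<^sub>R G (- ((1 / r) *\<^sub>R p) + (1 / r) *\<^sub>R x))"
    using r G(1) by (intro integrable_scaleR_right) (rule integrable_affine_lborel, simp_all)
  then have gi: "integrable lborel (\<lambda>x. (c / r) *\<^sub>R G (T x))" by (simp add: T add.commute)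
  then show "integrable lebesgue (\<lambda>x. (c / r) *\<^sub>R G (T x))"
    using integrable_completion[of "\<lambda>x. (c / r) *\<^sub>R G (T x)" lborel] gm by simp
  have "(\<integral>x. norm ((c / r) *\<^sub>R G (T x)) \<partial>lebesgue) = (\<integral>x. norm ((c / r) *\<^sub>R G (T x)) \<partial>lborel)"
    using gm by (intro integral_completion) simp
  also have "\<dots> = r ^ ?N * (\<integral>z. norm ((c / r) *\<^sub>R G (T (p + r *\<^sub>R z))) \<partial>lborel)"
    using gm by (subst integral_affine_lborel[OF _ r, of _ p]) auto
  also have "\<dots> = r ^ ?N * ((c / r) * (\<integral>z. norm (G z) \<partial>lborel))"
    using r c by (simp add: T_def)
  also have "\<dots> = c * r ^ (?N - 1) * (\<integral>z. norm (G z) \<partial>lborel)"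
  proof -
    obtain m where "?N = Suc m" by (metis not0_implies_Suc zero_less_card_finite less_irrefl)
    then show ?thesis using r by simp
  qed
  also have "\<dots> \<le> c * r ^ (?N - 1) * C" using G(2) c r by (intro mult_left_mono) auto
  finally show "(\<integral>x. norm ((c / r) *\<^sub>R G (T x)) \<partial>lebesgue) \<le> C * (c * r ^ (?N - 1))" by (simp add: mult_ac)
qed

text \<open>A test function and its derivative are bounded by some \<open>B\<close>, so the pairings
  are dominated by \<open>B\<close> times the summable \<open>L1\<close> norms, and sum and integral
  can be exchanged on both sides of the defining identity.\<close>

lemma suminf_W11:
  fixes v :: "nat \<Rightarrow> real^'n \<Rightarrow> real" and g :: "nat \<Rightarrow> real^'n \<Rightarrow> real^'n"
  assumes v: "\<And>j. integrable lebesgue (v j)" and g: "\<And>j. integrable lebesgue (g j)"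
    and wg: "\<And>j. weak_gradient (v j) (g j)"
    and vs: "\<And>x. summable (\<lambda>j. \<bar>v j x\<bar>)" and gs: "\<And>x. summable (\<lambda>j. norm (g j x))"
    and vS: "summable (\<lambda>j. \<integral>x. \<bar>v j x\<bar> \<partial>lebesgue)" and gS: "summable (\<lambda>j. \<integral>x. norm (g j x) \<partial>lebesgue)"
  shows "(\<lambda>x. \<Sum>j. v j x) \<in> W11"
proof (rule W11I)
  show "integrable lebesgue (\<lambda>x. \<Sum>j. v j x)" "integrable lebesgue (\<lambda>x. \<Sum>j. g j x)"
    using v g vs gs vS gS by (auto intro!: integrable_suminf)
  show "weak_gradient (\<lambda>x. \<Sum>j. v j x) (\<lambda>x. \<Sum>j. g j x)"
    unfolding weak_gradient_iff
  proof (intro allI impI)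
    fix \<phi> :: "real^'n \<Rightarrow> real" and i \<psi> assume \<phi>: "test_fun \<phi>" and \<psi>: "partial_deriv i \<phi> \<psi>"
    note t = test_funD[OF \<phi> \<psi>]
    obtain B where B: "\<And>x. \<bar>\<phi> x\<bar> \<le> B" "\<And>x. \<bar>\<psi> x\<bar> \<le> B" using t(5) by blast
    have B0: "0 \<le> B" using B(1)[of 0] by linarith
    have vs': "summable (\<lambda>j. v j x)" for x using vs[of x] by (rule summable_rabs_cancel)
    have gs': "summable (\<lambda>j. g j x)" for x using gs[of x] by (rule summable_norm_cancel)
    have gi: "(\<Sum>j. g j x) $ i = (\<Sum>j. g j x $ i)" for x
      by (rule bounded_linear.suminf[OF bounded_linear_vec_nth gs'])
    have gs'': "summable (\<lambda>j. g j x $ i)" for x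
      by (rule bounded_linear.summable[OF bounded_linear_vec_nth gs'])
    have I1: "integrable lebesgue (\<lambda>x. v j x * \<psi> x)" for j
      by (rule integrable_mult_bounded[OF v t(4) B(2)])
    have I2: "integrable lebesgue (\<lambda>x. g j x $ i * \<phi> x)" for j
      by (rule integrable_mult_bounded[OF integrable_nth[OF g] t(3) B(1)])
    have le1: "norm (v j x * \<psi> x) \<le> B * \<bar>v j x\<bar>" for j x
      using mult_left_mono[OF B(2)[of x], of "\<bar>v j x\<bar>"] by (simp add: abs_mult mult.commute)
    have le2: "norm (g j x $ i * \<phi> x) \<le> B * norm (g j x)" for j x
      using mult_mono[OF component_le_norm_cart[of "g j x" i] B(1)[of x]] B0 by (simp add: abs_mult mult.commute)
    have s1: "summable (\<lambda>j. norm (v j x * \<psi> x))" for x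
      by (rule summable_comparison_test'[OF summable_mult[OF vs], of 0]) (use le1 in auto)
    have s2: "summable (\<lambda>j. norm (g j x $ i * \<phi> x))" for x
      by (rule summable_comparison_test'[OF summable_mult[OF gs], of 0]) (use le2 in auto)
    have S1: "summable (\<lambda>j. \<integral>x. norm (v j x * \<psi> x) \<partial>lebesgue)"
    proof (rule summable_comparison_test'[OF summable_mult[OF vS, of B], of 0])
      fix j
      have "(\<integral>x. norm (v j x * \<psi> x) \<partial>lebesgue) \<le> (\<integral>x. B * \<bar>v j x\<bar> \<partial>lebesgue)"
        using I1[of j] v[of j] le1 by (intro integral_mono) auto
      then show "norm (\<integral>x. norm (v j x * \<psi> x) \<partial>lebesgue) \<le> B * (\<integral>x. \<bar>v j x\<bar> \<partial>lebesgue)" by simp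
    qed
    have S2: "summable (\<lambda>j. \<integral>x. norm (g j x $ i * \<phi> x) \<partial>lebesgue)"
    proof (rule summable_comparison_test'[OF summable_mult[OF gS, of B], of 0])
      fix j
      have "(\<integral>x. norm (g j x $ i * \<phi> x) \<partial>lebesgue) \<le> (\<integral>x. B * norm (g j x) \<partial>lebesgue)"
        using I2[of j] g[of j] le2 by (intro integral_mono) auto
      then show "norm (\<integral>x. norm (g j x $ i * \<phi> x) \<partial>lebesgue) \<le> B * (\<integral>x. norm (g j x) \<partial>lebesgue)" by simp
    qed
    have "(\<integral>x. (\<Sum>j. v j x) * \<psi> x \<partial>lebesgue) = (\<integral>x. (\<Sum>j. v j x * \<psi> x) \<partial>lebesgue)"
      by (simp add: suminf_mult2[OF vs'])
    also have "\<dots> = (\<Sum>j. \<integral>x. v j x * \<psi> x \<partial>lebesgue)"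
      by (rule integral_suminf[OF I1 _ S1]) (use s1 in auto)
    also have "\<dots> = (\<Sum>j. - (\<integral>x. g j x $ i * \<phi> x \<partial>lebesgue))"
      using wg \<phi> \<psi> unfolding weak_gradient_iff by simp
    also have "\<dots> = - (\<Sum>j. \<integral>x. g j x $ i * \<phi> x \<partial>lebesgue)"
    proof (rule suminf_minus)
      show "summable (\<lambda>j. \<integral>x. g j x $ i * \<phi> x \<partial>lebesgue)"
        by (rule summable_comparison_test'[OF S2, of 0]) (rule integral_norm_bound)
    qed
    also have "(\<Sum>j. \<integral>x. g j x $ i * \<phi> x \<partial>lebesgue) = (\<integral>x. (\<Sum>j. g j x $ i * \<phi> x) \<partial>lebesgue)"
      by (rule integral_suminf[OF I2 _ S2, symmetric]) (use s2 in auto)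
    also have "\<dots> = (\<integral>x. (\<Sum>j. g j x) $ i * \<phi> x \<partial>lebesgue)"
      by (simp add: suminf_mult2[OF gs''] gi)
    finally show "(\<integral>x. (\<Sum>j. v j x) * \<psi> x \<partial>lebesgue) = - (\<integral>x. (\<Sum>j. g j x) $ i * \<phi> x \<partial>lebesgue)" .
  qed
qed

text \<open>For \<open>\<gamma> > -1\<close> two children with ratio
  \<open>2 powr (- 1 / (1 + \<gamma>))\<close> give dimension \<open>1 + \<gamma>\<close>, and this
  ratio is below \<open>1 / 2\<close> because \<open>\<gamma> < 0\<close>. For
  \<open>\<gamma> = -1\<close> the power of \<open>\<rho>\<close> is 1, which forces
  \<open>M = 1\<close>.\<close>

lemma cantor_parameters:
  assumes "-1 \<le> \<gamma>" "\<gamma> < 0"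
  obtains \<rho> :: real and M :: nat where "0 < \<rho>" "\<rho> \<le> 1 / 2" "0 < M" "M \<le> 2" "real M * \<rho> powr (1 + \<gamma>) = 1"
proof (cases "\<gamma> = -1")
  case True
  then show ?thesis by (intro that[of "1/2" 1]) simp_all
next
  case False
  then have \<beta>: "0 < 1 + \<gamma>" "1 + \<gamma> < 1" using assms by simp_all
  define \<rho> where "\<rho> = 2 powr (- 1 / (1 + \<gamma>))"
  have "\<rho> \<le> 2 powr (-1)" unfolding \<rho>_def using \<beta> by (intro powr_mono) (auto simp: field_simps)
  moreover have "\<rho> powr (1 + \<gamma>) = 1 / 2" unfolding \<rho>_def powr_powr using \<beta> by (simp add: powr_minus_divide)
  ultimately show ?thesis by (intro that[of \<rho> 2]) (simp_all add: \<rho>_def powr_minus_divide)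
qed

text \<open>The numbers \<open>B j\<close> can be prescribed freely because neither the gradient
  bound of a block nor the range of levels it detects depends on its depth. The final conjunct,
  agreement with one smooth function off the other cubes, is what the smooth example needs.\<close>

lemma exists_block_series:
  fixes c r :: "nat \<Rightarrow> real" and p :: "nat \<Rightarrow> real^'n" and B :: "nat \<Rightarrow> real"
  assumes \<gamma>: "-1 \<le> \<gamma>" "\<gamma> < 0"
    and c: "\<And>j. c j > 0" and r: "\<And>j. r j > 0" "\<And>j. r j \<le> 1"
    and disj: "\<And>i j. i \<noteq> j \<Longrightarrow> cube (p i) (r i) \<inter> cube (p j) (r j) = {}"
    and summ: "summable (\<lambda>j. c j * r j ^ (CARD('n) - 1))"
  shows "\<exists>u. u \<in> W11
    \<and> (\<forall>j lam. lam > 0 \<longrightarrow> lam * (real CARD('n) + 1) * r j powr (1 + \<gamma>) < c j \<longrightarrow> ennreal (B j) \<le> nu \<gamma> (Eset lam \<gamma> u))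
    \<and> (\<forall>x. (\<forall>j. x \<notin> cube (p j) (r j)) \<longrightarrow> u x = 0)
    \<and> (\<forall>j. \<forall>x \<in> cube (p j) (r j). \<bar>u x\<bar> \<le> c j)
    \<and> (\<forall>j. \<exists>v. smooth_fun v \<and> (\<forall>x. (\<forall>i. i \<noteq> j \<longrightarrow> x \<notin> cube (p i) (r i)) \<longrightarrow> u x = v x))"
proof -
  let ?N = "CARD('n)"
  obtain \<rho> M where \<rho>: "0 < \<rho>" "\<rho> \<le> 1 / 2" and M: "0 < M" "M \<le> 2" and M\<rho>: "real M * \<rho> powr (1 + \<gamma>) = 1"
    using cantor_parameters[OF \<gamma>] by metis
  \<comment> \<open>An arbitrary coordinate, along which all the Cantor functions run.\<close>
  fix i0 :: 'n
  define \<kappa> where "\<kappa> = (real ?N + 1) powr (\<gamma> - real ?N) * 4 ^ (?N - 1) / 4"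
  have \<kappa>: "\<kappa> > 0" by (simp add: \<kappa>_def)
  \<comment> \<open>The least depth for which the lower bound of a single block reaches
    \<open>B j\<close>.\<close>
  define K where "K j = nat \<lceil>B j / (\<kappa> * r j powr (real ?N + \<gamma>))\<rceil>" for j
  have KB: "B j \<le> \<kappa> * real (K j) * r j powr (real ?N + \<gamma>)" for j
  proof -
    have "B j / (\<kappa> * r j powr (real ?N + \<gamma>)) \<le> real (K j)" unfolding K_def by linarith
    moreover have "0 < \<kappa> * r j powr (real ?N + \<gamma>)" using \<kappa> r(1)[of j] by simp
    ultimately show ?thesis by (simp add: divide_le_eq mult_ac)
  qed
  let ?V = "\<lambda>j. block \<rho> M (K j) i0"
  let ?Q = "cbox (vec (-3)) (vec 3) :: (real^'n) set"
  obtain C where C: "0 \<le> C" and "\<And>j. \<exists>G. (\<forall>i. partial_deriv i (?V j) (\<lambda>z. G z $ i)) \<and> (\<forall>z. z \<notin> ?Q \<longrightarrow> G z = 0)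
      \<and> integrable lborel G \<and> (\<integral>z. norm (G z :: real^'n) \<partial>lborel) \<le> C"
    using block_gradient_bound[where 'n='n] \<rho> M by metis
  then obtain G where G: "\<And>j i. partial_deriv i (?V j) (\<lambda>z. G j z $ i)" "\<And>j z. z \<notin> ?Q \<Longrightarrow> G j z = 0"
      "\<And>j. integrable lborel (G j)" "\<And>j. (\<integral>z. norm (G j z :: real^'n) \<partial>lborel) \<le> C" by metis
  have V1: "\<bar>?V j z\<bar> \<le> 1" for j z
    using cantor_fun_bounds[OF \<rho> M, of "K j" "z $ i0"] cutoff_bounds[of z]
    by (simp add: block_def abs_mult mult_le_one)
  define v where "v j x = c j * ?V j ((1 / r j) *\<^sub>R (x - p j))" for j x
  define g where "g j x = (c j / r j) *\<^sub>R G j ((1 / r j) *\<^sub>R (x - p j))" for j x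
  have sb: "smooth_fun (v j)" "\<And>x. x \<notin> cube (p j) (r j) \<Longrightarrow> v j x = 0" "\<And>x. x \<notin> cube (p j) (r j) \<Longrightarrow> g j x = 0"
    "weak_gradient (v j) (g j)" "integrable lebesgue (v j)" "integrable lebesgue (g j)"
    "(\<integral>x. \<bar>v j x\<bar> \<partial>lebesgue) \<le> c j * (6 * r j) ^ ?N"
    "(\<integral>x. norm (g j x) \<partial>lebesgue) \<le> C * (c j * r j ^ (?N - 1))" for j
    unfolding v_def[abs_def] g_def[abs_def]
    using scaled_block[where p="p j", OF c[of j] r(1)[of j] smooth_fun_block G(1)[where j=j] V1 block_eq_0
      G(3)[where j=j] G(4)[where j=j] G(2)[where j=j]]
    by blast+
  \<comment> \<open>Disjointness leaves at most one index, so the series of functions and of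
    gradients reduce to a single term at every point.\<close>
  have one: "finite {j. x \<in> cube (p j) (r j)}" for x
  proof (cases "\<exists>j. x \<in> cube (p j) (r j)")
    case True
    then obtain j where "x \<in> cube (p j) (r j)" by blast
    then have "{j. x \<in> cube (p j) (r j)} \<subseteq> {j}" using disj by blast
    then show ?thesis using finite_subset by blast
  qed simp
  define u where "u x = (\<Sum>j. v j x)" for x
  have uv: "u x = v j x" if "\<And>i. i \<noteq> j \<Longrightarrow> x \<notin> cube (p i) (r i)" for x j
  proof -
    have "(\<Sum>i. v i x) = (\<Sum>i\<in>{j}. v i x)" by (rule suminf_finite) (use sb(2) that in auto)
    then show ?thesis by (simp add: u_def)
  qed
  have uQ: "u x = v j x" if "x \<in> cube (p j) (r j)" for x j
    by (rule uv) (use that disj in blast)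
  have "u \<in> W11"
    unfolding u_def
  proof (rule suminf_W11[of v g])
    show "summable (\<lambda>j. \<bar>v j x\<bar>)" for x
      by (rule summable_finite[OF one[of x]]) (use sb(2) in auto)
    show "summable (\<lambda>j. norm (g j x))" for x
      by (rule summable_finite[OF one[of x]]) (use sb(3) in auto)
    show "summable (\<lambda>j. \<integral>x. \<bar>v j x\<bar> \<partial>lebesgue)"
    proof (rule summable_comparison_test'[OF summable_mult[OF summ, of "6 ^ ?N"], of 0])
      fix j
      obtain m where m: "?N = Suc m" by (metis not0_implies_Suc zero_less_card_finite less_irrefl)
      \<comment> \<open>Since \<open>r j \<le> 1\<close>, the \<open>L1\<close> norm of a block is
        controlled by the same summand as its gradient.\<close>
      have "c j * (6 * r j) ^ ?N = r j * (6 ^ ?N * (c j * r j ^ (?N - 1)))"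
        unfolding m by (simp add: power_mult_distrib)
      also have "\<dots> \<le> 1 * (6 ^ ?N * (c j * r j ^ (?N - 1)))"
        using r[of j] c[of j] by (intro mult_right_mono) auto
      finally show "norm (\<integral>x. \<bar>v j x\<bar> \<partial>lebesgue) \<le> 6 ^ ?N * (c j * r j ^ (?N - 1))"
        using sb(7)[of j] by simp
    qed
    show "summable (\<lambda>j. \<integral>x. norm (g j x) \<partial>lebesgue)"
      by (rule summable_comparison_test'[OF summable_mult[OF summ, of C], of 0]) (use sb(8) in simp)
  qed (rule sb)+
  moreover have "ennreal (B j) \<le> nu \<gamma> (Eset lam \<gamma> u)"
    if lam: "lam > 0" "lam * (real ?N + 1) * r j powr (1 + \<gamma>) < c j" for j lam
  proof -
    have "ennreal (B j) \<le> ennreal (\<kappa> * real (K j) * r j powr (real ?N + \<gamma>))"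
      using KB by (rule ennreal_leI)
    also have "\<dots> \<le> nu \<gamma> (Eset lam \<gamma> u)"
      unfolding \<kappa>_def
    proof (rule nu_block_lower_bound[OF \<rho> M \<gamma> M\<rho> c r(1) lam])
      fix x assume "\<And>i. \<bar>x $ i - p j $ i\<bar> < 3 * r j"
      then have "x \<in> cube (p j) (r j)" by (simp add: cube_def less_imp_le)
      then show "u x = c j * ?V j ((1 / r j) *\<^sub>R (x - p j))" by (simp add: uQ v_def)
    qed
    finally show ?thesis .
  qed
  moreover have "u x = 0" if "\<And>j. x \<notin> cube (p j) (r j)" for x
    using uv[of 0 x] sb(2)[of x 0] that by simp
  moreover have "\<bar>u x\<bar> \<le> c j" if "x \<in> cube (p j) (r j)" for j x
    using uQ[OF that] V1[of j "(1 / r j) *\<^sub>R (x - p j)"] c[of j] by (simp add: v_def abs_mult)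
  moreover have "\<exists>v. smooth_fun v \<and> (\<forall>x. (\<forall>i. i \<noteq> j \<longrightarrow> x \<notin> cube (p i) (r i)) \<longrightarrow> u x = v x)" for j
    using sb(1)[of j] uv by blast
  ultimately show ?thesis by (intro exI[where x=u]) simp
qed

section \<open>Choice of heights and scales\<close>

text \<open>For small \<open>lam\<close> pick \<open>j\<close> with
  \<open>\<theta> ^ Suc j \<le> lam * D < \<theta> ^ j\<close>. The prescribed lower bound then
  gives at least \<open>Suc j\<close> after multiplication by \<open>lam\<close>, and
  \<open>j\<close> tends to infinity as \<open>lam\<close> tends to 0.\<close>

lemma tendsto_infinity_of_geometric_thresholds:
  fixes f :: "real \<Rightarrow> ennreal"
  assumes \<theta>: "0 < \<theta>" "\<theta> < 1" and D: "D > 0"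
    and f: "\<And>j lam. lam > 0 \<Longrightarrow> lam * D < \<theta> ^ j \<Longrightarrow> ennreal (real (Suc j) * D / \<theta> ^ Suc j) \<le> f lam"
  shows "((\<lambda>lam. ennreal lam * f lam) \<longlongrightarrow> \<infinity>) (at_right 0)"
  unfolding infinity_ennreal_def tendsto_top_iff_ennreal
proof (intro allI impI)
  fix l :: real assume "l \<ge> 0"
  obtain J :: nat where J: "l < real J" using reals_Archimedean2 by blast
  have "ennreal l < ennreal lam * f lam" if lam: "0 < lam" "lam < \<theta> ^ J / D" for lam
  proof -
    have "\<exists>j. \<theta> ^ j \<le> lam * D"
      using real_arch_pow_inv[of "lam * D" \<theta>] \<theta> lam D by (auto intro: less_imp_le)
    then have m: "\<theta> ^ (LEAST j. \<theta> ^ j \<le> lam * D) \<le> lam * D" (is "\<theta> ^ ?m \<le> _") by (rule LeastI_ex)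
    have mJ: "J < ?m"
    proof (rule ccontr)
      assume "\<not> J < ?m"
      then have "\<theta> ^ J \<le> \<theta> ^ ?m" using \<theta> by (intro power_decreasing) auto
      then show False using m lam D by (simp add: pos_less_divide_eq)
    qed
    then obtain j where j: "?m = Suc j" by (cases ?m) simp_all
    have "lam * D < \<theta> ^ j" using not_less_Least[of j "\<lambda>j. \<theta> ^ j \<le> lam * D"] j by simp
    then have "ennreal (real (Suc j) * D / \<theta> ^ Suc j) \<le> f lam" by (rule f[OF lam(1)])
    then have "ennreal lam * ennreal (real (Suc j) * D / \<theta> ^ Suc j) \<le> ennreal lam * f lam"
      by (rule mult_left_mono) simp
    moreover have "ennreal l < ennreal lam * ennreal (real (Suc j) * D / \<theta> ^ Suc j)"
    proof -
      have "l < real (Suc j)" using J mJ j by simp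
      also have "\<dots> = real (Suc j) / \<theta> ^ Suc j * \<theta> ^ Suc j" using \<theta> by simp
      also have "\<dots> \<le> real (Suc j) / \<theta> ^ Suc j * (lam * D)"
        using m j \<theta> by (intro mult_left_mono) auto
      also have "\<dots> = lam * (real (Suc j) * D / \<theta> ^ Suc j)" by simp
      finally show ?thesis using lam D \<theta> \<open>l \<ge> 0\<close>
        by (subst ennreal_mult[symmetric]) (auto intro!: ennreal_lessI simp del: power_Suc of_nat_Suc)
    qed
    ultimately show ?thesis by simp
  qed
  moreover have "0 < \<theta> ^ J / D" using \<theta> D by simp
  ultimately show "eventually (\<lambda>lam. ennreal l < ennreal lam * f lam) (at_right 0)"
    unfolding eventually_at_right_field by blast
qed

text \<open>Cubes of side 6 are placed at spacing 7 along one axis, so that the sum is locally a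
  single block, and the heights decay exponentially with the distance from the origin.\<close>

lemma exists_smooth_rapidly_decreasing:
  fixes \<gamma> :: real
  assumes \<gamma>: "-1 \<le> \<gamma>" "\<gamma> < 0"
  shows "\<exists>u :: real^'n \<Rightarrow> real. smooth_fun u \<and> u \<in> dotW11 \<and> rapidly_decreasing u \<and>
         ((\<lambda>lam. ennreal lam * nu \<gamma> (Eset lam \<gamma> u)) \<longlongrightarrow> \<infinity>) (at_right 0)"
proof -
  fix i0 :: 'n
  let ?N = "real CARD('n)"
  \<comment> \<open>The constants make the height \<open>a * \<theta> ^ j\<close> equal to
    \<open>exp (- (7 * j + 3 * ?N))\<close>, where \<open>7 * j + 3 * ?N\<close> bounds the norm on
    the \<open>j\<close>-th cube; hence \<open>u\<close> is dominated by
    \<open>exp (- norm x)\<close>. Dividing by \<open>a\<close> in \<open>D\<close> normalises the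
    thresholds to powers of \<open>\<theta>\<close>.\<close>
  define \<theta> :: real where "\<theta> = exp (-7)"
  define a where "a = exp (- 3 * ?N)"
  define D where "D = (?N + 1) / a"
  have \<theta>: "0 < \<theta>" "\<theta> < 1" by (simp_all add: \<theta>_def)
  have a: "a > 0" and D: "D > 0" by (simp_all add: a_def D_def)
  define p :: "nat \<Rightarrow> real^'n" where "p j = axis i0 (7 * real j)" for j
  have cube: "\<bar>x $ i0 - 7 * real j\<bar> \<le> 3" "norm x \<le> 7 * real j + 3 * ?N" if "x \<in> cube (p j) 1" for x j
  proof -
    have xi: "\<bar>x $ i - p j $ i\<bar> \<le> 3" for i using that by (simp add: cube_def)
    show "\<bar>x $ i0 - 7 * real j\<bar> \<le> 3" using xi[of i0] by (simp add: p_def)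
    have "norm x \<le> (\<Sum>i\<in>UNIV. \<bar>x $ i\<bar>)" by (rule norm_le_l1_cart)
    also have "\<dots> \<le> (\<Sum>i\<in>UNIV. 3 + (if i = i0 then 7 * real j else 0))"
    proof (rule sum_mono)
      fix i show "\<bar>x $ i\<bar> \<le> 3 + (if i = i0 then 7 * real j else 0)"
        using xi[of i] by (auto simp: p_def axis_def)
    qed
    also have "\<dots> = 7 * real j + 3 * ?N" by (simp add: sum.distrib)
    finally show "norm x \<le> 7 * real j + 3 * ?N" .
  qed
  \<comment> \<open>\<open>13 / 4\<close> is the half-side 3 plus \<open>1 / 4\<close>. Twice this
    number is below the spacing 7, so a ball of radius \<open>1 / 4\<close> meets at most one
    cube.\<close>
  have near: "i = j" if "\<bar>s - 7 * real i\<bar> \<le> 13 / 4" "\<bar>s - 7 * real j\<bar> \<le> 13 / 4" for s :: real and i j :: nat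
  proof -
    have "\<bar>real i - real j\<bar> < 1" using that by linarith
    then show ?thesis by linarith
  qed
  have disj: "cube (p i) 1 \<inter> cube (p j) 1 = {}" if "i \<noteq> j" for i j
    using cube(1)[of _ i] cube(1)[of _ j] near[of _ i j] that by force
  have summ: "summable (\<lambda>j. a * \<theta> ^ j * 1 ^ (CARD('n) - 1))"
    using \<theta> by (simp add: summable_geometric summable_mult)
  obtain u :: "real^'n \<Rightarrow> real" where uW: "u \<in> W11"
    and unu: "\<And>j lam. lam > 0 \<Longrightarrow> lam * (?N + 1) * 1 powr (1 + \<gamma>) < a * \<theta> ^ j \<Longrightarrow>
        ennreal (real (Suc j) * D / \<theta> ^ Suc j) \<le> nu \<gamma> (Eset lam \<gamma> u)"
    and u0: "\<And>x. (\<And>j. x \<notin> cube (p j) 1) \<Longrightarrow> u x = 0"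
    and ule: "\<And>j x. x \<in> cube (p j) 1 \<Longrightarrow> \<bar>u x\<bar> \<le> a * \<theta> ^ j"
    and uv: "\<And>j. \<exists>v. smooth_fun v \<and> (\<forall>x. (\<forall>i. i \<noteq> j \<longrightarrow> x \<notin> cube (p i) 1) \<longrightarrow> u x = v x)"
    using exists_block_series[OF \<gamma>, where c="\<lambda>j. a * \<theta> ^ j" and r="\<lambda>j. 1" and p=p
        and B="\<lambda>j. real (Suc j) * D / \<theta> ^ Suc j", OF mult_pos_pos[OF a zero_less_power[OF \<theta>(1)]] _ _ disj summ]
    by (auto simp del: power_Suc of_nat_Suc)
  have "smooth_fun u"
  proof (rule smooth_fun_local, rule allI)
    fix x
    obtain j where j: "\<And>i. i \<noteq> j \<Longrightarrow> \<not> \<bar>x $ i0 - 7 * real i\<bar> \<le> 13 / 4"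
      using near by metis
    obtain v where v: "smooth_fun v" "\<And>x. (\<forall>i. i \<noteq> j \<longrightarrow> x \<notin> cube (p i) 1) \<Longrightarrow> u x = v x" using uv by blast
    have "u y = v y" if y: "y \<in> ball x (1 / 4)" for y
    proof (rule v(2), intro allI impI notI)
      fix i assume i: "i \<noteq> j" "y \<in> cube (p i) 1"
      have "\<bar>x $ i0 - y $ i0\<bar> < 1 / 4"
        using component_le_norm_cart[of "x - y" i0] y by (simp add: dist_norm)
      then show False using cube(1)[OF i(2)] j[OF i(1)] by linarith
    qed
    then show "\<exists>e>0. \<exists>h. smooth_fun h \<and> (\<forall>y\<in>ball x e. u y = h y)"
      using v(1) by (intro exI[of _ "1/4"] exI[of _ v] conjI ballI) auto
  qed
  moreover have "u \<in> dotW11" using uW by (simp add: W11_def)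
  moreover have "rapidly_decreasing u"
    unfolding rapidly_decreasing_def
  proof (intro allI impI)
    fix k :: real assume k: "k \<ge> 0"
    define m where "m = Suc (nat \<lceil>k\<rceil>)"
    have m: "k \<le> real m" "0 < real m" unfolding m_def by linarith+
    have ue: "\<bar>u x\<bar> \<le> exp (- norm x)" for x
    proof (cases "\<exists>j. x \<in> cube (p j) 1")
      case True
      then obtain j where j: "x \<in> cube (p j) 1" by blast
      have "a * \<theta> ^ j = exp (- (7 * real j + 3 * ?N))"
        by (simp add: a_def \<theta>_def exp_of_nat_mult[symmetric] exp_add[symmetric] mult.commute)
      also have "\<dots> \<le> exp (- norm x)" using cube(2)[OF j] by simp
      finally show ?thesis using ule[OF j] by simp
    qed (simp add: u0)
    have "norm x powr k * \<bar>u x\<bar> \<le> 1 + real m ^ m" for x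
    proof (cases "norm x \<le> 1")
      case True
      have "norm x powr k * \<bar>u x\<bar> \<le> 1 * 1"
        using True k ue[of x] by (intro mult_mono powr_le1) (auto intro: order_trans)
      then show ?thesis using zero_le_power[of "real m" m] by linarith
    next
      case False
      have "norm x powr k \<le> norm x powr real m" using False m by (intro powr_mono) auto
      also have "\<dots> = norm x ^ m" using False by (intro powr_realpow) auto
      \<comment> \<open>Raise \<open>t \<le> exp t\<close> to the power \<open>m\<close> at
        \<open>t = norm x / m\<close>; the successor in \<open>m\<close> keeps the denominator
        positive.\<close>
      also have "\<dots> \<le> real m ^ m * exp (norm x)"
      proof -
        have "norm x / real m \<le> exp (norm x / real m)"
          using exp_ge_add_one_self[of "norm x / real m"] by linarith
        then have "(norm x / real m) ^ m \<le> exp (norm x / real m) ^ m" using m by (intro power_mono) auto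
        also have "\<dots> = exp (norm x)" using m by (simp add: exp_of_nat_mult[symmetric])
        finally show ?thesis using m by (simp add: power_divide field_simps)
      qed
      finally have "norm x powr k * \<bar>u x\<bar> \<le> real m ^ m * exp (norm x) * exp (- norm x)"
        using ue[of x] by (intro mult_mono) auto
      also have "\<dots> = real m ^ m" by (simp add: exp_minus)
      finally show ?thesis by simp
    qed
    then show "\<exists>C. \<forall>x. norm x powr k * \<bar>u x\<bar> \<le> C" by blast
  qed
  moreover have "((\<lambda>lam. ennreal lam * nu \<gamma> (Eset lam \<gamma> u)) \<longlongrightarrow> \<infinity>) (at_right 0)"
  proof (rule tendsto_infinity_of_geometric_thresholds[OF \<theta> D])
    fix j and lam :: real assume "lam > 0" "lam * D < \<theta> ^ j"
    then show "ennreal (real (Suc j) * D / \<theta> ^ Suc j) \<le> nu \<gamma> (Eset lam \<gamma> u)"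
      using a by (intro unu) (simp_all add: D_def field_simps)
  qed
  ultimately show ?thesis by blast
qed

text \<open>Block heights \<open>q ^ j\<close> at scale \<open>2 powr - j\<close> give bounded total variation iff \<open>q < 2 ^ (N - 1)\<close>, while the
  levels \<open>lam\<close> detected by the \<open>j\<close>-th block are those below \<open>(q * 2 powr (1 + \<gamma>)) ^ j\<close>, up to a factor.\<close>
lemma exists_compact_support:
  fixes \<gamma> q :: real and B :: "nat \<Rightarrow> real"
  assumes \<gamma>: "-1 \<le> \<gamma>" "\<gamma> < 0" and q: "0 < q" "q < 2 ^ (CARD('n) - 1)"
  shows "\<exists>u :: real^'n \<Rightarrow> real. u \<in> W11 \<and> compact_support u \<and> (\<forall>j lam. lam > 0 \<longrightarrow>
    lam * (real CARD('n) + 1) < (q * 2 powr (1 + \<gamma>)) ^ j \<longrightarrow> ennreal (B j) \<le> nu \<gamma> (Eset lam \<gamma> u))"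
proof -
  fix i0 :: 'n
  let ?N = "real CARD('n)"
  define r :: "nat \<Rightarrow> real" where "r j = (1 / 2) ^ j" for j
  have r: "0 < r j" "r j \<le> 1" for j by (simp_all add: r_def power_le_one)
  \<comment> \<open>The \<open>j\<close>-th cube occupies the range from \<open>7 * r j\<close> to
    \<open>13 * r j\<close> in coordinate \<open>i0\<close>. The scales halve, and
    \<open>13 / 2 < 7\<close>, so the cubes are disjoint while shrinking to the origin.\<close>
  define p :: "nat \<Rightarrow> real^'n" where "p j = axis i0 (10 * r j)" for j
  have xi: "\<bar>x $ i - p j $ i\<bar> \<le> 3 * r j" if "x \<in> cube (p j) (r j)" for x i j using that by (simp add: cube_def)
  have cube: "7 * r j \<le> x $ i0" "x $ i0 \<le> 13 * r j" if "x \<in> cube (p j) (r j)" for x j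
    using xi[OF that, of i0] by (simp_all add: p_def abs_le_iff)
  have lt: "cube (p i) (r i) \<inter> cube (p j) (r j) = {}" if "i < j" for i j
  proof -
    have "r j \<le> r (Suc i)" unfolding r_def using that by (intro power_decreasing) auto
    then have "2 * r j \<le> r i" by (simp add: r_def)
    then show ?thesis using cube(1)[of _ i] cube(2)[of _ j] r(1)[of j] by force
  qed
  have disj: "cube (p i) (r i) \<inter> cube (p j) (r j) = {}" if "i \<noteq> j" for i j
    using lt[of i j] lt[of j i] that by (metis inf_commute linorder_neqE_nat)
  have summ: "summable (\<lambda>j. q ^ j * r j ^ (CARD('n) - 1))"
  proof -
    have "q ^ j * r j ^ (CARD('n) - 1) = (q / 2 ^ (CARD('n) - 1)) ^ j" for j
      by (simp add: r_def power_divide power_one_over power_mult[symmetric] mult.commute)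
    then show ?thesis using q by (simp add: summable_geometric)
  qed
  obtain u :: "real^'n \<Rightarrow> real" where uW: "u \<in> W11"
    and unu: "\<And>j lam. lam > 0 \<Longrightarrow> lam * (?N + 1) * r j powr (1 + \<gamma>) < q ^ j \<Longrightarrow> ennreal (B j) \<le> nu \<gamma> (Eset lam \<gamma> u)"
    and u0: "\<And>x. (\<And>j. x \<notin> cube (p j) (r j)) \<Longrightarrow> u x = 0"
    using exists_block_series[OF \<gamma>, where c="\<lambda>j. q ^ j" and B=B, OF zero_less_power[OF q(1)] r disj summ] by auto
  have "{x. u x \<noteq> 0} \<subseteq> cube 0 5"
  proof (intro subsetI)
    fix x assume "x \<in> {x. u x \<noteq> 0}"
    then obtain j where j: "x \<in> cube (p j) (r j)" using u0 by blast
    have "\<bar>x $ i\<bar> \<le> 15" for i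
      using xi[OF j, of i] r[of j] by (cases "i = i0") (simp_all add: p_def axis_def abs_le_iff)
    then show "x \<in> cube 0 5" by (simp add: cube_def)
  qed
  then have "bounded {x. u x \<noteq> 0}" unfolding cube_eq_cbox using bounded_cbox bounded_subset by blast
  then have "compact_support u" by (simp add: compact_support_def)
  moreover have "ennreal (B j) \<le> nu \<gamma> (Eset lam \<gamma> u)"
    if lam: "lam > 0" "lam * (?N + 1) < (q * 2 powr (1 + \<gamma>)) ^ j" for j lam
  proof (rule unu[OF lam(1)])
    \<comment> \<open>As \<open>r j\<close> is \<open>2 powr - j\<close>, its power
      \<open>1 + \<gamma>\<close> cancels the second factor of the threshold and leaves the height
      \<open>q ^ j\<close>.\<close>
    have "(2 powr (1 + \<gamma>)) ^ j * r j powr (1 + \<gamma>) = 1"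
    proof -
      have "(2 powr (1 + \<gamma>)) ^ j = (2 ^ j) powr (1 + \<gamma>)"
        by (simp add: powr_realpow[symmetric] powr_powr mult.commute)
      then show ?thesis by (simp add: r_def powr_mult[symmetric] power_mult_distrib[symmetric])
    qed
    moreover have "lam * (?N + 1) * r j powr (1 + \<gamma>) < (q * 2 powr (1 + \<gamma>)) ^ j * r j powr (1 + \<gamma>)"
      using lam(2) r(1)[of j] by (intro mult_strict_right_mono) auto
    ultimately show "lam * (?N + 1) * r j powr (1 + \<gamma>) < q ^ j" by (simp add: power_mult_distrib mult.assoc)
  qed
  ultimately show ?thesis using uW by blast
qed

text \<open>\<open>q = 1 / 2\<close> is admissible in every dimension. The thresholds are then the
  powers of \<open>2 powr \<gamma>\<close>, which is below 1 because \<open>\<gamma>\<close> is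
  negative.\<close>

lemma exists_compact_support_limit:
  fixes \<gamma> :: real
  assumes \<gamma>: "-1 \<le> \<gamma>" "\<gamma> < 0"
  shows "\<exists>u :: real^'n \<Rightarrow> real. u \<in> W11 \<and> compact_support u \<and>
    ((\<lambda>lam. ennreal lam * nu \<gamma> (Eset lam \<gamma> u)) \<longlongrightarrow> \<infinity>) (at_right 0)"
proof -
  let ?D = "real CARD('n) + 1"
  define \<theta> where "\<theta> = 1 / 2 * 2 powr (1 + \<gamma>)"
  have "\<theta> = 2 powr \<gamma>" by (simp add: \<theta>_def powr_add)
  then have \<theta>: "0 < \<theta>" "\<theta> < 1" using \<gamma> by (simp_all add: powr_less_one)
  have "(1 / 2 :: real) < 1" by simp
  also have "1 \<le> (2 :: real) ^ (CARD('n) - 1)" by simp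
  finally have q: "(1 / 2 :: real) < 2 ^ (CARD('n) - 1)" .
  obtain u :: "real^'n \<Rightarrow> real" where u: "u \<in> W11" "compact_support u"
    "\<And>j lam. lam > 0 \<Longrightarrow> lam * ?D < \<theta> ^ j \<Longrightarrow> ennreal (real (Suc j) * ?D / \<theta> ^ Suc j) \<le> nu \<gamma> (Eset lam \<gamma> u)"
    using exists_compact_support[OF \<gamma> _ q, of "\<lambda>j. real (Suc j) * ?D / \<theta> ^ Suc j", folded \<theta>_def]
    by (auto simp del: power_Suc of_nat_Suc)
  have "((\<lambda>lam. ennreal lam * nu \<gamma> (Eset lam \<gamma> u)) \<longlongrightarrow> \<infinity>) (at_right 0)"
    by (rule tendsto_infinity_of_geometric_thresholds[OF \<theta> _ u(3)]) auto
  then show ?thesis using u by blast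
qed

text \<open>A \<open>q\<close> strictly between \<open>2 powr (- (1 + \<gamma>))\<close> and
  \<open>2 ^ (CARD('n) - 1)\<close> makes the thresholds grow geometrically, so every level is
  detected by all late blocks. The assumption on dimension and exponent says that this interval is
  nonempty.\<close>

lemma exists_compact_support_infinite:
  fixes \<gamma> :: real
  assumes \<gamma>: "-1 \<le> \<gamma>" "\<gamma> < 0" and N: "CARD('n) \<ge> 2 \<or> -1 < \<gamma>"
  shows "\<exists>u :: real^'n \<Rightarrow> real. u \<in> W11 \<and> compact_support u \<and> (\<forall>lam>0. nu \<gamma> (Eset lam \<gamma> u) = \<infinity>)"
proof -
  let ?D = "real CARD('n) + 1"
  have "- (1 + \<gamma>) < real (CARD('n) - 1)"
  proof (cases "CARD('n) \<ge> 2")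
    case True
    then have "1 \<le> real (CARD('n) - 1)" by linarith
    then show ?thesis using \<gamma> by linarith
  next
    case False
    then have "- (1 + \<gamma>) < 0" using N by simp
    then show ?thesis by (rule less_le_trans) simp
  qed
  then have "2 powr (- (1 + \<gamma>)) < (2::real) powr real (CARD('n) - 1)"
    by (intro powr_less_mono) auto
  moreover have "(2::real) powr real (CARD('n) - 1) = 2 ^ (CARD('n) - 1)"
    by (rule powr_realpow) simp
  ultimately have "2 powr (- (1 + \<gamma>)) < (2::real) ^ (CARD('n) - 1)" by (simp only:)
  then obtain q where q: "2 powr (- (1 + \<gamma>)) < q" "q < 2 ^ (CARD('n) - 1)" using dense by blast
  have q0: "0 < q" using q(1) powr_ge_zero[of 2 "- (1 + \<gamma>)"] by linarith
  define \<theta> where "\<theta> = q * 2 powr (1 + \<gamma>)"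
  have "2 powr (- (1 + \<gamma>)) * 2 powr (1 + \<gamma>) < \<theta>"
    unfolding \<theta>_def using q(1) by (intro mult_strict_right_mono) auto
  then have \<theta>: "1 < \<theta>" by (simp add: powr_add[symmetric])
  obtain u :: "real^'n \<Rightarrow> real" where u: "u \<in> W11" "compact_support u"
    "\<And>j lam. lam > 0 \<Longrightarrow> lam * ?D < \<theta> ^ j \<Longrightarrow> ennreal (real j) \<le> nu \<gamma> (Eset lam \<gamma> u)"
    using exists_compact_support[OF \<gamma> q0 q(2), of real, folded \<theta>_def] by auto
  have "nu \<gamma> (Eset lam \<gamma> u) = \<infinity>" if lam: "lam > 0" for lam
  proof (rule ccontr)
    assume "nu \<gamma> (Eset lam \<gamma> u) \<noteq> \<infinity>"
    then obtain n where n: "nu \<gamma> (Eset lam \<gamma> u) < of_nat n"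
      using ennreal_Ex_less_of_nat by (metis infinity_ennreal_def less_top)
    \<comment> \<open>Once a level is detected it stays detected, since \<open>\<theta> > 1\<close>;
      passing to \<open>max j n\<close> raises the lower bound to at least \<open>n\<close>.\<close>
    obtain j where j: "lam * ?D < \<theta> ^ j" using real_arch_pow[OF \<theta>] by blast
    also have "\<theta> ^ j \<le> \<theta> ^ max j n" using \<theta> by (intro power_increasing) auto
    finally have "ennreal (real (max j n)) \<le> nu \<gamma> (Eset lam \<gamma> u)" by (rule u(3)[OF lam])
    moreover have "(of_nat n :: ennreal) \<le> ennreal (real (max j n))"
      by (simp add: ennreal_of_nat_eq_real_of_nat ennreal_leI)
    ultimately show False using n by (meson leD order_trans)
  qed
  then show ?thesis using u by blast
qed

theorem theorem1p8:
  fixes \<gamma> :: real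
  shows
   "(-1 \<le> \<gamma> \<and> \<gamma> < 0 \<longrightarrow>
      (\<exists>u :: real^'n \<Rightarrow> real. smooth_fun u \<and> u \<in> dotW11 \<and> rapidly_decreasing u \<and>
         ((\<lambda>lam. ennreal lam * nu \<gamma> (Eset lam \<gamma> u)) \<longlongrightarrow> \<infinity>) (at_right 0)))
  \<and> (-1 \<le> \<gamma> \<and> \<gamma> < 0 \<longrightarrow>
      (\<exists>u :: real^'n \<Rightarrow> real. u \<in> W11 \<and> compact_support u \<and>
         ((\<lambda>lam. ennreal lam * nu \<gamma> (Eset lam \<gamma> u)) \<longlongrightarrow> \<infinity>) (at_right 0))
      \<and> meager_in W11_topology
          {u :: real^'n \<Rightarrow> real. u \<in> W11 \<and>
             Limsup (at_right 0) (\<lambda>lam. ennreal lam * nu \<gamma> (Eset lam \<gamma> u)) < \<infinity>})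
  \<and> ((-1 \<le> \<gamma> \<and> \<gamma> < 0 \<and> CARD('n) \<ge> 2) \<or> (-1 < \<gamma> \<and> \<gamma> < 0 \<and> CARD('n) = 1) \<longrightarrow>
      (\<exists>u :: real^'n \<Rightarrow> real. u \<in> W11 \<and> compact_support u \<and>
         (\<forall>lam>0. nu \<gamma> (Eset lam \<gamma> u) = \<infinity>))
      \<and> meager_in W11_topology
          {u :: real^'n \<Rightarrow> real. u \<in> W11 \<and> (\<exists>lam>0. nu \<gamma> (Eset lam \<gamma> u) < \<infinity>)})"
  (is "(?\<gamma> \<longrightarrow> ?i) \<and> (?\<gamma> \<longrightarrow> ?ii) \<and> (?c \<longrightarrow> ?iii)")
proof (intro conjI[of "?\<gamma> \<longrightarrow> ?i"] conjI[of "?\<gamma> \<longrightarrow> ?ii"] impI)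
  assume ?\<gamma>
  then show ?i using exists_smooth_rapidly_decreasing[of \<gamma>] by simp
next
  assume ?\<gamma>
  then obtain u :: "real^'n \<Rightarrow> real" where u: "u \<in> W11" "compact_support u"
    "((\<lambda>lam. ennreal lam * nu \<gamma> (Eset lam \<gamma> u)) \<longlongrightarrow> \<infinity>) (at_right 0)"
    using exists_compact_support_limit[of \<gamma>] by auto
  then show ?ii using meager_bounded_limsup[OF u(1,3)] by blast
next
  assume ?c
  then obtain u :: "real^'n \<Rightarrow> real" where u: "u \<in> W11" "compact_support u"
    "\<And>lam. lam > 0 \<Longrightarrow> nu \<gamma> (Eset lam \<gamma> u) = \<infinity>"
    using exists_compact_support_infinite[of \<gamma>, where 'n='n] by auto
  then show ?iii using meager_finite_nu[OF u(1,3)] by blast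
qed

end
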